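(* Let $\mathbb P$ be a Bernoulli measure on $\partial\mathcal M$ and let $\varphi:\mathcal M\to\mathbb R$ be non-negative and sub-additive, i.e. $\varphi(x\cdot y)\le\varphi(x)+\varphi(y)$ for all $x,y\in\mathcal M$. Let $a\in\Sigma$ and let $(V_n)_{n\ge0}$ be the iterated sequence of the first hitting time of $a$. Then $\varphi(V_n)/|V_n|$ converges $\mathbb P$-a.s. as $n\to\infty$ to a constant, and this constant does not depend on the choice of the piece $a$.
   Context: Let $\Sigma$ be a finite set with at least two elements and $I\subseteq\Sigma\times\Sigma$ a symmetric irreflexive relation such that $(\Sigma,(\Sigma\times\Sigma)\setminus I)$ is connected. The heap monoid $\mathcal M=\mathcal M(\Sigma,I)$ is $\Sigma^*$ modulo the smallest congruence containing $(ab,ba)$ for $(a,b)\in I$; $\cdot$ is concatenation, $0$ the empty heap, $|x|$ the length, $|x|_a$ the number of occurrences of $a$. $x\le y$ iff $y=x\cdot z$ for some $z$. Cliques are heaps formed by distinct pairwise independent pieces; $\mathfrak C$ the nonempty ones; $\gamma\to\gamma'$ iff each piece of $\gamma'$ is dependent on some piece of $\gamma$. Every nonempty heap has a unique Cartier–Foata decomposition $\gamma_1\cdots\gamma_n$ with $\gamma_i\in\mathfrak C$, $\gamma_i\to\gamma_{i+1}$. The boundary $\partial\mathcal M$ is the set of infinite sequences $(\gamma_n)_{n\ge1}$ of nonempty cliques with $\gamma_n\to\gamma_{n+1}$; $\overline{\mathcal M}=\mathcal M\cup\partial\mathcal M$ (finite heaps padded with empty cliques), ordered by $\xi\le\xi'$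 iff $\gamma_1\cdots\gamma_n\le\gamma'_1\cdots\gamma'_n$ for all $n$; nondecreasing sequences have least upper bounds, and $L(\xi)=\{y\in\overline{\mathcal M}:y\le\xi\}$ is a complete lattice. $|\xi|=\infty$ for infinite $\xi$. ${\uparrow}x=\{\xi\in\partial\mathcal M:x\le\xi\}$; $\mathcal F$ the generated $\sigma$-algebra. A Bernoulli measure is a probability $\mathbb P$ on $(\partial\mathcal M,\mathcal F)$ with $\mathbb P({\uparrow}(x\cdot y))=\mathbb P({\uparrow}x)\mathbb P({\uparrow}y)$ and $\mathbb P({\uparrow}x)>0$ for all $x,y$. For $x\in\mathcal M$, $\xi\mapsto x\cdot\xi=\bigvee_n x\cdot\gamma_1\cdots\gamma_n$ is a bijection $\partial\mathcal M\to{\uparrow}x$ with inverse $\xi\mapsto\xi-x$. The first hitting time of $a\in\Sigma$ is the map $V:\partial\mathcal M\to\overline{\mathcal M}$, $\xi_V=\bigwedge H_a(\xi)$, $H_a(\xi)=\{x\in\mathcal M:x\le\xi,\ |x|_a>0\}$, the infimum taken in $L(\xi)$ ($\xi_V=\xi$ if $H_a(\xi)=\emptyset$). Its iterated sequence is $V_0=0$, $V_{n+1}(\xi)=\xi$ if $V_n(\xi)\in\partial\mathcal M$, else $V_{n+1}(\xi)=V_n(\xi)\cdot V(\xi-V_n(\xi))$; each $V_n$ is $\mathbb P$-a.s. in $\mathcal M$. *)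

theory Defs
  imports "HOL-Probability.Probability"
begin

text \<open>Alphabet Sigma = the finite type 'a. I is the independence relation.
  Finite heaps, infinite heaps and generalized heaps are all represented by their
  Cartier-Foata decomposition: a sequence of cliques (nat => 'a set), padded with
  empty cliques in the finite case.\<close>

definition swap_step :: "('a \<Rightarrow> 'a \<Rightarrow> bool) \<Rightarrow> 'a list \<Rightarrow> 'a list \<Rightarrow> bool" where
  "swap_step I u v \<longleftrightarrow> (\<exists>p q a b. I a b \<and> u = p @ [a, b] @ q \<and> v = p @ [b, a] @ q)"

definition heq :: "('a \<Rightarrow> 'a \<Rightarrow> bool) \<Rightarrow> 'a list \<Rightarrow> 'a list \<Rightarrow> bool" where
  "heq I = equivclp (swap_step I)"

definition clique :: "('a \<Rightarrow> 'a \<Rightarrow> bool) \<Rightarrow> 'a set \<Rightarrow> bool" where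
  "clique I c \<longleftrightarrow> (\<forall>a\<in>c. \<forall>b\<in>c. a \<noteq> b \<longrightarrow> I a b)"

definition cf_arrow :: "('a \<Rightarrow> 'a \<Rightarrow> bool) \<Rightarrow> 'a set \<Rightarrow> 'a set \<Rightarrow> bool" where
  "cf_arrow I c c' \<longleftrightarrow> (\<forall>b\<in>c'. \<exists>a\<in>c. \<not> I a b)"

definition cw :: "'a set \<Rightarrow> 'a list" where
  "cw c = (SOME w. distinct w \<and> set w = c)"

definition gheap :: "('a \<Rightarrow> 'a \<Rightarrow> bool) \<Rightarrow> (nat \<Rightarrow> 'a set) \<Rightarrow> bool" where
  "gheap I \<xi> \<longleftrightarrow> (\<forall>n. clique I (\<xi> n)) \<and>
     (\<forall>n. \<xi> (Suc n) \<noteq> {} \<longrightarrow> \<xi> n \<noteq> {} \<and> cf_arrow I (\<xi> n) (\<xi> (Suc n)))"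

definition bdry :: "('a \<Rightarrow> 'a \<Rightarrow> bool) \<Rightarrow> (nat \<Rightarrow> 'a set) set" where
  "bdry I = {\<xi>. gheap I \<xi> \<and> (\<forall>n. \<xi> n \<noteq> {})}"

definition fheaps :: "('a \<Rightarrow> 'a \<Rightarrow> bool) \<Rightarrow> (nat \<Rightarrow> 'a set) set" where
  "fheaps I = {\<xi>. gheap I \<xi> \<and> (\<exists>n. \<forall>m\<ge>n. \<xi> m = {})}"

definition hzero :: "nat \<Rightarrow> 'a set" where
  "hzero = (\<lambda>_. {})"

definition fsupp :: "(nat \<Rightarrow> 'a set) \<Rightarrow> nat" where
  "fsupp \<xi> = (LEAST n. \<forall>m\<ge>n. \<xi> m = {})"

definition hword :: "(nat \<Rightarrow> 'a set) \<Rightarrow> 'a list" where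
  "hword \<xi> = concat (map (\<lambda>k. cw (\<xi> k)) [0..<fsupp \<xi>])"

definition hlen :: "(nat \<Rightarrow> 'a set) \<Rightarrow> nat" where
  "hlen \<xi> = length (hword \<xi>)"

definition hcount :: "'a \<Rightarrow> (nat \<Rightarrow> 'a set) \<Rightarrow> nat" where
  "hcount a \<xi> = count_list (hword \<xi>) a"

definition hmul :: "('a \<Rightarrow> 'a \<Rightarrow> bool) \<Rightarrow> (nat \<Rightarrow> 'a set) \<Rightarrow> (nat \<Rightarrow> 'a set) \<Rightarrow> (nat \<Rightarrow> 'a set)" where
  "hmul I x y = (THE z. z \<in> fheaps I \<and> heq I (hword z) (hword x @ hword y))"

definition hle :: "('a \<Rightarrow> 'a \<Rightarrow> bool) \<Rightarrow> (nat \<Rightarrow> 'a set) \<Rightarrow> (nat \<Rightarrow> 'a set) \<Rightarrow> bool" where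
  "hle I x y \<longleftrightarrow> (\<exists>z\<in>fheaps I. hmul I x z = y)"

definition trunc :: "(nat \<Rightarrow> 'a set) \<Rightarrow> nat \<Rightarrow> (nat \<Rightarrow> 'a set)" where
  "trunc \<xi> n = (\<lambda>k. if k < n then \<xi> k else {})"

definition gle :: "('a \<Rightarrow> 'a \<Rightarrow> bool) \<Rightarrow> (nat \<Rightarrow> 'a set) \<Rightarrow> (nat \<Rightarrow> 'a set) \<Rightarrow> bool" where
  "gle I \<xi> \<xi>' \<longleftrightarrow> (\<forall>n. hle I (trunc \<xi> n) (trunc \<xi>' n))"

definition up :: "('a \<Rightarrow> 'a \<Rightarrow> bool) \<Rightarrow> (nat \<Rightarrow> 'a set) \<Rightarrow> (nat \<Rightarrow> 'a set) set" where
  "up I x = {\<xi> \<in> bdry I. gle I x \<xi>}"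

definition glub :: "('a \<Rightarrow> 'a \<Rightarrow> bool) \<Rightarrow> (nat \<Rightarrow> 'a set) set \<Rightarrow> (nat \<Rightarrow> 'a set)" where
  "glub I S = (THE u. gheap I u \<and> (\<forall>s\<in>S. gle I s u) \<and>
      (\<forall>u'. gheap I u' \<and> (\<forall>s\<in>S. gle I s u') \<longrightarrow> gle I u u'))"

definition glb_in :: "('a \<Rightarrow> 'a \<Rightarrow> bool) \<Rightarrow> (nat \<Rightarrow> 'a set) set \<Rightarrow> (nat \<Rightarrow> 'a set) set \<Rightarrow> (nat \<Rightarrow> 'a set)" where
  "glb_in I L S = (THE y. y \<in> L \<and> (\<forall>s\<in>S. gle I y s) \<and>
      (\<forall>y'\<in>L. (\<forall>s\<in>S. gle I y' s) \<longrightarrow> gle I y' y))"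

definition Lset :: "('a \<Rightarrow> 'a \<Rightarrow> bool) \<Rightarrow> (nat \<Rightarrow> 'a set) \<Rightarrow> (nat \<Rightarrow> 'a set) set" where
  "Lset I \<xi> = {y. gheap I y \<and> gle I y \<xi>}"

definition gmul :: "('a \<Rightarrow> 'a \<Rightarrow> bool) \<Rightarrow> (nat \<Rightarrow> 'a set) \<Rightarrow> (nat \<Rightarrow> 'a set) \<Rightarrow> (nat \<Rightarrow> 'a set)" where
  "gmul I x \<zeta> = glub I (range (\<lambda>n. hmul I x (trunc \<zeta> n)))"

text \<open>xi - x: inverse of the bijection partial M -> up x, xi' |-> x . xi'.\<close>
definition bminus :: "('a \<Rightarrow> 'a \<Rightarrow> bool) \<Rightarrow> (nat \<Rightarrow> 'a set) \<Rightarrow> (nat \<Rightarrow> 'a set) \<Rightarrow> (nat \<Rightarrow> 'a set)" where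
  "bminus I \<xi> x = (THE \<xi>'. \<xi>' \<in> bdry I \<and> gmul I x \<xi>' = \<xi>)"

definition Hset :: "('a \<Rightarrow> 'a \<Rightarrow> bool) \<Rightarrow> 'a \<Rightarrow> (nat \<Rightarrow> 'a set) \<Rightarrow> (nat \<Rightarrow> 'a set) set" where
  "Hset I a \<xi> = {x \<in> fheaps I. gle I x \<xi> \<and> hcount a x > 0}"

definition hit :: "('a \<Rightarrow> 'a \<Rightarrow> bool) \<Rightarrow> 'a \<Rightarrow> (nat \<Rightarrow> 'a set) \<Rightarrow> (nat \<Rightarrow> 'a set)" where
  "hit I a \<xi> = (if Hset I a \<xi> = {} then \<xi> else glb_in I (Lset I \<xi>) (Hset I a \<xi>))"

primrec Viter :: "('a \<Rightarrow> 'a \<Rightarrow> bool) \<Rightarrow> 'a \<Rightarrow> nat \<Rightarrow> (nat \<Rightarrow> 'a set) \<Rightarrow> (nat \<Rightarrow> 'a set)" where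
  "Viter I a 0 = (\<lambda>\<xi>. hzero)"
| "Viter I a (Suc n) = (\<lambda>\<xi>. if Viter I a n \<xi> \<in> bdry I then \<xi>
      else gmul I (Viter I a n \<xi>) (hit I a (bminus I \<xi> (Viter I a n \<xi>))))"

definition indep_ok :: "('a::finite \<Rightarrow> 'a \<Rightarrow> bool) \<Rightarrow> bool" where
  "indep_ok I \<longleftrightarrow> CARD('a) \<ge> 2 \<and> (\<forall>a b. I a b \<longrightarrow> I b a) \<and> (\<forall>a. \<not> I a a) \<and>
     (\<forall>a b. (\<lambda>x y. \<not> I x y)\<^sup>*\<^sup>* a b)"

definition bernoulli :: "('a \<Rightarrow> 'a \<Rightarrow> bool) \<Rightarrow> (nat \<Rightarrow> 'a set) measure \<Rightarrow> bool" where
  "bernoulli I P \<longleftrightarrow> prob_space P \<and> space P = bdry I \<and>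
     sets P = sigma_sets (bdry I) (up I ` fheaps I) \<and>
     (\<forall>x\<in>fheaps I. \<forall>y\<in>fheaps I. measure P (up I (hmul I x y)) = measure P (up I x) * measure P (up I y)) \<and>
     (\<forall>x\<in>fheaps I. measure P (up I x) > 0)"

end

theory Submission
  imports Defs "HOL-Library.Sublist"
begin

text \<open>A trace is determined by its projections to pairs of dependent letters, and prefix order is
  prefix order of all projections. In this picture \<open>V\<^sub>n\<close> is the least prefix of \<open>\<xi>\<close> containing
  \<open>n\<close> occurrences of \<open>a\<close>, and multiplicativity of the measure of up-sets makes the increments of \<open>V\<^sub>n\<close> independent and
  identically distributed. Their length is integrable because, after any cylinder, a walk through the
  whole alphabet occurs with probability bounded below. Kingman's theorem gives the limit for each \<open>a\<close>.
  To compare \<open>a\<close> and \<open>b\<close>, note that \<open>V\<^sub>n\<close> for \<open>a\<close> contains \<open>V\<^sub>m\<close> for \<open>b\<close>, where \<open>m\<close> is the number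
  of \<open>b\<close> in it, and that the latter contains \<open>V\<^sub>j\<close> for \<open>a\<close> at the last time \<open>j < n\<close> at which the
  increment was a fixed walk from \<open>a\<close> to \<open>b\<close> and back; the lengths of these three heaps are
  asymptotically equal.\<close>

section \<open>Subadditive cocycles over ergodic systems\<close>

text \<open>Kingman's theorem divides by \<open>n\<close>; the quotient by the length of V_n is then
  reached through the law of large numbers for that length, whose limit is positive because no
  increment is empty. Comparing with averages over blocks of length \<open>k\<close> needs
  ergodicity of the \<open>k\<close>-th power of the shift, which holds for independent letters but
  not for powers of every ergodic map. The obstacle in comparing \<open>a\<close> with
  \<open>b\<close> is that \<phi> need not be monotone, so a sandwich of heaps does not sandwich
  their \<phi>-values. Only one half is usable: if a heap is a product x . r, its \<phi>-value
  exceeds that of x by at most a constant plus a multiple of the length of r. This gives one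
  inequality between the two limits, and exchanging \<open>a\<close> and \<open>b\<close> gives the
  other. That r is negligible is due to renewal: the fixed walk is a possible increment, hence has
  positive frequency, so its last occurrence before time \<open>n\<close> is at n - o(n).\<close>

lemma sum_lessThan_add:
  fixes f :: "nat \<Rightarrow> real"
  shows "(\<Sum>i<m + k. f i) = (\<Sum>i<m. f i) + (\<Sum>i<k. f (m + i))"
  by (induction k) auto

text \<open>Ergodicity is required of sets that contain their preimage, not only of strictly
  invariant ones: this inclusion is what sub-additivity yields for the exceptional set in
  \<open>cocycle_eventually_gt\<close>. As \<open>T\<close> preserves the measure, such sets are
  invariant up to null sets.\<close>

locale ergodic_system = prob_space N for N :: "'b measure" +
  fixes T :: "'b \<Rightarrow> 'b"
  assumes T_measurable [measurable]: "T \<in> N \<rightarrow>\<^sub>M N"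
    and T_preserves: "distr N N T = N"
    and T_ergodic: "A \<in> sets N \<Longrightarrow> T -` A \<inter> space N \<subseteq> A \<Longrightarrow> prob A = 0 \<or> prob A = 1"
begin

lemma T_pow_measurable [measurable]: "(T ^^ n) \<in> N \<rightarrow>\<^sub>M N"
  by (induction n) (auto simp: id_def intro: measurable_comp)

lemma T_pow_space: "x \<in> space N \<Longrightarrow> (T ^^ n) x \<in> space N"
  by (rule measurable_space[OF T_pow_measurable])

lemma T_pow_add: "(T ^^ n) ((T ^^ m) x) = (T ^^ (m + n)) x"
  by (metis add.commute comp_apply funpow_add)

lemma T_pow_preserves: "distr N N (T ^^ n) = N"
proof (induction n)
  case (Suc n)
  have "distr N N (T ^^ Suc n) = distr (distr N N (T ^^ n)) N T"
    by (subst distr_distr) auto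
  then show ?case by (simp only: Suc T_preserves)
qed (simp add: id_def)

lemma integral_T_pow: "f \<in> borel_measurable N \<Longrightarrow> (\<integral>x. f ((T ^^ n) x) \<partial>N) = (\<integral>x. f x \<partial>N :: real)"
  using integral_distr[OF T_pow_measurable[of n], of f] by (simp add: T_pow_preserves)

lemma integrable_T_pow: "integrable N f \<Longrightarrow> integrable N (\<lambda>x. f ((T ^^ n) x) :: real)"
  using integrable_distr[OF T_pow_measurable[of n], of f] by (simp add: T_pow_preserves)

lemma cocycle_le_sum:
  fixes G :: "nat \<Rightarrow> 'b \<Rightarrow> real"
  assumes sub: "\<And>m n x. x \<in> space N \<Longrightarrow> 1 \<le> m \<Longrightarrow> 1 \<le> n \<Longrightarrow> G (m + n) x \<le> G m x + G n ((T ^^ m) x)"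
    and "x \<in> space N" "1 \<le> n"
  shows "G n x \<le> (\<Sum>i<n. G 1 ((T ^^ i) x))"
  using assms(3)
proof (induction n rule: dec_induct)
  case (step n)
  then show ?case using sub[of x n 1] assms(2) by auto
qed auto

text \<open>Katznelson and Weiss: cut an orbit segment greedily into blocks of length at most \<open>L\<close> on which
  the average is at most \<open>\<beta>\<close>, paying \<open>h\<close> wherever no such block starts.\<close>

lemma cocycle_block_bound:
  fixes G :: "nat \<Rightarrow> 'b \<Rightarrow> real" and \<beta> :: real and L :: nat
  assumes sub: "\<And>m n x. x \<in> space N \<Longrightarrow> 1 \<le> m \<Longrightarrow> 1 \<le> n \<Longrightarrow> G (m + n) x \<le> G m x + G n ((T ^^ m) x)"
  defines "h x \<equiv> \<bar>G 1 x\<bar> + \<bar>\<beta>\<bar>"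
  defines "hb x \<equiv> (if \<forall>m\<in>{1..L}. G m x > real m * \<beta> then h x else 0)"
  assumes "x \<in> space N" "1 \<le> n"
  shows "G n x \<le> real n * \<beta> + (\<Sum>i<n. hb ((T ^^ i) x)) + (\<Sum>i<n. if n \<le> i + L then h ((T ^^ i) x) else 0)"
  using assms(4,5)
proof (induction n arbitrary: x rule: less_induct)
  case (less n)
  let ?R = "\<lambda>n x. (\<Sum>i<n. hb ((T ^^ i) x)) + (\<Sum>i<n. if n \<le> i + L then h ((T ^^ i) x) else 0)"
  have h0: "0 \<le> h y" "0 \<le> hb y" for y by (auto simp: h_def hb_def)
  have shift: "?R (m + k) x = (\<Sum>i<m. hb ((T ^^ i) x)) + (\<Sum>i<m. if m + k \<le> i + L then h ((T ^^ i) x) else 0)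
      + ?R k ((T ^^ m) x)" for m k
    by (simp add: sum_lessThan_add T_pow_add cong: if_cong)
  have Rge: "?R (m + k) x \<ge> ?R k ((T ^^ m) x)" for m k
    unfolding shift using h0 by (simp add: sum_nonneg)
  show ?case
  proof (cases "\<forall>m\<in>{1..L}. G m x > real m * \<beta>")
    case True
    then have hb: "hb x = h x" by (simp add: hb_def)
    have G1: "G 1 x \<le> \<beta> + h x" by (auto simp: h_def)
    show ?thesis
    proof (cases "n = 1")
      case True
      then show ?thesis using G1 hb h0(1)[of x] by auto
    next
      case False
      then obtain k where n: "n = 1 + k" "1 \<le> k" using less.prems(2) by (intro that[of "n - 1"]) auto
      have "G n x \<le> G 1 x + G k (T x)" using sub[of x 1 k] less.prems n by simp
      also have "G k (T x) \<le> real k * \<beta> + ?R k (T x)"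
        using less.IH[of k "T x"] n T_pow_space[OF less.prems(1), of 1] by (simp add: add.assoc)
      finally have "G n x \<le> real n * \<beta> + (hb x + ?R k (T x))"
        using G1 hb n by (simp add: algebra_simps)
      also have "hb x + ?R k (T x) \<le> ?R n x"
      proof -
        have 1: "(\<Sum>i<1. hb ((T ^^ i) x)) = hb x" "(T ^^ 1) x = T x" by simp_all
        have "0 \<le> (\<Sum>i<1. if 1 + k \<le> i + L then h ((T ^^ i) x) else 0)"
          by (rule sum_nonneg) (use h0 in auto)
        then show ?thesis unfolding n shift 1 by linarith
      qed
      finally show ?thesis by (simp add: add.assoc)
    qed
  next
    case False
    then obtain m where m: "1 \<le> m" "m \<le> L" "G m x \<le> real m * \<beta>" by (auto simp: not_less)
    consider "m < n" | "m = n" | "n < m" by linarith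
    then show ?thesis
    proof cases
      case 1
      then obtain k where n: "n = m + k" "1 \<le> k" by (intro that[of "n - m"]) auto
      have "G n x \<le> G m x + G k ((T ^^ m) x)" using sub[of x m k] less.prems m n by simp
      also have "G k ((T ^^ m) x) \<le> real k * \<beta> + ?R k ((T ^^ m) x)"
        using less.IH[of k "(T ^^ m) x"] n m T_pow_space[OF less.prems(1), of m] by (simp add: add.assoc)
      also have "?R k ((T ^^ m) x) \<le> ?R n x" unfolding n by (rule Rge)
      finally show ?thesis using m n by (simp add: algebra_simps)
    next
      case 2
      have "0 \<le> ?R n x" using h0 by (simp add: sum_nonneg)
      then show ?thesis using 2 m by simp
    next
      \<comment> \<open>The good block would overrun the segment. Then \<open>n \<le> L\<close>, so
        the last sum charges \<open>h\<close> at every index and absorbs each \<open>G 1\<close>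
        directly.\<close>
      case 3
      have "G n x \<le> (\<Sum>i<n. G 1 ((T ^^ i) x))" using cocycle_le_sum[OF sub] less.prems by simp
      also have "\<dots> \<le> (\<Sum>i<n. \<beta> + (if n \<le> i + L then h ((T ^^ i) x) else 0))"
        using 3 m by (intro sum_mono) (auto simp: h_def)
      also have "\<dots> = real n * \<beta> + (\<Sum>i<n. if n \<le> i + L then h ((T ^^ i) x) else 0)"
        by (simp add: sum.distrib)
      also have "\<dots> \<le> real n * \<beta> + ?R n x" using h0 by (simp add: sum_nonneg)
      finally show ?thesis by (simp add: add.assoc)
    qed
  qed
qed

text \<open>Integrate \<open>cocycle_block_bound\<close>. Invariance turns the sum of
  \<open>hb\<close> into \<open>n\<close> times one integral, whereas the boundary sum costs at most
  \<open>L\<close> integrals of \<open>h\<close> whatever \<open>n\<close> is. Hence \<gamma> -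
  \<beta> is at most the integral of \<open>hb L\<close>, which tends to 0 by domination, since
  almost every point starts a good block of some finite length.\<close>

lemma cocycle_average_ge:
  fixes G :: "nat \<Rightarrow> 'b \<Rightarrow> real"
  assumes sub: "\<And>m n x. x \<in> space N \<Longrightarrow> 1 \<le> m \<Longrightarrow> 1 \<le> n \<Longrightarrow> G (m + n) x \<le> G m x + G n ((T ^^ m) x)"
    and int: "\<And>n. 1 \<le> n \<Longrightarrow> integrable N (G n)"
    and low: "\<And>n. 1 \<le> n \<Longrightarrow> real n * \<gamma> \<le> (\<integral>x. G n x \<partial>N)"
    and ae: "AE x in N. \<exists>m\<ge>1. G m x \<le> real m * \<beta>"
  shows "\<gamma> \<le> \<beta>"
proof -
  have [measurable]: "G m \<in> borel_measurable N" if "1 \<le> m" for m using int[OF that] by auto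
  define h where "h x = \<bar>G 1 x\<bar> + \<bar>\<beta>\<bar>" for x
  define hb where "hb L x = (if \<forall>m\<in>{1..L}. G m x > real m * \<beta> then h x else 0)" for L x
  have [measurable]: "h \<in> borel_measurable N" unfolding h_def by measurable
  have [measurable]: "hb L \<in> borel_measurable N" for L
  proof -
    have "Measurable.pred N (\<lambda>x. \<forall>m\<in>{1..L}. G m x > real m * \<beta>)"
      by (intro pred_intros_finite) auto
    then show ?thesis unfolding hb_def by measurable
  qed
  have ih: "integrable N h" unfolding h_def using int[of 1] by auto
  have ihb: "integrable N (hb L)" for L
    by (rule Bochner_Integration.integrable_bound[OF ih]) (auto simp: hb_def h_def)
  have h0: "0 \<le> h x" "0 \<le> hb L x" for x L by (auto simp: h_def hb_def)
  have key: "\<gamma> - \<beta> \<le> (\<integral>x. hb L x \<partial>N)" for L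
  proof (rule ccontr)
    define \<delta> where "\<delta> = \<gamma> - \<beta> - (\<integral>x. hb L x \<partial>N)"
    assume "\<not> ?thesis"
    then have "\<delta> > 0" by (simp add: \<delta>_def)
    then obtain n where n: "real L * (\<integral>x. h x \<partial>N) < real n * \<delta>"
      using reals_Archimedean3 by blast
    have h_int: "0 \<le> (\<integral>x. h x \<partial>N)" using h0 by (simp add: integral_nonneg_AE)
    then have "0 \<le> real L * (\<integral>x. h x \<partial>N)" by (intro mult_nonneg_nonneg) auto
    then have n1: "1 \<le> n" using n by (cases n) auto
    have *: "integrable N (\<lambda>x. if n \<le> i + L then h ((T ^^ i) x) else 0)" for i
      using integrable_T_pow[OF ih, of i] by (cases "n \<le> i + L") auto
    have bound: "G n x \<le> real n * \<beta> + (\<Sum>i<n. hb L ((T ^^ i) x)) + (\<Sum>i<n. if n \<le> i + L then h ((T ^^ i) x) else 0)"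
      if "x \<in> space N" for x
      unfolding h_def hb_def by (rule cocycle_block_bound[OF sub that n1])
    have "real n * \<gamma> \<le> (\<integral>x. G n x \<partial>N)" using low n1 .
    also have "\<dots> \<le> (\<integral>x. real n * \<beta> + (\<Sum>i<n. hb L ((T ^^ i) x)) +
        (\<Sum>i<n. if n \<le> i + L then h ((T ^^ i) x) else 0) \<partial>N)"
      by (intro integral_mono Bochner_Integration.integrable_add Bochner_Integration.integrable_sum
          int n1 * integrable_T_pow[OF ihb] bound) simp_all
    also have "\<dots> = real n * \<beta> + (\<integral>x. (\<Sum>i<n. hb L ((T ^^ i) x)) \<partial>N) +
        (\<integral>x. (\<Sum>i<n. if n \<le> i + L then h ((T ^^ i) x) else 0) \<partial>N)"
      using integrable_T_pow[OF ihb] * by (simp add: prob_space)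
    also have "(\<integral>x. (\<Sum>i<n. hb L ((T ^^ i) x)) \<partial>N) = real n * (\<integral>x. hb L x \<partial>N)"
      by (subst Bochner_Integration.integral_sum) (simp_all add: integral_T_pow integrable_T_pow[OF ihb])
    also have "(\<integral>x. (\<Sum>i<n. if n \<le> i + L then h ((T ^^ i) x) else 0) \<partial>N)
        = (\<Sum>i<n. if n \<le> i + L then (\<integral>x. h x \<partial>N) else 0)"
      by (subst Bochner_Integration.integral_sum[OF *]) (auto intro!: sum.cong simp: integral_T_pow)
    also have "(\<Sum>i<n. if n \<le> i + L then (\<integral>x. h x \<partial>N) else 0) = real (card {i. i < n \<and> n \<le> i + L}) * (\<integral>x. h x \<partial>N)"
    proof -
      have "{..<n} \<inter> {i. n \<le> i + L} = {i. i < n \<and> n \<le> i + L}" by auto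
      then show ?thesis by (simp add: sum.If_cases)
    qed
    also have "\<dots> \<le> real L * (\<integral>x. h x \<partial>N)"
    proof (rule mult_right_mono)
      have "card {i. i < n \<and> n \<le> i + L} \<le> card {n - L..<n}" by (intro card_mono) auto
      then show "real (card {i. i < n \<and> n \<le> i + L}) \<le> real L" by simp
    qed (use h_int in simp)
    finally show False using n by (simp add: \<delta>_def algebra_simps)
  qed
  have "(\<lambda>L. \<integral>x. hb L x \<partial>N) \<longlonglongrightarrow> (\<integral>x. 0 \<partial>N)"
  proof (rule integral_dominated_convergence[where w = h])
    show "AE x in N. (\<lambda>L. hb L x) \<longlonglongrightarrow> 0"
      using ae
    proof eventually_elim
      case (elim x)
      then obtain m where "m \<ge> 1" "G m x \<le> real m * \<beta>" by auto
      then have "\<not> (\<forall>m\<in>{1..L}. G m x > real m * \<beta>)" if "m \<le> L" for L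
        using that by (intro notI) (drule bspec[of _ _ m], auto)
      then have "hb L x = 0" if "m \<le> L" for L using that unfolding hb_def by (meson if_not_P)
      then show ?case by (intro tendsto_eventually) (auto simp: eventually_sequentially)
    qed
  qed (use ih in \<open>auto simp: hb_def h_def\<close>)
  then have "\<gamma> - \<beta> \<le> 0" by (intro LIMSEQ_le_const[of _ 0 "\<gamma> - \<beta>"]) (use key in auto)
  then show ?thesis by simp
qed

text \<open>The points whose lower limit of \<open>G n / n\<close> is at most \<beta> form a set
  that contains its preimage, because passing from \<open>T x\<close> to \<open>x\<close> costs only
  the fixed term \<open>G 1 x\<close>. By ergodicity it is null or of full measure, and
  \<open>cocycle_average_ge\<close> excludes full measure.\<close>

lemma cocycle_eventually_gt:
  fixes G :: "nat \<Rightarrow> 'b \<Rightarrow> real"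
  assumes sub: "\<And>m n x. x \<in> space N \<Longrightarrow> 1 \<le> m \<Longrightarrow> 1 \<le> n \<Longrightarrow> G (m + n) x \<le> G m x + G n ((T ^^ m) x)"
    and int: "\<And>n. 1 \<le> n \<Longrightarrow> integrable N (G n)"
    and low: "\<And>n. 1 \<le> n \<Longrightarrow> real n * \<gamma> \<le> (\<integral>x. G n x \<partial>N)"
    and "\<beta> < \<gamma>"
  shows "AE x in N. eventually (\<lambda>n. real n * \<beta> < G n x) sequentially"
proof -
  have [measurable]: "G (Suc m) \<in> borel_measurable N" for m using int[of "Suc m"] by auto
  \<comment> \<open>The countable slack \<open>1 / real (Suc e)\<close> encodes a lower limit of at
    most \<beta>; indices \<open>Suc n\<close> keep clear of \<open>G 0\<close>, about which nothing
    is assumed.\<close>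
  define B where "B = {x\<in>space N. \<forall>e M. \<exists>n. M \<le> n \<and> G (Suc n) x \<le> real (Suc n) * (\<beta> + 1 / real (Suc e))}"
  have [measurable]: "B \<in> sets N" unfolding B_def by measurable
  have "T -` B \<inter> space N \<subseteq> B"
  proof
    fix x assume x: "x \<in> T -` B \<inter> space N"
    have "\<exists>n. M \<le> n \<and> G (Suc n) x \<le> real (Suc n) * (\<beta> + 1 / real (Suc e))" for e M
    proof -
      \<comment> \<open>Half of the slack: it is used at \<open>T x\<close>, and the other half
        absorbs \<open>G 1 x - \<beta>\<close> as soon as \<open>n \<ge> K\<close>.\<close>
      define d where "d = 1 / real (Suc (2 * e + 1))"
      have d: "d > 0" "1 / real (Suc e) = 2 * d" by (auto simp: d_def field_simps)
      obtain K where K: "\<bar>G 1 x\<bar> + \<bar>\<beta>\<bar> < real K * d" using reals_Archimedean3[OF d(1)] by blast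
      obtain n where n: "max M K \<le> n" "G (Suc n) (T x) \<le> real (Suc n) * (\<beta> + d)"
        using x unfolding B_def d_def by blast
      have "G (Suc (Suc n)) x \<le> G 1 x + G (Suc n) (T x)" using sub[of x 1 "Suc n"] x by simp
      also have "\<dots> \<le> G 1 x + real (Suc n) * (\<beta> + d)" using n by simp
      also have "\<dots> \<le> real (Suc (Suc n)) * (\<beta> + 2 * d)"
      proof -
        have "G 1 x - \<beta> \<le> real K * d" using K by auto
        also have "\<dots> \<le> real n * d" using n d by (intro mult_right_mono) auto
        finally show ?thesis using d by (simp add: algebra_simps)
      qed
      finally show ?thesis using n d by (intro exI[of _ "Suc n"]) auto
    qed
    then show "x \<in> B" using x by (auto simp: B_def)
  qed
  moreover have "prob B \<noteq> 1"
  proof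
    assume "prob B = 1"
    then have "AE x in N. x \<in> B" by (simp add: prob_eq_1)
    define \<beta>' where "\<beta>' = (\<beta> + \<gamma>) / 2"
    obtain e where e: "1 / real (Suc e) < \<beta>' - \<beta>"
      using nat_approx_posE[of "\<beta>' - \<beta>"] \<open>\<beta> < \<gamma>\<close> by (auto simp: \<beta>'_def)
    have "AE x in N. \<exists>m\<ge>1. G m x \<le> real m * \<beta>'"
      using \<open>AE x in N. x \<in> B\<close>
    proof eventually_elim
      case (elim x)
      then obtain n where "G (Suc n) x \<le> real (Suc n) * (\<beta> + 1 / real (Suc e))" unfolding B_def by blast
      also have "\<dots> \<le> real (Suc n) * \<beta>'" using e by (intro mult_left_mono) auto
      finally show ?case by (intro exI[of _ "Suc n"]) auto
    qed
    then have "\<gamma> \<le> \<beta>'" using cocycle_average_ge[OF sub int low] by blast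
    then show False using \<open>\<beta> < \<gamma>\<close> by (simp add: \<beta>'_def)
  qed
  ultimately have "prob B = 0" using T_ergodic[of B] by auto
  then have "AE x in N. x \<notin> B" by (simp add: prob_eq_0)
  then show ?thesis
    using AE_space
  proof eventually_elim
    case (elim x)
    then obtain e M where "\<forall>n. \<not> (M \<le> n \<and> G (Suc n) x \<le> real (Suc n) * (\<beta> + 1 / real (Suc e)))"
      unfolding B_def by blast
    then have eM: "real (Suc n) * (\<beta> + 1 / real (Suc e)) < G (Suc n) x" if "M \<le> n" for n
      using that not_le by blast
    have "real n * \<beta> < G n x" if "Suc M \<le> n" for n
    proof -
      obtain k where k: "n = Suc k" "M \<le> k" using \<open>Suc M \<le> n\<close> by (cases n) auto
      have "real (Suc k) * \<beta> \<le> real (Suc k) * (\<beta> + 1 / real (Suc e))" by (intro mult_left_mono) auto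
      from le_less_trans[OF this eM[OF k(2)]] show ?thesis by (simp add: k)
    qed
    then show ?case by (auto simp: eventually_sequentially)
  qed
qed

lemma cocycle_eventually_average_gt:
  fixes G :: "nat \<Rightarrow> 'b \<Rightarrow> real"
  assumes sub: "\<And>m n x. x \<in> space N \<Longrightarrow> 1 \<le> m \<Longrightarrow> 1 \<le> n \<Longrightarrow> G (m + n) x \<le> G m x + G n ((T ^^ m) x)"
    and int: "\<And>n. 1 \<le> n \<Longrightarrow> integrable N (G n)"
    and low: "\<And>n. 1 \<le> n \<Longrightarrow> real n * \<gamma> \<le> (\<integral>x. G n x \<partial>N)"
  shows "AE x in N. \<forall>e. eventually (\<lambda>n. \<gamma> - 1 / real (Suc e) < G n x / real n) sequentially"
  unfolding AE_all_countable
proof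
  fix e
  have "AE x in N. eventually (\<lambda>n. real n * (\<gamma> - 1 / real (Suc e)) < G n x) sequentially"
    by (rule cocycle_eventually_gt[OF sub int low]) auto
  then show "AE x in N. eventually (\<lambda>n. \<gamma> - 1 / real (Suc e) < G n x / real n) sequentially"
  proof eventually_elim
    case (elim x)
    then show ?case using eventually_gt_at_top[of 0]
      by eventually_elim (simp add: field_simps)
  qed
qed

section \<open>The theorems of Birkhoff and Kingman\<close>

lemma tendsto_from_rates:
  fixes f :: "nat \<Rightarrow> real"
  assumes "\<And>e. eventually (\<lambda>n. l - 1 / real (Suc e) < f n) sequentially"
    and "\<And>e. eventually (\<lambda>n. f n < l + 1 / real (Suc e)) sequentially"
  shows "f \<longlonglongrightarrow> l"
proof (rule tendstoI)
  fix d :: real assume "d > 0"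
  then obtain e where e: "1 / real (Suc e) < d" using nat_approx_posE by blast
  show "eventually (\<lambda>n. dist (f n) l < d) sequentially"
    using assms[of e] by eventually_elim (use e in \<open>auto simp: dist_real_def\<close>)
qed

text \<open>Birkhoff sums are additive, so the lower bound for sub-additive cocycles applies to the
  sums of \<open>F\<close> and of \<open>-F\<close> alike.\<close>

theorem birkhoff:
  fixes F :: "'b \<Rightarrow> real"
  assumes F: "integrable N F"
  shows "AE x in N. (\<lambda>n. (\<Sum>i<n. F ((T ^^ i) x)) / real n) \<longlonglongrightarrow> (\<integral>x. F x \<partial>N)"
proof -
  have *: "AE x in N. \<forall>e. eventually (\<lambda>n. (\<integral>x. F x \<partial>N) - 1 / real (Suc e) < (\<Sum>i<n. F ((T ^^ i) x)) / real n) sequentially"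
    if F: "integrable N F" for F
  proof (rule cocycle_eventually_average_gt)
    fix m n x
    show "(\<Sum>i<m + n. F ((T ^^ i) x)) \<le> (\<Sum>i<m. F ((T ^^ i) x)) + (\<Sum>i<n. F ((T ^^ i) ((T ^^ m) x)))"
      by (simp add: sum_lessThan_add T_pow_add)
  next
    fix n :: nat
    show "integrable N (\<lambda>x. \<Sum>i<n. F ((T ^^ i) x))"
      by (intro Bochner_Integration.integrable_sum integrable_T_pow F)
    show "real n * (\<integral>x. F x \<partial>N) \<le> (\<integral>x. (\<Sum>i<n. F ((T ^^ i) x)) \<partial>N)"
      using F by (subst Bochner_Integration.integral_sum) (auto simp: integral_T_pow intro: integrable_T_pow)
  qed
  show ?thesis
    using *[OF F] *[of "\<lambda>x. - F x", OF Bochner_Integration.integrable_minus[OF F]]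
  proof eventually_elim
    case (elim x)
    show ?case
    proof (rule tendsto_from_rates)
      fix e
      show "eventually (\<lambda>n. (\<Sum>i<n. F ((T ^^ i) x)) / real n < (\<integral>x. F x \<partial>N) + 1 / real (Suc e)) sequentially"
        using elim(2)[rule_format, of e] by eventually_elim (simp add: sum_negf)
    qed (use elim(1) in auto)
  qed
qed

end

lemma div_ratio_tendsto:
  assumes "0 < k" shows "(\<lambda>n. real (n div k) / real n) \<longlonglongrightarrow> 1 / real k"
proof (rule real_tendsto_sandwich)
  show "(\<lambda>n. 1 / real k - 1 / real n) \<longlonglongrightarrow> 1 / real k"
    using tendsto_diff[OF tendsto_const lim_1_over_n, of "1 / real k"] by simp
  show "\<forall>\<^sub>F n in sequentially. 1 / real k - 1 / real n \<le> real (n div k) / real n"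
    using eventually_gt_at_top[of 0]
  proof eventually_elim
    case (elim n)
    have "real n = real k * real (n div k) + real (n mod k)" by (metis of_nat_add of_nat_mult mult_div_mod_eq)
    moreover have "real (n mod k) \<le> real k" using assms by (simp add: less_imp_le)
    ultimately have "real n \<le> real k * real (n div k) + real k" by simp
    then have "real n / real k - 1 \<le> real (n div k)" using assms by (simp add: field_simps)
    then have "(real n / real k - 1) / real n \<le> real (n div k) / real n" by (intro divide_right_mono) auto
    then show ?case using elim by (simp add: diff_divide_distrib)
  qed
  show "\<forall>\<^sub>F n in sequentially. real (n div k) / real n \<le> 1 / real k"
    using eventually_gt_at_top[of 0]
  proof eventually_elim
    case (elim n)
    have "real k * real (n div k) \<le> real n" by (metis of_nat_le_iff of_nat_mult div_times_less_eq_dividend mult.commute)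
    then show ?case using elim assms by (simp add: field_simps)
  qed
qed simp

text \<open>The lower bound is \<open>cocycle_eventually_average_gt\<close>, with \<gamma> the
  infimum of the mean averages; nonnegativity keeps it finite. For the upper bound, fix
  \<open>k\<close> with mean average near \<gamma>, cut the orbit into blocks of length
  \<open>k\<close> and apply Birkhoff's theorem to \<open>T ^^ k\<close>, which is why every power
  is assumed ergodic.\<close>

theorem kingman:
  fixes g :: "nat \<Rightarrow> 'b \<Rightarrow> real"
  assumes erg: "\<And>k. 1 \<le> k \<Longrightarrow> ergodic_system N (T ^^ k)"
    and sub: "\<And>m n x. x \<in> space N \<Longrightarrow> 1 \<le> m \<Longrightarrow> 1 \<le> n \<Longrightarrow> g (m + n) x \<le> g m x + g n ((T ^^ m) x)"
    and int: "\<And>n. 1 \<le> n \<Longrightarrow> integrable N (g n)"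
    and nonneg: "\<And>n x. 0 \<le> g n x"
  shows "\<exists>c. AE x in N. (\<lambda>n. g n x / real n) \<longlonglongrightarrow> c"
proof -
  interpret ergodic_system N T using erg[of 1] by simp
  define \<gamma> where "\<gamma> = (INF n\<in>{1..}. (\<integral>x. g n x \<partial>N) / real n)"
  have bdd: "bdd_below ((\<lambda>n. (\<integral>x. g n x \<partial>N) / real n) ` {1..})"
    using nonneg by (intro bdd_belowI[of _ 0]) (auto intro!: divide_nonneg_nonneg integral_nonneg_AE)
  have low: "real n * \<gamma> \<le> (\<integral>x. g n x \<partial>N)" if "1 \<le> n" for n
  proof -
    have "\<gamma> \<le> (\<integral>x. g n x \<partial>N) / real n" unfolding \<gamma>_def using that by (intro cINF_lower bdd) auto
    then show ?thesis using that by (simp add: field_simps)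
  qed
  have up: "AE x in N. eventually (\<lambda>n. g n x / real n < \<gamma> + 1 / real (Suc e)) sequentially" for e
  proof -
    have "\<exists>k\<in>{1..}. (\<integral>x. g k x \<partial>N) / real k < \<gamma> + 1 / real (Suc e)"
      using bdd by (subst cINF_less_iff[symmetric]) (auto simp: \<gamma>_def)
    then obtain k where k: "1 \<le> k" "(\<integral>x. g k x \<partial>N) / real k < \<gamma> + 1 / real (Suc e)" by auto
    interpret Tk: ergodic_system N "T ^^ k" using erg k by simp
    have pk: "((T ^^ k) ^^ j) x = (T ^^ (k * j)) x" for j x by (simp add: funpow_mult mult.commute)
    have blocks: "g (k * q) x \<le> (\<Sum>j<q. g k ((T ^^ (k * j)) x))" if "1 \<le> q" "x \<in> space N" for q x
      using Tk.cocycle_le_sum[of "\<lambda>q. g (k * q)" x q] that k sub[of _ "k * _" "k * _"]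
      by (simp add: pk distrib_left)
    \<comment> \<open>The incomplete last block is charged to \<open>g 1\<close> and written as a
      difference of two Birkhoff sums; after division by \<open>n\<close> this tends to a difference
      of two equal limits.\<close>
    have rest: "g n x \<le> (\<Sum>j<n div k. g k ((T ^^ (k * j)) x)) +
        ((\<Sum>i<n. g 1 ((T ^^ i) x)) - (\<Sum>i<k * (n div k). g 1 ((T ^^ i) x)))"
      if "k \<le> n" "x \<in> space N" for n x
    proof -
      define q r where "q = n div k" and "r = n mod k"
      have q: "1 \<le> q" "n = k * q + r" using that k div_greater_zero_iff[of n k] by (auto simp: q_def r_def)
      have "g n x \<le> g (k * q) x + (\<Sum>i<r. g 1 ((T ^^ (k * q + i)) x))"
      proof (cases "r = 0")
        case False
        have "g n x \<le> g (k * q) x + g r ((T ^^ (k * q)) x)" using sub[of x "k * q" r] that q False k by simp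
        also have "g r ((T ^^ (k * q)) x) \<le> (\<Sum>i<r. g 1 ((T ^^ i) ((T ^^ (k * q)) x)))"
          using False T_pow_space[OF that(2)] by (intro cocycle_le_sum sub) auto
        finally show ?thesis by (simp add: T_pow_add)
      qed (use q in simp)
      also have "(\<Sum>i<r. g 1 ((T ^^ (k * q + i)) x)) = (\<Sum>i<n. g 1 ((T ^^ i) x)) - (\<Sum>i<k * q. g 1 ((T ^^ i) x))"
        unfolding q(2) by (simp add: sum_lessThan_add)
      finally show ?thesis using blocks[OF q(1) that(2)] by (simp add: q_def)
    qed
    show ?thesis
      using Tk.birkhoff[OF int[OF k(1)]] birkhoff[OF int[of 1, simplified]] AE_space
    proof eventually_elim
      case (elim x)
      define A where "A q = (\<Sum>j<q. g k ((T ^^ (k * j)) x))" for q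
      define S where "S n = (\<Sum>i<n. g 1 ((T ^^ i) x))" for n
      have A: "(\<lambda>q. A q / real q) \<longlonglongrightarrow> (\<integral>x. g k x \<partial>N)" using elim(1) by (simp add: pk A_def)
      have S: "(\<lambda>n. S n / real n) \<longlonglongrightarrow> (\<integral>x. g 1 x \<partial>N)" using elim(2) by (simp add: S_def)
      have qinf: "filterlim (\<lambda>n. n div k) at_top sequentially"
      proof (rule filterlim_at_top[THEN iffD2], rule allI)
        fix Z show "\<forall>\<^sub>F n in sequentially. Z \<le> n div k"
          using eventually_ge_at_top[of "Z * k"] by eventually_elim (use k in \<open>simp add: less_eq_div_iff_mult_less_eq\<close>)
      qed
      have kqinf: "filterlim (\<lambda>n. k * (n div k)) at_top sequentially"
        by (rule filterlim_at_top_mono[OF qinf]) (use k in auto)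
      have "(\<lambda>n. A (n div k) / real (n div k) * (real (n div k) / real n) +
          (S n / real n - S (k * (n div k)) / real (k * (n div k)) * (real k * (real (n div k) / real n))))
          \<longlonglongrightarrow> (\<integral>x. g k x \<partial>N) * (1 / real k) + ((\<integral>x. g 1 x \<partial>N) - (\<integral>x. g 1 x \<partial>N) * (real k * (1 / real k)))"
        using k by (intro tendsto_add tendsto_diff tendsto_mult tendsto_const div_ratio_tendsto S
          filterlim_compose[OF A qinf] filterlim_compose[OF S kqinf]) auto
      then have lim: "(\<lambda>n. A (n div k) / real (n div k) * (real (n div k) / real n) +
          (S n / real n - S (k * (n div k)) / real (k * (n div k)) * (real k * (real (n div k) / real n))))
          \<longlonglongrightarrow> (\<integral>x. g k x \<partial>N) / real k" using k by simp
      show ?case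
        using order_tendstoD(2)[OF lim k(2)] eventually_ge_at_top[of k]
      proof eventually_elim
        case (elim n)
        have "0 < n div k" "0 < n" using elim k div_greater_zero_iff[of n k] by auto
        then have "A (n div k) / real (n div k) * (real (n div k) / real n) +
          (S n / real n - S (k * (n div k)) / real (k * (n div k)) * (real k * (real (n div k) / real n)))
          = (A (n div k) + (S n - S (k * (n div k)))) / real n"
          using k by (simp add: field_simps)
        also have "\<dots> \<ge> g n x / real n"
          using rest[OF elim(2) \<open>x \<in> space N\<close>] by (intro divide_right_mono) (auto simp: A_def S_def)
        finally show ?case using elim(1) by linarith
      qed
    qed
  qed
  have "AE x in N. \<forall>e. eventually (\<lambda>n. \<gamma> - 1 / real (Suc e) < g n x / real n) sequentially"
    by (rule cocycle_eventually_average_gt) (auto intro: sub[simplified] int low)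
  moreover have "AE x in N. \<forall>e. eventually (\<lambda>n. g n x / real n < \<gamma> + 1 / real (Suc e)) sequentially"
    unfolding AE_all_countable using up by blast
  ultimately have "AE x in N. (\<lambda>n. g n x / real n) \<longlonglongrightarrow> \<gamma>"
    by eventually_elim (blast intro: tendsto_from_rates)
  then show ?thesis by blast
qed

section \<open>The shift on sequences of independent letters\<close>

lemma sdrop_eq_funpow: "sdrop n = stl ^^ n"
  by (induction n) (auto simp: fun_eq_iff funpow_Suc_right simp del: funpow.simps(2))

locale discrete_prob_space = prob_space M for M :: "'a::countable measure" +
  assumes sets_eq: "sets M = UNIV"
begin

lemma space_stream_space_eq: "space (stream_space M) = UNIV"
proof -
  have "space M = UNIV" using sets_eq sets.sets_into_space[of UNIV M] by auto
  then show ?thesis by (simp add: space_stream_space)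
qed

text \<open>Independence of the first letters from the tail. The shift \<open>n\<close> may exceed
  the length of \<open>xs\<close> because \<open>ergodic_sdrop\<close> uses it with a multiple of
  \<open>k\<close>.\<close>

lemma emeasure_sstart_Int:
  assumes B: "B \<in> sets (stream_space M)" and "length xs \<le> n"
  shows "emeasure (stream_space M) (sstart UNIV xs \<inter> sdrop n -` B) =
    (\<Prod>x\<leftarrow>xs. emeasure M {x}) * emeasure (stream_space M) (sdrop (n - length xs) -` B)"
  using assms(2)
proof (induction xs arbitrary: n)
  case Nil
  then show ?case by simp
next
  case (Cons x xs)
  interpret S: prob_space "stream_space M" by (rule prob_space_stream_space)
  have SS: "sets (stream_space M) = sets (stream_space (count_space UNIV))"
    using sets_eq by (intro sets_stream_space_cong) simp
  have sdrop_sets: "sdrop k -` B \<in> sets (stream_space M)" for k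
    using measurable_sets[OF measurable_sdrop[of k M] B] by (simp add: space_stream_space_eq)
  have meas: "sstart UNIV ys \<inter> sdrop k -` B \<in> sets (stream_space M)" for ys k
    using sdrop_sets[of k] sets_sstart[of UNIV ys] SS by auto
  obtain n' where n: "n = Suc n'" "length xs \<le> n'" using Cons.prems by (cases n) auto
  have "emeasure (stream_space M) (sstart UNIV (x # xs) \<inter> sdrop n -` B)
      = (\<integral>\<^sup>+t. emeasure (stream_space M) {\<omega>\<in>space (stream_space M). t ## \<omega> \<in> sstart UNIV (x # xs) \<inter> sdrop n -` B} \<partial>M)"
    by (rule emeasure_stream_space[OF meas])
  also have "\<dots> = (\<integral>\<^sup>+t. emeasure (stream_space M) (sstart UNIV xs \<inter> sdrop n' -` B) * indicator {x} t \<partial>M)"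
  proof (rule nn_integral_cong)
    fix t
    have "{\<omega>\<in>space (stream_space M). t ## \<omega> \<in> sstart UNIV (x # xs) \<inter> sdrop n -` B}
       = (if t = x then sstart UNIV xs \<inter> sdrop n' -` B else {})"
      by (auto simp: space_stream_space_eq n)
    then show "emeasure (stream_space M) {\<omega>\<in>space (stream_space M). t ## \<omega> \<in> sstart UNIV (x # xs) \<inter> sdrop n -` B}
       = emeasure (stream_space M) (sstart UNIV xs \<inter> sdrop n' -` B) * indicator {x} t" by simp
  qed
  also have "\<dots> = emeasure (stream_space M) (sstart UNIV xs \<inter> sdrop n' -` B) * emeasure M {x}"
    using sets_eq by (simp add: nn_integral_cmult_indicator)
  finally show ?case unfolding n(1) using Cons.IH[OF n(2)] by (simp add: mult_ac del: sdrop.simps)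
qed

lemma emeasure_sstart:
  shows "emeasure (stream_space M) (sstart UNIV xs) = (\<Prod>x\<leftarrow>xs. emeasure M {x})"
proof -
  interpret S: prob_space "stream_space M" by (rule prob_space_stream_space)
  show ?thesis
    using emeasure_sstart_Int[OF sets.top, of xs "length xs"] S.emeasure_space_1 by (simp add: space_stream_space_eq)
qed

lemma sdrop_preserves:
  assumes B: "B \<in> sets (stream_space M)"
  shows "emeasure (stream_space M) (sdrop n -` B) = emeasure (stream_space M) B"
proof (induction n)
  case (Suc n)
  have "sdrop (Suc n) -` B \<in> sets (stream_space M)"
    using measurable_sets[OF measurable_sdrop[of "Suc n" M] B] by (simp add: space_stream_space_eq)
  then have "emeasure (stream_space M) (sdrop (Suc n) -` B)
      = (\<integral>\<^sup>+t. emeasure (stream_space M) {\<omega>\<in>space (stream_space M). t ## \<omega> \<in> sdrop (Suc n) -` B} \<partial>M)"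
    by (rule emeasure_stream_space)
  also have "\<dots> = (\<integral>\<^sup>+t. emeasure (stream_space M) (sdrop n -` B) \<partial>M)"
    by (simp add: space_stream_space_eq vimage_def)
  finally show ?case using Suc emeasure_space_1 by (simp del: sdrop.simps)
qed simp

text \<open>An almost invariant \<open>B\<close> agrees with \<open>sdrop n -` B\<close> for arbitrarily large \<open>n\<close>, so it is
  independent of every cylinder, hence of itself.\<close>

lemma ergodic_sdrop:
  assumes k: "1 \<le> k"
  shows "ergodic_system (stream_space M) (stl ^^ k)"
proof -
  interpret S: prob_space "stream_space M" by (rule prob_space_stream_space)
  have SS: "sets (stream_space M) = sets (stream_space (count_space UNIV))"
    using sets_eq by (intro sets_stream_space_cong) simp
  have "ergodic_system (stream_space M) (sdrop k)"
  proof
    show "sdrop k \<in> stream_space M \<rightarrow>\<^sub>M stream_space M" by measurable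
    show "distr (stream_space M) (stream_space M) (sdrop k) = stream_space M"
      by (rule measure_eqI) (auto simp: emeasure_distr space_stream_space_eq sdrop_preserves)
    fix B assume B: "B \<in> sets (stream_space M)" and inv: "sdrop k -` B \<inter> space (stream_space M) \<subseteq> B"
    have inv': "sdrop (k * m) -` B \<subseteq> B" for m
    proof (induction m)
      case (Suc m)
      have "sdrop (k * Suc m) -` B = sdrop (k * m) -` (sdrop k -` B)"
        by (auto simp: add.commute)
      then show ?case using inv Suc space_stream_space_eq by auto
    qed simp
    have ds: "sdrop n -` B \<in> sets (stream_space M)" for n
      using measurable_sets[OF measurable_sdrop[of n M] B] by (simp add: space_stream_space_eq)
    show "S.prob B = 0 \<or> S.prob B = 1"
    proof (cases "emeasure (stream_space M) B = 0")
      case False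
      \<comment> \<open>Independence from all cylinders means that conditioning on \<open>B\<close>
        does not change the measure; but the conditioned measure gives \<open>B\<close> mass
        1.\<close>
      define U where "U = uniform_measure (stream_space M) B"
      have "U = stream_space M"
      proof (rule stream_space_eq_sstart[of UNIV])
        show "prob_space U" unfolding U_def using False by (intro prob_space_uniform_measure) auto
        fix xs :: "'a list"
        have ss: "sstart UNIV xs \<in> sets (stream_space M)" using SS by simp
        let ?n = "k * length xs"
        have le: "length xs \<le> ?n" using k by simp
        have "emeasure (stream_space M) (B - sdrop ?n -` B) = emeasure (stream_space M) B - emeasure (stream_space M) (sdrop ?n -` B)"
          using inv' B ds by (intro emeasure_Diff) auto
        then have null: "emeasure (stream_space M) (B - sdrop ?n -` B) = 0"
          using sdrop_preserves[OF B] by simp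
        have "emeasure (stream_space M) (B \<inter> sstart UNIV xs)
          \<le> emeasure (stream_space M) ((sstart UNIV xs \<inter> sdrop ?n -` B) \<union> (B - sdrop ?n -` B))"
          using B ds ss by (intro emeasure_mono) auto
        also have "\<dots> \<le> emeasure (stream_space M) (sstart UNIV xs \<inter> sdrop ?n -` B) + 0"
          using B ds ss null by (metis emeasure_subadditive sets.Diff sets.Int)
        finally have "emeasure (stream_space M) (B \<inter> sstart UNIV xs)
          \<le> emeasure (stream_space M) (sstart UNIV xs \<inter> sdrop ?n -` B)" by simp
        moreover have "emeasure (stream_space M) (sstart UNIV xs \<inter> sdrop ?n -` B)
          \<le> emeasure (stream_space M) (B \<inter> sstart UNIV xs)"
          using B ds ss inv'[of "length xs"] by (intro emeasure_mono) auto
        ultimately have "emeasure (stream_space M) (B \<inter> sstart UNIV xs)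
          = emeasure (stream_space M) (sstart UNIV xs) * emeasure (stream_space M) B"
          by (simp add: emeasure_sstart_Int[OF B le] emeasure_sstart sdrop_preserves[OF B])
        then show "emeasure U (sstart UNIV xs) = emeasure (stream_space M) (sstart UNIV xs)"
          unfolding U_def using B ss False
          by (simp add: ennreal_mult_divide_eq S.emeasure_finite)
      qed (auto simp: SS U_def prob_space_stream_space)
      then have "emeasure (stream_space M) B = emeasure U B" by simp
      also have "\<dots> = 1" unfolding U_def using False by (intro emeasure_uniform_measure_1) auto
      finally show ?thesis by (simp add: S.emeasure_eq_measure)
    qed (simp add: S.emeasure_eq_measure)
  qed
  then show ?thesis by (simp add: sdrop_eq_funpow)
qed

end

section \<open>Words modulo commutation\<close>

locale independence =
  fixes I :: "'a::finite \<Rightarrow> 'a \<Rightarrow> bool"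
  assumes I_sym: "I a b \<Longrightarrow> I b a" and I_irrefl: "\<not> I a a"
begin

definition pair_proj :: "'a \<Rightarrow> 'a \<Rightarrow> 'a list \<Rightarrow> 'a list" where
  "pair_proj a b = filter (\<lambda>c. c = a \<or> c = b)"

text \<open>\<open>I\<close> is irreflexive, so the pairs include \<open>a = b\<close>, whose
  projections record the number of each letter. In this form congruence and cancellation are
  immediate; agreement with \<open>heq\<close> is \<open>heq_iff_teq\<close>.\<close>

definition teq :: "'a list \<Rightarrow> 'a list \<Rightarrow> bool" (infix \<open>\<doteq>\<close> 50) where
  "u \<doteq> v \<longleftrightarrow> (\<forall>a b. \<not> I a b \<longrightarrow> pair_proj a b u = pair_proj a b v)"

definition tle :: "'a list \<Rightarrow> 'a list \<Rightarrow> bool" (infix \<open>\<preceq>\<close> 50) where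
  "u \<preceq> v \<longleftrightarrow> (\<forall>a b. \<not> I a b \<longrightarrow> prefix (pair_proj a b u) (pair_proj a b v))"

lemma pair_proj_append [simp]: "pair_proj a b (u @ v) = pair_proj a b u @ pair_proj a b v"
  by (simp add: pair_proj_def)

lemma pair_proj_Nil [simp]: "pair_proj a b [] = []"
  by (simp add: pair_proj_def)

lemma pair_proj_Cons: "pair_proj a b (x # u) = (if x = a \<or> x = b then x # pair_proj a b u else pair_proj a b u)"
  by (simp add: pair_proj_def)

lemma count_pair_proj: "c = a \<or> c = b \<Longrightarrow> count_list (pair_proj a b u) c = count_list u c"
  by (induction u) (auto simp: pair_proj_Cons)

lemma length_pair_proj:
  "length (pair_proj a b u) = (if a = b then count_list u a else count_list u a + count_list u b)"
  by (induction u) (auto simp: pair_proj_Cons)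

lemma teq_refl [simp, intro]: "u \<doteq> u" by (simp add: teq_def)
lemma teq_sym: "u \<doteq> v \<Longrightarrow> v \<doteq> u" by (simp add: teq_def)
lemma teq_trans [trans]: "u \<doteq> v \<Longrightarrow> v \<doteq> w \<Longrightarrow> u \<doteq> w" by (simp add: teq_def)
lemma tle_refl [simp, intro]: "u \<preceq> u" by (simp add: tle_def)
lemma tle_trans [trans]: "u \<preceq> v \<Longrightarrow> v \<preceq> w \<Longrightarrow> u \<preceq> w"
  unfolding tle_def by (meson prefix_order.trans)
lemma tle_antisym: "u \<preceq> v \<Longrightarrow> v \<preceq> u \<Longrightarrow> u \<doteq> v"
  unfolding tle_def teq_def by (meson prefix_order.antisym)
lemma teq_imp_tle: "u \<doteq> v \<Longrightarrow> u \<preceq> v" by (simp add: teq_def tle_def)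
lemma tle_teq_trans [trans]: "u \<preceq> v \<Longrightarrow> v \<doteq> w \<Longrightarrow> u \<preceq> w" by (simp add: teq_def tle_def)

lemma teq_append: "u \<doteq> u' \<Longrightarrow> v \<doteq> v' \<Longrightarrow> u @ v \<doteq> u' @ v'" by (simp add: teq_def)
lemma teq_append_cancel [simp]: "u @ v \<doteq> u @ w \<longleftrightarrow> v \<doteq> w" by (simp add: teq_def)
lemma tle_append_cancel [simp]: "u @ v \<preceq> u @ w \<longleftrightarrow> v \<preceq> w" by (simp add: tle_def)
lemma tle_append [simp, intro]: "u \<preceq> u @ v" by (simp add: tle_def)

lemma Nil_tle [simp, intro]: "[] \<preceq> v" by (simp add: tle_def)

lemma tle_appendD: "u @ v \<preceq> w \<Longrightarrow> u \<preceq> w"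
  using tle_trans tle_append by blast

lemma tle_count: assumes "u \<preceq> v" shows "count_list u a \<le> count_list v a"
proof -
  have "prefix (pair_proj a a u) (pair_proj a a v)" using assms I_irrefl by (simp add: tle_def)
  then have "length (pair_proj a a u) \<le> length (pair_proj a a v)" by (rule prefix_length_le)
  then show ?thesis by (simp add: length_pair_proj)
qed

lemma teq_count: "u \<doteq> v \<Longrightarrow> count_list u a = count_list v a"
  by (meson antisym teq_imp_tle teq_sym tle_count)

lemma length_sum_count: fixes u :: "'a list" shows "length u = (\<Sum>a\<in>UNIV. count_list u a)"
proof (induction u)
  case (Cons x u)
  have "(\<Sum>a\<in>UNIV. count_list (x # u) a) = (\<Sum>a\<in>UNIV. (if a = x then 1 else 0) + count_list u a)"
    by (intro sum.cong) auto
  also have "\<dots> = length (x # u)" using Cons by (simp add: sum.distrib sum.delta)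
  finally show ?case by simp
qed simp

lemma teq_length: "u \<doteq> v \<Longrightarrow> length u = length v"
  by (simp add: length_sum_count teq_count)

lemma tle_length: "u \<preceq> v \<Longrightarrow> length u \<le> length v"
  by (simp add: length_sum_count tle_count sum_mono)

text \<open>Under a common upper bound the projections of \<open>u\<close> and \<open>v\<close> are
  prefixes of the same words, so their lengths decide the comparison. Order arguments thereby become
  counts of letters.\<close>

lemma tle_iff_count:
  assumes "u \<preceq> w" "v \<preceq> w"
  shows "u \<preceq> v \<longleftrightarrow> (\<forall>a. count_list u a \<le> count_list v a)"
proof
  assume *: "\<forall>a. count_list u a \<le> count_list v a"
  show "u \<preceq> v" unfolding tle_def
  proof (intro allI impI)
    fix a b assume "\<not> I a b"
    then have "prefix (pair_proj a b u) (pair_proj a b w)" "prefix (pair_proj a b v) (pair_proj a b w)"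
      using assms by (auto simp: tle_def)
    moreover have "length (pair_proj a b u) \<le> length (pair_proj a b v)"
      using * by (auto simp: length_pair_proj intro: add_mono)
    ultimately show "prefix (pair_proj a b u) (pair_proj a b v)"
      by (meson prefix_length_prefix)
  qed
qed (simp add: tle_count)

section \<open>Agreement of projections with the commutation congruence\<close>

lemma teq_move_front: "(\<And>c. c \<in> set p \<Longrightarrow> I x c) \<Longrightarrow> p @ x # q \<doteq> x # p @ q"
proof (induction p)
  case (Cons c p)
  have "c # p @ x # q \<doteq> c # x # p @ q"
    using Cons teq_append[of "[c]" "[c]" "p @ x # q" "x # p @ q"] by simp
  also have "\<dots> \<doteq> x # c # p @ q"
    using Cons.prems[of c] I_irrefl I_sym by (auto simp: teq_def pair_proj_Cons)
  finally show ?case by simp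
qed simp

lemma teq_move_back: "(\<And>c. c \<in> set q \<Longrightarrow> I x c) \<Longrightarrow> p @ x # q \<doteq> p @ q @ [x]"
  using teq_move_front[of q x "[]"] by (simp add: teq_sym)

lemma swap_step_imp_teq: "swap_step I u v \<Longrightarrow> u \<doteq> v"
  using I_irrefl I_sym by (auto simp: swap_step_def teq_def pair_proj_Cons)

lemma heq_imp_teq: assumes "heq I u v" shows "u \<doteq> v"
  using assms unfolding heq_def
  by (induction rule: equivclp_induct) (blast intro: teq_refl teq_trans teq_sym swap_step_imp_teq)+

lemma heq_trans: "heq I u v \<Longrightarrow> heq I v w \<Longrightarrow> heq I u w"
  unfolding heq_def by (rule equivclp_trans)

lemma heq_sym: "heq I u v \<Longrightarrow> heq I v u"
  unfolding heq_def by (rule equivclp_sym)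

lemma heq_refl: "heq I u u" by (simp add: heq_def)

lemma heq_Cons: assumes "heq I u v" shows "heq I (x # u) (x # v)"
proof -
  have step: "swap_step I (x # a) (x # b)" if "swap_step I a b" for a b
    using that unfolding swap_step_def by (metis append_Cons)
  show ?thesis
    using assms unfolding heq_def
  proof (induction rule: equivclp_induct)
    case (step y z)
    then have "equivclp (swap_step I) (x # y) (x # z)"
      using \<open>\<And>b a. swap_step I a b \<Longrightarrow> swap_step I (x # a) (x # b)\<close> by (blast intro: r_into_equivclp equivclp_sym)
    then show ?case using step equivclp_trans by metis
  qed simp
qed

lemma heq_move_front: "(\<And>c. c \<in> set p \<Longrightarrow> I x c) \<Longrightarrow> heq I (p @ x # q) (x # p @ q)"
proof (induction p)
  case (Cons c p)
  have "heq I (c # p @ x # q) (c # x # p @ q)" using Cons by (intro heq_Cons) auto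
  moreover have "swap_step I (c # x # p @ q) (x # c # p @ q)"
    unfolding swap_step_def using Cons.prems[of c] I_sym
    by (intro exI[of _ "[]"] exI[of _ "p @ q"] exI[of _ c] exI[of _ x]) auto
  ultimately show ?case unfolding heq_def by (metis append_Cons equivclp_trans r_into_equivclp)
qed (simp add: heq_refl)

text \<open>Take the first \<open>x\<close> in \<open>v\<close>. A dependent letter before it would
  make the projection of \<open>v\<close> to that pair start with a letter other than
  \<open>x\<close>.\<close>

lemma Cons_tleE:
  assumes "x # u \<preceq> v"
  obtains p q where "v = p @ x # q" "\<forall>c\<in>set p. I x c"
proof -
  have "count_list v x \<ge> count_list (x # u) x" using assms by (rule tle_count)
  then have "x \<in> set v" using count_list_0_iff[of v x] by fastforce
  then obtain p q where v: "v = p @ x # q" "x \<notin> set p" by (meson split_list_first)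
  have "I x c" if c: "c \<in> set p" for c
  proof (rule ccontr)
    assume "\<not> I x c"
    then have "prefix (pair_proj x c (x # u)) (pair_proj x c v)" using assms by (auto simp: tle_def)
    moreover obtain d r where dr: "pair_proj x c p = d # r" 
      using c by (cases "pair_proj x c p") (auto simp: pair_proj_def filter_empty_conv)
    moreover have "d \<in> set p" using dr filter_is_subset[of "\<lambda>e. e = x \<or> e = c" p] by (simp add: pair_proj_def)
    ultimately show False using v by (auto simp: pair_proj_Cons)
  qed
  with v that show thesis by blast
qed

text \<open>Peel off the letters of \<open>u\<close>: each can be brought to the front of
  \<open>v\<close> by swaps. Thus the projection order is left divisibility in the heap
  monoid.\<close>

lemma tle_imp_ex_heq: "u \<preceq> v \<Longrightarrow> \<exists>w. heq I v (u @ w)"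
proof (induction u arbitrary: v)
  case Nil
  then show ?case by (auto intro: heq_refl)
next
  case (Cons x u)
  obtain p q where v: "v = p @ x # q" "\<forall>c\<in>set p. I x c"
    using Cons.prems by (rule Cons_tleE)
  then have *: "heq I v (x # p @ q)" using heq_move_front by blast
  have "x # u \<preceq> x # p @ q" using Cons.prems heq_imp_teq[OF *] tle_teq_trans by blast
  then have "u \<preceq> p @ q" using tle_append_cancel[of "[x]" u "p @ q"] by simp
  then obtain w where "heq I (p @ q) (u @ w)" using Cons.IH by blast
  then have "heq I v (x # u @ w)" using * heq_Cons heq_trans by blast
  then show ?case by auto
qed

text \<open>In the direction not covered by \<open>heq_imp_teq\<close>, the remainder supplied by
  \<open>tle_imp_ex_heq\<close> is empty for reasons of length.\<close>

lemma heq_iff_teq: "heq I u v \<longleftrightarrow> u \<doteq> v"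
proof
  assume *: "u \<doteq> v"
  then obtain w where w: "heq I v (u @ w)" using tle_imp_ex_heq teq_imp_tle by blast
  then have "length v = length u + length w" using teq_length[OF heq_imp_teq] by fastforce
  with * have "w = []" using teq_length by fastforce
  with w show "heq I u v" by (simp add: heq_sym)
qed (rule heq_imp_teq)

lemma tle_iff: "u \<preceq> v \<longleftrightarrow> (\<exists>w. v \<doteq> u @ w)"
  using tle_imp_ex_heq heq_imp_teq by (meson teq_sym tle_append tle_teq_trans)

lemma tleE: assumes "u \<preceq> v" obtains w where "v \<doteq> u @ w"
  using assms tle_iff by blast

subsection \<open>Cartier-Foata normal forms\<close>

text \<open>Unlike \<open>hword\<close>, this also makes sense for infinite heaps; it is the word of
  the truncation (\<open>hword_trunc\<close>).\<close>

definition lword :: "(nat \<Rightarrow> 'a set) \<Rightarrow> nat \<Rightarrow> 'a list" where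
  "lword \<xi> n = concat (map (\<lambda>k. cw (\<xi> k)) [0..<n])"

lemma distinct_cw [simp]: "distinct (cw (c :: 'a set))" and set_cw [simp]: "set (cw c) = (c :: 'a set)"
proof -
  have "\<exists>w. distinct w \<and> set w = c" using finite_distinct_list[of c] by auto
  then have "distinct (cw c) \<and> set (cw c) = c" unfolding cw_def by (rule someI_ex)
  then show "distinct (cw c)" "set (cw c) = c" by auto
qed

lemma cw_empty [simp]: "cw ({} :: 'a set) = []"
  using set_cw[of "{}"] by (metis set_empty)

lemma count_cw [simp]: "count_list (cw (c :: 'a set)) a = (if a \<in> c then 1 else 0)"
proof -
  have "distinct w \<Longrightarrow> count_list w a = (if a \<in> set w then 1 else 0)" for w
    by (induction w) auto
  then show ?thesis by simp
qed

lemma lword_0 [simp]: "lword \<xi> 0 = []"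
  by (simp add: lword_def)

lemma lword_Suc [simp]: "lword \<xi> (Suc n) = lword \<xi> n @ cw (\<xi> n)"
  by (simp add: lword_def)

lemma lword_cong: "(\<And>k. k < n \<Longrightarrow> \<xi> k = \<xi>' k) \<Longrightarrow> lword \<xi> n = lword \<xi>' n"
  unfolding lword_def by (intro arg_cong[of _ _ concat] map_cong) auto

lemma lword_tle_mono: "m \<le> n \<Longrightarrow> lword \<xi> m \<preceq> lword \<xi> n"
proof (induction n)
  case (Suc n)
  then show ?case using tle_trans[of "lword \<xi> m" "lword \<xi> n"] by (cases "m = Suc n") auto
qed simp

lemma lword_extend_empty: "m \<le> n \<Longrightarrow> (\<And>k. m \<le> k \<Longrightarrow> \<xi> k = {}) \<Longrightarrow> lword \<xi> n = lword \<xi> m"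
  by (induction n rule: dec_induct) auto

lemma fsupp_empty: "\<exists>n. \<forall>m\<ge>n. \<xi> m = {} \<Longrightarrow> fsupp \<xi> \<le> k \<Longrightarrow> \<xi> k = {}"
  unfolding fsupp_def by (smt (verit, del_insts) LeastI_ex)

lemma lword_eq_hword: "z \<in> fheaps I \<Longrightarrow> fsupp z \<le> n \<Longrightarrow> lword z n = hword z"
  unfolding fheaps_def hword_def using lword_extend_empty[of "fsupp z" n z] fsupp_empty[of z]
  by (simp add: lword_def)

lemma lword_tle_hword: "z \<in> fheaps I \<Longrightarrow> lword z n \<preceq> hword z"
  by (metis lword_eq_hword lword_tle_mono nle_le order_refl tle_refl)

lemma hword_trunc: "hword (trunc \<xi> n) = lword \<xi> n"
proof -
  have "fsupp (trunc \<xi> n) \<le> n" unfolding fsupp_def by (rule Least_le) (simp add: trunc_def)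
  then have "lword (trunc \<xi> n) n = lword (trunc \<xi> n) (fsupp (trunc \<xi> n))"
    by (intro lword_extend_empty fsupp_empty exI[of _ n]) (auto simp: trunc_def)
  moreover have "lword (trunc \<xi> n) n = lword \<xi> n" by (rule lword_cong) (simp add: trunc_def)
  ultimately show ?thesis by (simp add: hword_def lword_def)
qed

lemma trunc_fheaps: "gheap I \<xi> \<Longrightarrow> trunc \<xi> n \<in> fheaps I"
  unfolding fheaps_def gheap_def trunc_def by (auto simp: clique_def intro: exI[of _ n])

lemma fheaps_gheap: "z \<in> fheaps I \<Longrightarrow> gheap I z" by (simp add: fheaps_def)
lemma bdry_gheap: "z \<in> bdry I \<Longrightarrow> gheap I z" by (simp add: bdry_def)

text \<open>Identifies a piece across two heaps: in a projection of a common upper bound, an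
  occurrence of \<open>a\<close> is fixed by its rank among the occurrences of
  \<open>a\<close>.\<close>

lemma prefix_snoc_same_count:
  assumes "prefix (p @ [a]) w" "prefix (q @ [a]) w" "count_list p a = count_list q a"
  shows "p = q"
proof -
  consider "prefix (p @ [a]) (q @ [a])" | "prefix (q @ [a]) (p @ [a])"
    using assms prefix_same_cases by blast
  then show ?thesis
  proof cases
    case 1
    then show ?thesis
    proof (cases "prefix (p @ [a]) q")
      case True
      then obtain r where "q = p @ [a] @ r" by (auto elim: prefixE)
      then show ?thesis using assms(3) by simp
    qed (use 1 in auto)
  next
    case 2
    then show ?thesis
    proof (cases "prefix (q @ [a]) p")
      case True
      then obtain r where "p = q @ [a] @ r" by (auto elim: prefixE)
      then show ?thesis using assms(3) by simp
    qed (use 2 in auto)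
  qed
qed

lemma pair_proj_clique_snoc:
  assumes "clique I c" "a \<in> c" "\<not> I a b" shows "pair_proj a b (cw c) = [a]"
proof -
  have b: "b \<in> c \<Longrightarrow> b = a" using assms by (auto simp: clique_def)
  have "set (pair_proj a b (cw c)) = {a}" using assms(2) b by (auto simp: pair_proj_def)
  moreover have "distinct (pair_proj a b (cw c))" by (simp add: pair_proj_def)
  ultimately show ?thesis
    by (metis One_nat_def distinct_card is_singletonI is_singleton_altdef length_0_conv length_Suc_conv list.set_intros(1) singletonD)
qed

text \<open>A piece of level \<open>k\<close> in \<open>\<xi>\<close> that had level \<open>j > k\<close> in \<open>\<xi>'\<close> would sit in \<open>\<xi>'\<close> above a
  dependent piece of level \<open>j - 1 \<ge> k\<close> which does not lie below it in \<open>\<xi>\<close>.\<close>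

lemma lword_tle:
  assumes "gheap I \<xi>" "gheap I \<xi>'" "lword \<xi> n \<preceq> lword \<xi>' m" "k \<le> n"
  shows "lword \<xi> k \<preceq> lword \<xi>' k"
  using assms(4)
proof (induction k)
  case (Suc k)
  then have IH: "lword \<xi> k \<preceq> lword \<xi>' k" by simp
  define M where "M = max m (Suc k)"
  have "lword \<xi> (Suc k) \<preceq> lword \<xi> n" using Suc.prems by (intro lword_tle_mono)
  then have le: "lword \<xi> (Suc k) \<preceq> lword \<xi>' M"
    using assms(3) lword_tle_mono[of m M \<xi>'] by (auto simp: M_def intro: tle_trans)
  have "count_list (lword \<xi> (Suc k)) a \<le> count_list (lword \<xi>' (Suc k)) a" for a
  proof (rule ccontr)
    assume neg: "\<not> ?thesis"
    have cle: "count_list (lword \<xi> k) b \<le> count_list (lword \<xi>' k) b" for b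
      using IH by (rule tle_count)
    have "a \<in> \<xi> k \<and> a \<notin> \<xi>' k \<and> count_list (lword \<xi> k) a = count_list (lword \<xi>' k) a"
      using neg tle_count[OF IH, of a] by (simp split: if_splits)
    then have a: "a \<in> \<xi> k" "a \<notin> \<xi>' k"
      and ceq: "count_list (lword \<xi> k) a = count_list (lword \<xi>' k) a" by auto
    have *: "count_list (lword \<xi>' i) a = count_list (lword \<xi>' k) a"
      if "k \<le> i" "\<And>l. k \<le> l \<Longrightarrow> l < i \<Longrightarrow> a \<notin> \<xi>' l" for i
      using that by (induction i rule: dec_induct) auto
    have "\<exists>j. k \<le> j \<and> j < M \<and> a \<in> \<xi>' j"
    proof (rule ccontr)
      assume "\<not> ?thesis"
      then have "count_list (lword \<xi>' M) a = count_list (lword \<xi>' k) a"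
        by (intro *) (auto simp: M_def)
      then show False using tle_count[OF le, of a] a ceq by simp
    qed
    then obtain j0 where j0: "k \<le> j0 \<and> j0 < M \<and> a \<in> \<xi>' j0" by blast
    define j where "j = (LEAST j. k \<le> j \<and> j < M \<and> a \<in> \<xi>' j)"
    have j: "k \<le> j" "j < M" "a \<in> \<xi>' j" 
      using LeastI[of "\<lambda>j. k \<le> j \<and> j < M \<and> a \<in> \<xi>' j", OF j0] by (auto simp: j_def)
    have least: "a \<notin> \<xi>' l" if "k \<le> l" "l < j" for l
      using not_less_Least[of l "\<lambda>j. k \<le> j \<and> j < M \<and> a \<in> \<xi>' j"] that j by (auto simp: j_def)
    have "j \<noteq> k" using j a by auto
    then obtain i where i: "j = Suc i" "k \<le> i" using j(1) by (cases j) auto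
    have "\<exists>b\<in>\<xi>' i. \<not> I b a" using assms(2) j(3) unfolding gheap_def cf_arrow_def i by blast
    then obtain b where b: "b \<in> \<xi>' i" "\<not> I a b" using I_sym by blast
    have "b \<noteq> a" using least[of i] b i by auto
    have cl: "clique I (\<xi> k)" "clique I (\<xi>' j)" using assms by (auto simp: gheap_def)
    have 1: "pair_proj a b (lword \<xi> (Suc k)) = pair_proj a b (lword \<xi> k) @ [a]"
      using pair_proj_clique_snoc[OF cl(1) a(1) b(2)] by simp
    have 2: "pair_proj a b (lword \<xi>' (Suc j)) = pair_proj a b (lword \<xi>' j) @ [a]"
      using pair_proj_clique_snoc[OF cl(2) j(3) b(2)] by simp
    have "lword \<xi>' (Suc j) \<preceq> lword \<xi>' M" using j by (intro lword_tle_mono) auto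
    \<comment> \<open>Both words are followed by the same occurrence of \<open>a\<close> in the
      projection of the common upper bound, so they carry equally many \<open>b\<close>. But \<xi>'
      has one more \<open>b\<close>, in layer \<open>i\<close>, than its first \<open>k\<close>
      layers hold.\<close>
    then have "pair_proj a b (lword \<xi> k) = pair_proj a b (lword \<xi>' j)"
      using le b(2) 1 2 ceq *[OF j(1) least]
      by (intro prefix_snoc_same_count[of _ a "pair_proj a b (lword \<xi>' M)"])
        (simp_all add: tle_def count_pair_proj flip: 1 2 del: lword_Suc)
    then have "count_list (lword \<xi> k) b = count_list (lword \<xi>' j) b"
      by (metis count_pair_proj)
    also have "\<dots> > count_list (lword \<xi>' k) b"
      using tle_count[OF lword_tle_mono[OF i(2)], of \<xi>' b] b(1) by (simp add: i)
    finally show False using cle[of b] by simp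
  qed
  then show ?case using tle_iff_count[OF le lword_tle_mono, of "Suc k"] by (simp add: M_def del: lword_Suc)
qed simp

lemma lword_teq_imp_eq:
  assumes "\<And>k. lword \<xi> k \<doteq> lword \<xi>' k" shows "\<xi> = \<xi>'"
proof
  fix k
  have "a \<in> \<xi> k \<longleftrightarrow> a \<in> \<xi>' k" for a
    using teq_count[OF assms[of k], of a] teq_count[OF assms[of "Suc k"], of a] by (auto split: if_splits)
  then show "\<xi> k = \<xi>' k" by auto
qed

text \<open>Uniqueness of the Cartier-Foata decomposition: by \<open>lword_tle\<close>, equivalent
  words agree layer by layer.\<close>

lemma fheaps_teq_imp_eq:
  assumes "z \<in> fheaps I" "z' \<in> fheaps I" "hword z \<doteq> hword z'"
  shows "z = z'"
proof (rule lword_teq_imp_eq)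
  fix k
  have tle: "lword x k \<preceq> lword y k" if "x \<in> fheaps I" "y \<in> fheaps I" "hword x \<doteq> hword y" for x y
    using that lword_eq_hword[OF that(2), of "fsupp y"] lword_tle_hword[OF that(1), of k]
    by (intro lword_tle[of x y k "fsupp y"]) (auto intro: tle_teq_trans simp: fheaps_gheap)
  then show "lword z k \<doteq> lword z' k" using assms teq_sym by (intro tle_antisym) auto
qed

lemma distinct_clique_teq:
  "distinct u \<Longrightarrow> distinct v \<Longrightarrow> set u = set v \<Longrightarrow> clique I (set u) \<Longrightarrow> u \<doteq> v"
proof (induction u arbitrary: v)
  case (Cons x u)
  obtain p q where v: "v = p @ x # q" using Cons.prems by (metis list.set_intros(1) split_list)
  have "x \<notin> set p" "set p \<subseteq> set (x # u)" using Cons.prems v by auto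
  then have "I x c" if "c \<in> set p" for c using Cons.prems(4) that unfolding clique_def by force
  then have "v \<doteq> x # p @ q" unfolding v by (rule teq_move_front)
  moreover have "set u = set (p @ q)" using Cons.prems(1-3) unfolding v by auto
  then have "u \<doteq> p @ q" using Cons.prems v by (intro Cons.IH) (auto simp: clique_def)
  ultimately show ?case using teq_append_cancel[of "[x]" u "p @ q"] by (simp, meson teq_sym teq_trans)
qed auto

text \<open>The new piece falls to the first level from which on everything is independent of it.\<close>

lemma fheaps_snoc:
  assumes z: "z \<in> fheaps I" shows "\<exists>z'\<in>fheaps I. hword z' \<doteq> hword z @ [x]"
proof -
  define free where "free k \<longleftrightarrow> (\<forall>m\<ge>k. \<forall>c\<in>z m. I c x)" for k
  define K where "K = (LEAST k. free k)"
  define z' where "z' = z(K := insert x (z K))"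
  obtain N where N: "\<And>m. m \<ge> N \<Longrightarrow> z m = {}" using z by (auto simp: fheaps_def)
  then have "free N" by (auto simp: free_def)
  then have K: "free K" unfolding K_def by (rule LeastI)
  have cl: "clique I (z n)" and ar: "z (Suc n) \<noteq> {} \<Longrightarrow> z n \<noteq> {} \<and> cf_arrow I (z n) (z (Suc n))" for n
    using z by (auto simp: fheaps_def gheap_def)
  \<comment> \<open>The layer just before \<open>K\<close> supports the new piece; otherwise
    \<open>K\<close> could be lowered.\<close>
  have dep: "\<exists>c\<in>z n. \<not> I c x" if "Suc n = K" for n
  proof -
    have "\<not> free n" using not_less_Least[of n free] that by (simp add: K_def)
    then obtain m c where m: "m \<ge> n" "c \<in> z m" "\<not> I c x" by (auto simp: free_def)
    then have "\<not> m \<ge> K" using K by (auto simp: free_def)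
    then have "m = n" using m that by simp
    with m show ?thesis by blast
  qed
  have gh: "gheap I z'"
    unfolding gheap_def
  proof (intro conjI allI impI)
    fix n
    show "clique I (z' n)" using cl[of n] K I_sym by (auto simp: clique_def z'_def free_def)
    assume n: "z' (Suc n) \<noteq> {}"
    show "z' n \<noteq> {}" using n ar[of n] dep[of n] by (auto simp: z'_def split: if_splits)
    show "cf_arrow I (z' n) (z' (Suc n))"
    proof (cases "Suc n = K")
      case True
      then have "z' n = z n" "z' (Suc n) = insert x (z (Suc n))" by (auto simp: z'_def)
      then show ?thesis using dep[OF True] ar[of n] by (auto simp: cf_arrow_def)
    next
      case False
      then have "z' (Suc n) = z (Suc n)" "z n \<subseteq> z' n" by (auto simp: z'_def)
      then show ?thesis using ar[of n] n by (auto simp: cf_arrow_def) blast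
    qed
  qed
  then have fh: "z' \<in> fheaps I" unfolding fheaps_def
    by (auto intro!: exI[of _ "max N (Suc K)"] simp: N z'_def)
  have indep: "I x c" if "n \<ge> K" "c \<in> z n" for n c using K that I_sym by (auto simp: free_def)
  have "x \<notin> z K" using K I_irrefl by (auto simp: free_def)
  have teq: "lword z' n \<doteq> lword z n @ [x]" if "Suc K \<le> n" for n
    using that
  proof (induction n rule: dec_induct)
    case base
    have "lword z' K = lword z K" by (rule lword_cong) (simp add: z'_def)
    moreover have "cw (z' K) \<doteq> cw (z K) @ [x]"
      using \<open>x \<notin> z K\<close> gh by (intro distinct_clique_teq) (auto simp: z'_def gheap_def dest!: spec[of _ K])
    ultimately show ?case by simp
  next
    case (step n)
    have "lword z' (Suc n) \<doteq> (lword z n @ [x]) @ cw (z n)"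
      using teq_append[OF step.IH teq_refl[of "cw (z n)"]] step.hyps by (simp add: z'_def fun_upd_def)
    also have "(lword z n @ [x]) @ cw (z n) \<doteq> lword z n @ cw (z n) @ [x]"
      using teq_move_back[of "cw (z n)" x "lword z n"] indep[of n] step.hyps by simp
    finally show ?case by simp
  qed
  have "hword z' = lword z' (max (Suc K) (max (fsupp z) (fsupp z')))" 
    and "hword z = lword z (max (Suc K) (max (fsupp z) (fsupp z')))"
    using lword_eq_hword fh z by simp_all
  with teq fh show ?thesis by (metis max.cobounded1)
qed

section \<open>Finite heaps as classes of words\<close>

lemma hzero_fheaps: "hzero \<in> fheaps I"
  by (simp add: fheaps_def gheap_def hzero_def clique_def)

lemma hword_hzero [simp]: "hword (hzero :: nat \<Rightarrow> 'a set) = []"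
  using hword_trunc[of hzero 0] by (simp add: trunc_def hzero_def)

lemma ex_fheaps_teq: "\<exists>z\<in>fheaps I. hword z \<doteq> w"
proof (induction w rule: rev_induct)
  case Nil
  show ?case using hzero_fheaps by (intro bexI[of _ hzero]) auto
next
  case (snoc x w)
  then obtain z where z: "z \<in> fheaps I" "hword z \<doteq> w" by blast
  then obtain z' where "z' \<in> fheaps I" "hword z' \<doteq> hword z @ [x]" using fheaps_snoc by blast
  with z teq_append[OF z(2), of "[x]" "[x]"] show ?case by (meson teq_refl teq_trans)
qed

text \<open>The same description as in \<open>hmul\<close>, for an arbitrary word; products then
  become concatenations of representatives (\<open>hmul_heap_of\<close>).\<close>

definition heap_of :: "'a list \<Rightarrow> nat \<Rightarrow> 'a set" where
  "heap_of w = (THE z. z \<in> fheaps I \<and> heq I (hword z) w)"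

lemma heap_of_unique: "z \<in> fheaps I \<Longrightarrow> hword z \<doteq> w \<Longrightarrow> heap_of w = z"
  unfolding heap_of_def heq_iff_teq
  by (rule the_equality) (auto intro: fheaps_teq_imp_eq teq_trans teq_sym)

lemma heap_of_fheaps [simp, intro]: "heap_of w \<in> fheaps I" and hword_heap_of: "hword (heap_of w) \<doteq> w"
  using ex_fheaps_teq heap_of_unique by metis+

lemma heap_of_gheap [simp, intro]: "gheap I (heap_of w)" by (simp add: fheaps_gheap)

lemma heap_of_hword [simp]: "z \<in> fheaps I \<Longrightarrow> heap_of (hword z) = z"
  by (simp add: heap_of_unique)

lemma heap_of_eq_iff: "heap_of u = heap_of v \<longleftrightarrow> u \<doteq> v"
  by (metis hword_heap_of heap_of_fheaps heap_of_unique teq_sym teq_trans)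

lemma heap_of_Nil: "heap_of [] = hzero"
  using heap_of_unique[OF hzero_fheaps, of "[]"] by simp

lemma hmul_eq_heap_of: "hmul I x y = heap_of (hword x @ hword y)"
  by (simp add: hmul_def heap_of_def)

lemma hmul_heap_of: "hmul I (heap_of u) (heap_of v) = heap_of (u @ v)"
  by (simp add: hmul_eq_heap_of heap_of_eq_iff teq_append hword_heap_of)

lemma hlen_heap_of [simp]: "hlen (heap_of u) = length u"
  by (simp add: hlen_def teq_length[OF hword_heap_of])

lemma hcount_heap_of [simp]: "hcount a (heap_of u) = count_list u a"
  by (simp add: hcount_def teq_count[OF hword_heap_of])

lemma hle_iff: assumes "y \<in> fheaps I" shows "hle I x y \<longleftrightarrow> hword x \<preceq> hword y"
proof
  assume "hle I x y"
  then obtain z where "hmul I x z = y" by (auto simp: hle_def)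
  then have "hword x @ hword z \<doteq> hword y" using hword_heap_of teq_sym by (auto simp: hmul_eq_heap_of)
  then show "hword x \<preceq> hword y" using tle_teq_trans by blast
next
  assume "hword x \<preceq> hword y"
  then obtain w where "hword y \<doteq> hword x @ w" by (rule tleE)
  also have "hword x @ w \<doteq> hword x @ hword (heap_of w)" by (simp add: teq_sym hword_heap_of)
  finally have "hmul I x (heap_of w) = y" using assms by (simp add: hmul_eq_heap_of heap_of_unique)
  then show "hle I x y" unfolding hle_def by blast
qed

text \<open>A generalized heap is handled through the finite words below it: by
  \<open>gle_iff\<close> and \<open>gheap_eqI\<close> they determine order and identity, so products
  and hitting times can be treated with little reference to layers.\<close>

definition below :: "'a list \<Rightarrow> (nat \<Rightarrow> 'a set) \<Rightarrow> bool" where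
  "below u \<xi> \<longleftrightarrow> (\<exists>k. u \<preceq> lword \<xi> k)"

lemma below_lword [simp, intro]: "below (lword \<xi> k) \<xi>" by (auto simp: below_def)

lemma tle_below_trans: "u \<preceq> v \<Longrightarrow> below v \<xi> \<Longrightarrow> below u \<xi>"
  unfolding below_def by (meson tle_trans)

lemma teq_below: "u \<doteq> v \<Longrightarrow> below u \<xi> \<longleftrightarrow> below v \<xi>"
  by (meson teq_imp_tle teq_sym tle_below_trans)

lemma belowE2:
  assumes "below u \<xi>" "below v \<xi>" obtains k where "u \<preceq> lword \<xi> k" "v \<preceq> lword \<xi> k"
proof -
  obtain i j where "u \<preceq> lword \<xi> i" "v \<preceq> lword \<xi> j" using assms by (auto simp: below_def)
  then show thesis using lword_tle_mono[of i "max i j" \<xi>] lword_tle_mono[of j "max i j" \<xi>]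
    by (intro that[of "max i j"]) (auto intro: tle_trans)
qed

lemma below_fheaps: "z \<in> fheaps I \<Longrightarrow> below u z \<longleftrightarrow> u \<preceq> hword z"
  unfolding below_def by (metis lword_eq_hword lword_tle_hword order_refl tle_trans)

lemma below_heap_of [simp]: "below u (heap_of w) \<longleftrightarrow> u \<preceq> w"
  using below_fheaps[OF heap_of_fheaps] hword_heap_of by (meson teq_sym tle_teq_trans)

lemma lword_below_iff: "gheap I \<xi> \<Longrightarrow> gheap I \<xi>' \<Longrightarrow> below (lword \<xi> k) \<xi>' \<longleftrightarrow> lword \<xi> k \<preceq> lword \<xi>' k"
  unfolding below_def using lword_tle by blast

lemma gle_iff:
  assumes "gheap I \<xi>" "gheap I \<xi>'"
  shows "gle I \<xi> \<xi>' \<longleftrightarrow> (\<forall>u. below u \<xi> \<longrightarrow> below u \<xi>')"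
proof -
  have "gle I \<xi> \<xi>' \<longleftrightarrow> (\<forall>k. below (lword \<xi> k) \<xi>')"
    using assms by (simp add: gle_def hle_iff trunc_fheaps hword_trunc lword_below_iff)
  also have "\<dots> \<longleftrightarrow> (\<forall>u. below u \<xi> \<longrightarrow> below u \<xi>')"
    by (meson below_def below_lword tle_below_trans)
  finally show ?thesis .
qed

lemma gheap_eqI:
  assumes "gheap I \<xi>" "gheap I \<xi>'" "\<And>u. below u \<xi> \<longleftrightarrow> below u \<xi>'"
  shows "\<xi> = \<xi>'"
proof (rule lword_teq_imp_eq)
  fix k show "lword \<xi> k \<doteq> lword \<xi>' k"
    using assms lword_below_iff below_lword by (intro tle_antisym) blast+
qed

lemma gle_heap_of_iff: "gheap I \<xi> \<Longrightarrow> gle I (heap_of u) \<xi> \<longleftrightarrow> below u \<xi>"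
  by (auto simp: gle_iff intro: tle_below_trans)

lemma mono_bounded_nat_eventually_const:
  fixes f :: "nat \<Rightarrow> nat"
  assumes "mono f" "\<And>n. f n \<le> B"
  shows "\<exists>c. eventually (\<lambda>n. f n = c) sequentially"
proof -
  have "finite (range f)" using assms(2) by (auto intro: finite_subset[of _ "{..B}"])
  then have "Max (range f) \<in> range f" by (intro Max_in) auto
  then obtain N where N: "f N = Max (range f)" by (metis imageE)
  have "f n = f N" if "n \<ge> N" for n
    using monoD[OF assms(1) that] Max_ge[OF \<open>finite (range f)\<close>, of "f n"] N by auto
  then show ?thesis by (auto simp: eventually_sequentially)
qed

text \<open>In the normal forms of the \<open>w n\<close>, the number of each letter within the
  first \<open>k\<close> layers is nondecreasing in \<open>n\<close> and at most \<open>k\<close>,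
  so every layer is eventually constant. This provides the suprema of nondecreasing
  sequences.\<close>

lemma ex_limit_heap:
  assumes mono: "\<And>n. w n \<preceq> w (Suc n)"
  shows "\<exists>\<eta>. gheap I \<eta> \<and> (\<forall>u. below u \<eta> \<longleftrightarrow> (\<exists>n. u \<preceq> w n))"
proof -
  have mono': "w m \<preceq> w n" if "m \<le> n" for m n
    using that by (induction n rule: dec_induct) (auto intro: tle_trans mono)
  define z where "z n = heap_of (w n)" for n
  have lz: "lword (z m) k \<preceq> lword (z n) k" if "m \<le> n" for m n k
    unfolding z_def using mono'[OF that] tle_trans
    by (subst lword_below_iff[symmetric]) (auto intro!: heap_of_gheap simp: below_heap_of,
      metis below_lword below_heap_of tle_trans)
  have cb: "count_list (lword \<xi> k) a \<le> k" for \<xi> k a by (induction k) auto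
  have ec: "\<exists>c. eventually (\<lambda>n. count_list (lword (z n) k) a = c) sequentially" for k a
    using cb by (intro mono_bounded_nat_eventually_const[of _ k]) (auto intro!: monoI tle_count lz)
  then obtain c where c: "\<And>k a. eventually (\<lambda>n. count_list (lword (z n) k) a = c k a) sequentially"
    by metis
  have ex: "\<exists>C. eventually (\<lambda>n. z n k = C) sequentially" for k
  proof -
    have "eventually (\<lambda>n. \<forall>a\<in>UNIV. count_list (lword (z n) k) a = c k a \<and>
        count_list (lword (z n) (Suc k)) a = c (Suc k) a) sequentially"
      by (intro eventually_ball_finite ballI eventually_conj c finite)
    then have "eventually (\<lambda>n. z n k = {a. c (Suc k) a = Suc (c k a)}) sequentially"
    proof eventually_elim
      case (elim n)
      have "a \<in> z n k \<longleftrightarrow> c (Suc k) a = Suc (c k a)" for a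
        using elim by (auto split: if_splits)
      then show ?case by blast
    qed
    then show ?thesis by blast
  qed
  then obtain \<eta> where \<eta>: "\<And>k. eventually (\<lambda>n. z n k = \<eta> k) sequentially" by metis
  have \<eta>': "eventually (\<lambda>n. \<forall>k<K. z n k = \<eta> k) sequentially" for K
  proof -
    have "eventually (\<lambda>n. \<forall>k\<in>{..<K}. z n k = \<eta> k) sequentially"
      by (intro eventually_ball_finite ballI \<eta> finite_lessThan)
    then show ?thesis by (simp add: Ball_def)
  qed
  have ex': "\<exists>n\<ge>m. \<forall>k<K. z n k = \<eta> k" for K m
  proof -
    obtain N where "\<forall>n\<ge>N. \<forall>k<K. z n k = \<eta> k" using \<eta>'[of K] unfolding eventually_sequentially by blast
    then show ?thesis by (intro exI[of _ "max m N"]) auto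
  qed
  have "gheap I \<eta>" unfolding gheap_def
  proof (intro conjI allI)
    fix k
    obtain n where "\<forall>l<Suc (Suc k). z n l = \<eta> l" using ex' by blast
    then have *: "z n k = \<eta> k" "z n (Suc k) = \<eta> (Suc k)" by auto
    have "gheap I (z n)" by (simp add: z_def)
    then show "clique I (\<eta> k)" "\<eta> (Suc k) \<noteq> {} \<longrightarrow> \<eta> k \<noteq> {} \<and> cf_arrow I (\<eta> k) (\<eta> (Suc k))"
      unfolding gheap_def *[symmetric] by blast+
  qed
  moreover have "below u \<eta> \<longleftrightarrow> (\<exists>n. u \<preceq> w n)" for u
  proof
    assume "below u \<eta>"
    then obtain K where "u \<preceq> lword \<eta> K" by (auto simp: below_def)
    moreover obtain n where "\<forall>k<K. z n k = \<eta> k" using ex' by blast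
    then have "lword \<eta> K = lword (z n) K" by (intro lword_cong) auto
    ultimately have "below u (z n)" by (auto simp: below_def)
    then show "\<exists>n. u \<preceq> w n" by (auto simp: z_def)
  next
    assume "\<exists>n. u \<preceq> w n"
    then obtain n where "below u (z n)" by (auto simp: z_def)
    then obtain K where K: "u \<preceq> lword (z n) K" by (auto simp: below_def)
    obtain m where m: "m \<ge> n" "\<forall>k<K. z m k = \<eta> k" using ex' by blast
    then have "lword \<eta> K = lword (z m) K" by (intro lword_cong) auto
    with tle_trans[OF K lz[OF m(1)]] show "below u \<eta>" unfolding below_def by metis
  qed
  ultimately show ?thesis by blast
qed

subsection \<open>Hitting times\<close>

text \<open>As a heap, such a word has no maximal piece except its last letter.\<close>

definition pyramid :: "'a list \<Rightarrow> bool" where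
  "pyramid v \<longleftrightarrow> (\<forall>p c q. v = p @ c # q \<and> q \<noteq> [] \<longrightarrow> (\<exists>d\<in>set q. \<not> I c d))"

text \<open>By \<open>hitword_minimal\<close> such a word represents the least prefix of a heap with
  \<open>n\<close> occurrences of \<open>a\<close>, that is, a value of V_n.\<close>

definition hitword :: "'a \<Rightarrow> nat \<Rightarrow> 'a list \<Rightarrow> bool" where
  "hitword a n v \<longleftrightarrow> pyramid v \<and> (v \<noteq> [] \<longrightarrow> last v = a) \<and> count_list v a = n"

text \<open>Descending along the dependence chain that links a piece of \<open>v\<close> to the top piece \<open>a\<close>,
  the positions in the projections force every piece of \<open>v\<close> into \<open>s\<close>.\<close>

lemma hitword_minimal:
  assumes v: "hitword a n v" "v \<preceq> w" and s: "s \<preceq> w" "n \<le> count_list s a"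
  shows "v \<preceq> s"
proof -
  have *: "count_list (p @ [c]) c \<le> count_list s c" if "v = p @ c # q" for p c q
    using that
  proof (induction "length q" arbitrary: p c q rule: less_induct)
    case less
    show ?case
    proof (cases "q = []")
      case True
      then show ?thesis using v(1) s(2) less.prems by (auto simp: hitword_def)
    next
      case False
      then obtain d where d: "d \<in> set q" "\<not> I c d"
        using v(1) less.prems unfolding hitword_def pyramid_def by blast
      obtain q1 q2 where q: "q = q1 @ d # q2" using d(1) by (meson split_list)
      have IH: "count_list (p @ c # q1 @ [d]) d \<le> count_list s d"
        using less.hyps[of q2 "p @ c # q1" d] less.prems q by simp
      show ?thesis
      proof (rule ccontr)
        assume neg: "\<not> ?thesis"
        have "p @ [c] \<preceq> w" using v(2) less.prems tle_appendD[of "p @ [c]" q w] by simp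
        then consider "prefix (pair_proj c d s) (pair_proj c d (p @ [c]))"
          | "prefix (pair_proj c d (p @ [c])) (pair_proj c d s)"
          using s(1) d(2) unfolding tle_def by (meson prefix_same_cases)
        then show False
        proof cases
          case 1
          then obtain r where "pair_proj c d (p @ [c]) = pair_proj c d s @ r" by (rule prefixE)
          then have "count_list (p @ [c]) d = count_list s d + count_list r d"
            using count_pair_proj[of d c d] by (metis count_list_append)
          then show ?thesis using IH neg by (auto split: if_splits)
        next
          case 2
          then obtain r where "pair_proj c d s = pair_proj c d (p @ [c]) @ r" by (rule prefixE)
          then have "count_list s c = count_list (p @ [c]) c + count_list r c"
            using count_pair_proj[of c c d] by (metis count_list_append)
          then show ?thesis using neg by simp
        qed
      qed
    qed
  qed
  have "count_list v c \<le> count_list s c" for c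
  proof (cases "c \<in> set v")
    case True
    then obtain p q where "v = p @ c # q" "c \<notin> set q" by (meson split_list_last)
    then show ?thesis using *[of p c q] by (simp add: count_list_0_iff)
  qed (simp add: count_list_0_iff)
  then show ?thesis using tle_iff_count v(2) s(1) by blast
qed

lemma hitword_Nil: "hitword a 0 []"
  by (simp add: hitword_def pyramid_def)

text \<open>Only the tip of \<open>u\<close> needs an argument: it is an \<open>a\<close>, and a
  nonempty \<open>v\<close> ends in another \<open>a\<close>, on which it depends.\<close>

lemma hitword_append:
  assumes "hitword a m u" "hitword a n v" shows "hitword a (m + n) (u @ v)"
proof (cases "v = []")
  case False
  have "\<exists>d\<in>set q. \<not> I c d" if eq: "u @ v = p @ c # q" and q: "q \<noteq> []" for p c q
  proof -
    obtain us where "(u = p @ us \<and> us @ v = c # q) \<or> v = us @ c # q"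
      using eq unfolding append_eq_append_conv2 by blast
    then have "(\<exists>r. u = p @ c # r \<and> q = r @ v) \<or> (\<exists>r. v = r @ c # q)"
      by (cases us) auto
    then consider r where "u = p @ c # r" "q = r @ v" | r where "v = r @ c # q" by blast
    then show ?thesis
    proof cases
      case (1 r)
      show ?thesis
      proof (cases "r = []")
        case True
        then have "c = a" "a \<in> set q" using 1 assms False last_in_set[of v] by (auto simp: hitword_def)
        then show ?thesis using I_irrefl by blast
      next
        case False
        then have "\<exists>d\<in>set r. \<not> I c d" using 1(1) assms(1) unfolding hitword_def pyramid_def by blast
        then show ?thesis using 1(2) by auto
      qed
    next
      case (2 r)
      then show ?thesis using assms(2) q by (auto simp: hitword_def pyramid_def)
    qed
  qed
  then show ?thesis using assms False by (auto simp: hitword_def pyramid_def)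
qed (use assms in \<open>auto simp: hitword_def\<close>)

lemma hitword_concat: "(\<And>v. v \<in> set vs \<Longrightarrow> hitword a 1 v) \<Longrightarrow> hitword a (length vs) (concat vs)"
proof (induction vs)
  case (Cons v vs)
  then show ?case using hitword_append[of a 1 v "length vs" "concat vs"] by simp
qed (simp add: hitword_Nil)

text \<open>A shortest word below \<xi> that contains \<open>a\<close> works: a letter before the
  last with no later dependent letter could be moved to the end and dropped, and \<open>a\<close>
  would remain.\<close>

lemma ex_hitword_below:
  assumes "below u \<xi>" "a \<in> set u"
  shows "\<exists>v. hitword a 1 v \<and> below v \<xi>"
proof -
  obtain v where v: "below v \<xi>" "a \<in> set v"
    and min: "\<And>w. below w \<xi> \<Longrightarrow> a \<in> set w \<Longrightarrow> length v \<le> length w"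
    using ex_has_least_nat[of "\<lambda>v. below v \<xi> \<and> a \<in> set v" u length] assms by blast
  have "v \<noteq> []" using v by auto
  then obtain v' b where v': "v = v' @ [b]" by (meson rev_exhaust)
  have "below v' \<xi>" using v(1) unfolding v' using tle_below_trans by blast
  then have a: "a \<notin> set v'" using min[of v'] v' by auto
  then have b: "b = a" using v(2) v' by simp
  have "\<exists>d\<in>set q. \<not> I c d" if eq: "v = p @ c # q" and q: "q \<noteq> []" for p c q
  proof (rule ccontr)
    assume "\<not> ?thesis"
    then have "v \<doteq> (p @ q) @ [c]" unfolding eq using teq_move_back[of q c p] by simp
    then have "below (p @ q) \<xi>" using v(1) tle_below_trans teq_below by blast
    moreover have "last v = a" using v' b by simp
    then have "last q = a" using eq q by simp
    then have "a \<in> set (p @ q)" using last_in_set[OF q] by simp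
    ultimately show False using min[of "p @ q"] eq by simp
  qed
  then have "hitword a 1 v" using a b v' by (simp add: hitword_def pyramid_def count_list_0_iff)
  with v(1) show ?thesis by blast
qed

section \<open>Suprema, products and quotients of generalized heaps\<close>

lemma gheap_antisym: "gheap I \<xi> \<Longrightarrow> gheap I \<xi>' \<Longrightarrow> gle I \<xi> \<xi>' \<Longrightarrow> gle I \<xi>' \<xi> \<Longrightarrow> \<xi> = \<xi>'"
  by (rule gheap_eqI) (auto simp: gle_iff)

lemma glub_eq:
  assumes "gheap I \<eta>" "\<And>s. s \<in> S \<Longrightarrow> gheap I s" "\<And>u. below u \<eta> \<longleftrightarrow> (\<exists>s\<in>S. below u s)"
  shows "glub I S = \<eta>"
proof -
  have "gheap I \<eta> \<and> (\<forall>s\<in>S. gle I s \<eta>) \<and> (\<forall>u'. gheap I u' \<and> (\<forall>s\<in>S. gle I s u') \<longrightarrow> gle I \<eta> u')"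
    using assms by (auto simp: gle_iff)
  then show ?thesis unfolding glub_def
    by (intro the_equality) (auto intro: gheap_antisym)
qed

lemma gmul_eq:
  assumes "gheap I \<eta>" "gheap I \<zeta>" "\<And>w. below w \<eta> \<longleftrightarrow> (\<exists>n. w \<preceq> u @ lword \<zeta> n)"
  shows "gmul I (heap_of u) \<zeta> = \<eta>"
proof -
  have *: "hmul I (heap_of u) (trunc \<zeta> n) = heap_of (u @ lword \<zeta> n)" for n
    by (metis assms(2) hmul_heap_of hword_trunc heap_of_hword trunc_fheaps)
  show ?thesis unfolding gmul_def by (rule glub_eq) (auto simp: * assms)
qed

lemma gmul_below:
  assumes "gheap I \<zeta>"
  shows "gheap I (gmul I (heap_of u) \<zeta>)" "below w (gmul I (heap_of u) \<zeta>) \<longleftrightarrow> (\<exists>n. w \<preceq> u @ lword \<zeta> n)"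
proof -
  obtain \<eta> where \<eta>: "gheap I \<eta>" "\<And>w. below w \<eta> \<longleftrightarrow> (\<exists>n. w \<preceq> u @ lword \<zeta> n)"
    using ex_limit_heap[of "\<lambda>n. u @ lword \<zeta> n"] by auto
  then have "gmul I (heap_of u) \<zeta> = \<eta>" using assms by (intro gmul_eq)
  with \<eta> show "gheap I (gmul I (heap_of u) \<zeta>)" "below w (gmul I (heap_of u) \<zeta>) \<longleftrightarrow> (\<exists>n. w \<preceq> u @ lword \<zeta> n)"
    by auto
qed

lemma gmul_heap_of: "gmul I (heap_of u) (heap_of v) = heap_of (u @ v)"
proof (rule gmul_eq)
  fix w
  have "(\<exists>n. w \<preceq> u @ lword (heap_of v) n) \<longleftrightarrow> w \<preceq> u @ v"
  proof
    assume "\<exists>n. w \<preceq> u @ lword (heap_of v) n"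
    then obtain n where n: "w \<preceq> u @ lword (heap_of v) n" by blast
    have "lword (heap_of v) n \<preceq> v" using below_lword[of "heap_of v" n] by simp
    then have "u @ lword (heap_of v) n \<preceq> u @ v" by simp
    with n show "w \<preceq> u @ v" by (rule tle_trans)
  next
    assume w: "w \<preceq> u @ v"
    have "below v (heap_of v)" by simp
    then obtain n where "v \<preceq> lword (heap_of v) n" unfolding below_def by blast
    then have "u @ v \<preceq> u @ lword (heap_of v) n" by simp
    with w show "\<exists>n. w \<preceq> u @ lword (heap_of v) n" using tle_trans by blast
  qed
  then show "below w (heap_of (u @ v)) \<longleftrightarrow> (\<exists>n. w \<preceq> u @ lword (heap_of v) n)" by simp
qed auto

lemma length_lword_ge:
  assumes "\<And>k. k < n \<Longrightarrow> \<xi> k \<noteq> {}" shows "n \<le> length (lword \<xi> n)"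
  using assms
proof (induction n)
  case (Suc n)
  then have "cw (\<xi> n) \<noteq> []" using set_cw[of "\<xi> n"] by (metis lessI set_empty)
  then show ?case using Suc by (cases "cw (\<xi> n)") (auto simp: less_Suc_eq)
qed simp

lemma gheap_empty_above:
  assumes "gheap I \<xi>" "\<xi> m = {}" "m \<le> k" shows "\<xi> k = {}"
  using assms(3)
proof (induction k rule: dec_induct)
  case (step k)
  then show ?case using assms(1) unfolding gheap_def by blast
qed (simp add: assms)

lemma bdry_iff: "\<xi> \<in> bdry I \<longleftrightarrow> gheap I \<xi> \<and> (\<forall>n. \<exists>u. below u \<xi> \<and> n \<le> length u)"
proof -
  have False if g: "gheap I \<xi>" "\<forall>n. \<exists>u. below u \<xi> \<and> n \<le> length u" and m: "\<xi> m = {}" for m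
  proof -
    obtain u k where u: "Suc (length (lword \<xi> m)) \<le> length u" "u \<preceq> lword \<xi> k"
      using g(2) unfolding below_def by blast
    have "lword \<xi> (max m k) = lword \<xi> m"
      using gheap_empty_above[OF g(1) m] by (intro lword_extend_empty) auto
    moreover have "u \<preceq> lword \<xi> (max m k)" using u(2) lword_tle_mono[of k "max m k" \<xi>] tle_trans by simp
    ultimately show False using u(1) tle_length[of u "lword \<xi> m"] by simp
  qed
  moreover have "\<exists>u. below u \<xi> \<and> n \<le> length u" if "\<forall>k. \<xi> k \<noteq> {}" for n
    using length_lword_ge[of n \<xi>] that below_lword by blast
  ultimately show ?thesis unfolding bdry_def by blast
qed

lemma heap_of_not_bdry [simp]: "heap_of u \<notin> bdry I"
  using heap_of_fheaps[of u] by (auto simp: bdry_def fheaps_def)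

text \<open>Cancel \<open>u\<close> from the layer words of \<xi>; the remainders increase, and
  their limit is a quotient. It is the only one, because a factor can be read off from the words
  \<open>u @ v\<close> below the product.\<close>

lemma bminus_props:
  assumes \<xi>: "\<xi> \<in> bdry I" and u: "below u \<xi>"
  shows "bminus I \<xi> (heap_of u) \<in> bdry I"
    and "below w (bminus I \<xi> (heap_of u)) \<longleftrightarrow> below (u @ w) \<xi>"
    and "gmul I (heap_of u) (bminus I \<xi> (heap_of u)) = \<xi>"
proof -
  obtain N where N: "u \<preceq> lword \<xi> N" using u by (auto simp: below_def)
  have "u \<preceq> lword \<xi> (N + n)" for n
    by (rule tle_trans[OF N lword_tle_mono]) simp
  then have "\<exists>w. lword \<xi> (N + n) \<doteq> u @ w" for n
    by (simp add: tle_iff)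
  then obtain W where W: "\<And>n. lword \<xi> (N + n) \<doteq> u @ W n" by metis
  have Wle: "v \<preceq> W n \<longleftrightarrow> u @ v \<preceq> lword \<xi> (N + n)" for v n
    using tle_teq_trans[OF _ W[of n], of "u @ v"] tle_teq_trans[OF _ teq_sym[OF W[of n]], of "u @ v"] by auto
  have "W n \<preceq> W (Suc n)" for n
  proof -
    have "u @ W n \<preceq> lword \<xi> (N + n)" by (rule teq_imp_tle[OF teq_sym[OF W]])
    also have "\<dots> \<preceq> lword \<xi> (N + Suc n)" by (intro lword_tle_mono) simp
    finally show ?thesis unfolding Wle .
  qed
  then obtain \<zeta> where \<zeta>: "gheap I \<zeta>" "\<And>v. below v \<zeta> \<longleftrightarrow> (\<exists>n. v \<preceq> W n)"
    using ex_limit_heap[of W] by blast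
  have bz: "below v \<zeta> \<longleftrightarrow> below (u @ v) \<xi>" for v
  proof
    assume "below (u @ v) \<xi>"
    then obtain k where "u @ v \<preceq> lword \<xi> k" by (auto simp: below_def)
    then have "u @ v \<preceq> lword \<xi> (N + k)" by (rule tle_trans[OF _ lword_tle_mono]) simp
    then show "below v \<zeta>" unfolding \<zeta>(2) Wle by blast
  next
    assume "below v \<zeta>"
    then obtain n where "u @ v \<preceq> lword \<xi> (N + n)" unfolding \<zeta>(2) Wle by blast
    then show "below (u @ v) \<xi>" unfolding below_def by blast
  qed
  have leW: "v \<preceq> u @ W k" if "v \<preceq> lword \<xi> k" for v k
  proof -
    have "lword \<xi> k \<preceq> lword \<xi> (N + k)" by (intro lword_tle_mono) simp
    from tle_trans[OF that this] W[of k] show ?thesis by (rule tle_teq_trans)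
  qed
  have "\<exists>v. below v \<zeta> \<and> n \<le> length v" for n
  proof -
    obtain v where v: "below v \<xi>" "length u + n \<le> length v" using \<xi> unfolding bdry_iff by blast
    then obtain k where k: "v \<preceq> lword \<xi> k" by (auto simp: below_def)
    have "n \<le> length (W k)" using tle_length[OF leW[OF k]] v(2) by simp
    then show ?thesis unfolding \<zeta>(2) using tle_refl by blast
  qed
  then have "\<zeta> \<in> bdry I" using \<zeta>(1) unfolding bdry_iff by blast
  moreover have gm: "gmul I (heap_of u) \<zeta> = \<xi>"
  proof (rule gmul_eq)
    fix w
    show "below w \<xi> \<longleftrightarrow> (\<exists>n. w \<preceq> u @ lword \<zeta> n)"
    proof
      assume "below w \<xi>"
      then obtain k where k: "w \<preceq> lword \<xi> k" by (auto simp: below_def)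
      have "below (W k) \<zeta>" using \<zeta>(2) tle_refl by blast
      then obtain n where "W k \<preceq> lword \<zeta> n" unfolding below_def by blast
      then have "u @ W k \<preceq> u @ lword \<zeta> n" by simp
      with leW[OF k] show "\<exists>n. w \<preceq> u @ lword \<zeta> n" using tle_trans by blast
    next
      assume "\<exists>n. w \<preceq> u @ lword \<zeta> n"
      then obtain n where "w \<preceq> u @ lword \<zeta> n" by blast
      moreover have "below (u @ lword \<zeta> n) \<xi>" using bz[of "lword \<zeta> n"] by simp
      ultimately show "below w \<xi>" by (rule tle_below_trans)
    qed
  qed (use \<zeta> \<xi> in \<open>auto simp: bdry_gheap\<close>)
  moreover have "\<zeta>' = \<zeta>" if "\<zeta>' \<in> bdry I" "gmul I (heap_of u) \<zeta>' = \<xi>" for \<zeta>'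
  proof (rule gheap_eqI)
    fix v
    have "below (u @ v) \<xi> \<longleftrightarrow> (\<exists>n. v \<preceq> lword \<zeta>' n)"
      using gmul_below(2)[OF bdry_gheap[OF that(1)], of "u @ v" u] that(2) by simp
    then show "below v \<zeta>' \<longleftrightarrow> below v \<zeta>" unfolding bz below_def[of v \<zeta>'] by blast
  qed (use that \<zeta> in \<open>auto simp: bdry_gheap\<close>)
  ultimately have "bminus I \<xi> (heap_of u) = \<zeta>" unfolding bminus_def by (intro the_equality) blast+
  then show "bminus I \<xi> (heap_of u) \<in> bdry I" "below w (bminus I \<xi> (heap_of u)) \<longleftrightarrow> below (u @ w) \<xi>"
    "gmul I (heap_of u) (bminus I \<xi> (heap_of u)) = \<xi>"
    using \<open>\<zeta> \<in> bdry I\<close> bz gm by auto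
qed

text \<open>The infimum over \<open>Hset\<close> is a minimum: the heap of \<open>v\<close> is a
  member, and \<open>hitword_minimal\<close> puts it below all others.\<close>

lemma hit_eq:
  assumes \<zeta>: "gheap I \<zeta>" and v: "hitword a 1 v" "below v \<zeta>"
  shows "hit I a \<zeta> = heap_of v"
proof -
  have mem: "heap_of v \<in> Hset I a \<zeta>" using assms by (simp add: Hset_def gle_heap_of_iff hitword_def)
  have L: "heap_of v \<in> Lset I \<zeta>" using assms by (simp add: Lset_def gle_heap_of_iff)
  have low: "gle I (heap_of v) s" if "s \<in> Hset I a \<zeta>" for s
  proof -
    have s: "s \<in> fheaps I" "gle I s \<zeta>" "count_list (hword s) a \<ge> 1"
      using that by (auto simp: Hset_def hcount_def)
    have "below (hword s) \<zeta>" using s(2) gle_heap_of_iff[OF \<zeta>, of "hword s"] s(1) by simp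
    then obtain k where k: "v \<preceq> lword \<zeta> k" "hword s \<preceq> lword \<zeta> k" using belowE2 v(2) by blast
    then have "v \<preceq> hword s" using hitword_minimal[OF v(1)] s(3) by blast
    then show ?thesis using s(1) by (simp add: gle_heap_of_iff fheaps_gheap below_fheaps)
  qed
  have "glb_in I (Lset I \<zeta>) (Hset I a \<zeta>) = heap_of v"
    unfolding glb_in_def
  proof (rule the_equality)
    show "heap_of v \<in> Lset I \<zeta> \<and> (\<forall>s\<in>Hset I a \<zeta>. gle I (heap_of v) s) \<and>
      (\<forall>y'\<in>Lset I \<zeta>. (\<forall>s\<in>Hset I a \<zeta>. gle I y' s) \<longrightarrow> gle I y' (heap_of v))"
      using mem L low by blast
  next
    fix y assume y: "y \<in> Lset I \<zeta> \<and> (\<forall>s\<in>Hset I a \<zeta>. gle I y s) \<and>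
      (\<forall>y'\<in>Lset I \<zeta>. (\<forall>s\<in>Hset I a \<zeta>. gle I y' s) \<longrightarrow> gle I y' y)"
    then have "gle I y (heap_of v)" "gle I (heap_of v) y" using mem L low by auto
    then show "y = heap_of v" using y by (intro gheap_antisym) (auto simp: Lset_def)
  qed
  then show ?thesis using mem by (auto simp: hit_def)
qed

text \<open>Every iterate met here is a finite heap, so the branch of \<open>Viter\<close> for
  infinite values is never entered, and each step is an instance of \<open>hit_eq\<close> on the
  quotient.\<close>

lemma Viter_eq:
  assumes \<xi>: "\<xi> \<in> bdry I"
  shows "(\<And>v. v \<in> set vs \<Longrightarrow> hitword a 1 v) \<Longrightarrow> below (concat vs) \<xi> \<Longrightarrow>
    Viter I a (length vs) \<xi> = heap_of (concat vs)"
proof (induction vs rule: rev_induct)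
  case Nil
  then show ?case by (simp add: heap_of_Nil)
next
  case (snoc v vs)
  have b: "below (concat vs) \<xi>" using snoc.prems(2) tle_below_trans[of "concat vs"] by auto
  then have IH: "Viter I a (length vs) \<xi> = heap_of (concat vs)" using snoc by auto
  have "below v (bminus I \<xi> (heap_of (concat vs)))" using snoc.prems(2) bminus_props(2)[OF \<xi> b] by simp
  then have "hit I a (bminus I \<xi> (heap_of (concat vs))) = heap_of v"
    using snoc.prems(1) bminus_props(1)[OF \<xi> b] by (intro hit_eq) (auto simp: bdry_gheap)
  then show ?case by (simp add: IH gmul_heap_of)
qed

subsection \<open>Decay of avoidance probabilities\<close>

text \<open>As a heap, a walk is a chain: each letter lies on top of the preceding one.\<close>

abbreviation walk :: "'a list \<Rightarrow> bool" where
  "walk \<equiv> successively (\<lambda>x y. \<not> I x y)"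

lemma walk_extend:
  assumes "(\<lambda>x y. \<not> I x y)\<^sup>*\<^sup>* (last xs) b" "walk xs" "xs \<noteq> []"
  shows "\<exists>w. walk (xs @ w) \<and> last (xs @ w) = b"
  using assms(1)
proof (induction rule: rtranclp_induct)
  case base
  then show ?case using assms by (intro exI[of _ "[]"]) auto
next
  case (step y z)
  then obtain w where "walk (xs @ w)" "last (xs @ w) = y" by blast
  then show ?case using step.hyps assms(3)
    by (intro exI[of _ "w @ [z]"]) (auto simp: successively_append_iff simp flip: append_assoc)
qed

lemma walk_cover:
  assumes conn: "\<And>a b. (\<lambda>x y. \<not> I x y)\<^sup>*\<^sup>* a b"
  shows "\<exists>y. walk (c # y) \<and> set (c # y) = UNIV"
proof -
  have "finite S \<Longrightarrow> \<exists>y. walk (c # y) \<and> S \<subseteq> set (c # y)" for S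
  proof (induction rule: finite_induct)
    case (insert x S)
    then obtain y where y: "walk (c # y)" "S \<subseteq> set (c # y)" by blast
    obtain w where w: "walk ((c # y) @ w)" "last ((c # y) @ w) = x"
      using walk_extend[OF conn y(1)] by blast
    have "x \<in> set ((c # y) @ w)" using w(2) last_in_set[of "(c # y) @ w"] by simp
    then show ?case using y w(1) by (intro exI[of _ "y @ w"]) auto
  qed (auto intro: exI[of _ "[]"])
  from this[of UNIV] show ?thesis by auto
qed

text \<open>Every piece independent of the first letter of a covering walk has to lie above a piece of the walk.\<close>

lemma first_layer_walk:
  assumes \<eta>: "gheap I \<eta>" and y: "walk (c # y)" "set (c # y) = UNIV" and b: "below (c # y) \<eta>"
  shows "\<eta> 0 = {c}"
proof -
  have "d = c" if d: "d \<in> \<eta> 0" for d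
  proof (rule ccontr)
    assume "d \<noteq> c"
    then have "d \<in> set y" using y(2) by auto
    then obtain y1 y2 where y12: "y = y1 @ d # y2" "d \<notin> set y1" by (meson split_list_first)
    \<comment> \<open>The predecessor of the first \<open>d\<close> on the walk, hence dependent on
      \<open>d\<close>. The projection to \<open>d\<close> and \<open>e\<close> would have to start
      with \<open>e\<close> because of the walk, and with \<open>d\<close> because \<open>d\<close>
      lies in the first layer.\<close>
    define e where "e = last (c # y1)"
    have e: "\<not> I d e" "e \<in> set (c # y1)" "e \<noteq> d"
    proof -
      have "walk ((c # y1) @ d # y2)" using y(1) y12 by simp
      then show "\<not> I d e" unfolding successively_append_iff e_def using I_sym by auto
      show "e \<in> set (c # y1)" unfolding e_def by (rule last_in_set) simp
      then show "e \<noteq> d" using y12(2) \<open>d \<noteq> c\<close> by auto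
    qed
    have "cw (\<eta> 0) \<doteq> d # cw (\<eta> 0 - {d})"
      using \<eta> d by (intro distinct_clique_teq) (auto simp: gheap_def)
    then have "[d] \<preceq> lword \<eta> (Suc 0)"
      using tle_teq_trans[OF tle_append[of "[d]" "cw (\<eta> 0 - {d})"], of "cw (\<eta> 0)"] teq_sym by simp
    then have "below [d] \<eta>" unfolding below_def by blast
    then obtain k where k: "[d] \<preceq> lword \<eta> k" "c # y \<preceq> lword \<eta> k" using belowE2 b by blast
    have "pair_proj d e (c # y1) \<noteq> []" using e(2) unfolding pair_proj_def filter_empty_conv by blast
    then obtain f r where fr: "pair_proj d e (c # y1) = f # r" by (cases "pair_proj d e (c # y1)") auto
    then have "f \<in> set (pair_proj d e (c # y1))" by simp
    then have "f \<in> set (c # y1)" "f = d \<or> f = e" unfolding pair_proj_def set_filter by blast+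
    then have "f = e" using y12(2) \<open>d \<noteq> c\<close> by auto
    moreover have "pair_proj d e (c # y) = pair_proj d e (c # y1) @ pair_proj d e (d # y2)"
      using pair_proj_append[of d e "c # y1" "d # y2"] y12 by simp
    moreover have "prefix (pair_proj d e (c # y)) (pair_proj d e (lword \<eta> k))"
      "prefix (pair_proj d e [d]) (pair_proj d e (lword \<eta> k))" using k e(1) by (auto simp: tle_def)
    ultimately have "prefix (e # r @ pair_proj d e (d # y2)) (pair_proj d e (lword \<eta> k))"
      "prefix [d] (pair_proj d e (lword \<eta> k))" using fr by (auto simp: pair_proj_Cons)
    then show False using e(3) by (cases "pair_proj d e (lword \<eta> k)") auto
  qed
  moreover have "\<eta> 0 \<noteq> {}"
  proof
    assume "\<eta> 0 = {}"
    then have "lword \<eta> k = lword \<eta> 0" for k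
      using gheap_empty_above[OF \<eta>, of 0] by (intro lword_extend_empty) auto
    moreover obtain k where "c # y \<preceq> lword \<eta> k" using b unfolding below_def by blast
    ultimately show False using tle_length[of "c # y" "lword \<eta> k"] by simp
  qed
  ultimately show ?thesis by auto
qed

lemma set_lword: "set (lword \<xi> n) = (\<Union>k<n. \<xi> k)"
  by (induction n) (auto simp: lessThan_Suc)

lemma lword_add: "lword (\<lambda>k. if k < n then \<xi> k else \<eta> (k - n)) (n + m) = lword \<xi> n @ lword \<eta> m"
proof (induction m)
  case 0
  show ?case by (simp, rule lword_cong) simp
qed simp

text \<open>The normal form of \<open>u\<close> has at most \<open>length u\<close> layers, since
  each nonempty layer holds a piece, and its initial segments compare with those of \<eta> level by
  level.\<close>

lemma below_lword_length:
  assumes "gheap I \<eta>" "below u \<eta>" "length u \<le> L" shows "u \<preceq> lword \<eta> L"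
proof -
  let ?z = "heap_of u"
  have "?z L = {}"
  proof (rule ccontr)
    assume "?z L \<noteq> {}"
    then have "\<And>k. k < Suc L \<Longrightarrow> ?z k \<noteq> {}"
      using gheap_empty_above[OF heap_of_gheap] by (metis less_Suc_eq_le)
    then have "Suc L \<le> length (lword ?z (Suc L))" by (rule length_lword_ge)
    moreover have "lword ?z (Suc L) \<preceq> u" using below_lword below_heap_of by blast
    ultimately show False using tle_length[of "lword ?z (Suc L)" u] assms(3) by simp
  qed
  then have "\<And>k. L \<le> k \<Longrightarrow> ?z k = {}" using gheap_empty_above[OF heap_of_gheap] by blast
  then have ext: "lword ?z k \<preceq> lword ?z L" for k
    using lword_extend_empty[of L "max L k" ?z] lword_tle_mono[of k "max L k" ?z] by simp
  have "below u ?z" by simp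
  then obtain k where "u \<preceq> lword ?z k" unfolding below_def by blast
  then have u: "u \<preceq> lword ?z L" using ext tle_trans by blast
  have "lword ?z L \<preceq> u" using below_lword below_heap_of by blast
  then have "below (lword ?z L) \<eta>" using assms(2) by (rule tle_below_trans)
  then have "lword ?z L \<preceq> lword \<eta> L" using lword_below_iff[OF heap_of_gheap assms(1)] by simp
  with u show ?thesis by (rule tle_trans)
qed

text \<open>What remains of \<xi> after \<open>lword \<xi>' (Suc m)\<close> has first layer
  \<open>{c}\<close> by \<open>first_layer_walk\<close>. As \<open>c\<close> also lies in layer
  \<open>m\<close> of \<xi>' and depends on itself, stacking the layers gives a normal form, so
  \<xi> starts with exactly the layers of \<xi>'. The walk then brings every letter within
  \<open>L\<close> further layers.\<close>

lemma cylinder_contains_walk: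
  assumes \<xi>: "\<xi> \<in> bdry I" and \<xi>': "\<xi>' \<in> bdry I" and c: "c \<in> \<xi>' m"
    and y: "walk (c # y)" "set (c # y) = UNIV" and b: "below (lword \<xi>' (Suc m) @ c # y) \<xi>"
    and L: "length (c # y) \<le> L"
  shows "\<forall>k<Suc m. \<xi> k = \<xi>' k" "\<exists>k<Suc m + L. a \<in> \<xi> k"
proof -
  let ?n = "Suc m" and ?x = "lword \<xi>' (Suc m)"
  have bx: "below ?x \<xi>" using b tle_below_trans tle_append by blast
  define \<eta> where "\<eta> = bminus I \<xi> (heap_of ?x)"
  have \<eta>: "\<eta> \<in> bdry I" "below (c # y) \<eta>" "gmul I (heap_of ?x) \<eta> = \<xi>"
    using bminus_props[OF \<xi> bx] b by (auto simp: \<eta>_def)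
  have \<eta>0: "\<eta> 0 = {c}" using first_layer_walk bdry_gheap \<eta> y by blast
  define \<zeta> where "\<zeta> = (\<lambda>k. if k < ?n then \<xi>' k else \<eta> (k - ?n))"
  have "gheap I \<zeta>"
    unfolding gheap_def
  proof (intro conjI allI impI)
    fix k
    have g: "gheap I \<xi>'" "gheap I \<eta>" using \<xi>' \<eta> by (auto simp: bdry_gheap)
    show "clique I (\<zeta> k)" using g by (auto simp: \<zeta>_def gheap_def)
    show "\<zeta> k \<noteq> {}" using \<xi>' \<eta>(1) by (auto simp: \<zeta>_def bdry_def)
    consider "Suc k < ?n" | "k = m" | "?n \<le> k" by linarith
    then show "cf_arrow I (\<zeta> k) (\<zeta> (Suc k))"
    proof cases
      case 1
      then show ?thesis using \<xi>' by (auto simp: \<zeta>_def bdry_def gheap_def)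
    next
      case 2
      then show ?thesis using c \<eta>0 I_irrefl by (auto simp: \<zeta>_def cf_arrow_def)
    next
      case 3
      then have "Suc k - ?n = Suc (k - ?n)" by simp
      then show ?thesis using 3 \<eta>(1) by (auto simp: \<zeta>_def bdry_def gheap_def)
    qed
  qed
  have "\<xi> = \<zeta>"
  proof (rule gheap_eqI)
    fix u
    have "below u \<xi> \<longleftrightarrow> (\<exists>j. u \<preceq> ?x @ lword \<eta> j)"
      using gmul_below(2)[OF bdry_gheap[OF \<eta>(1)], of u ?x] \<eta>(3) by simp
    also have "\<dots> \<longleftrightarrow> (\<exists>j. u \<preceq> lword \<zeta> (?n + j))" unfolding \<zeta>_def lword_add ..
    also have "\<dots> \<longleftrightarrow> below u \<zeta>"
    proof
      assume "below u \<zeta>"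
      then obtain k where "u \<preceq> lword \<zeta> k" unfolding below_def by blast
      then have "u \<preceq> lword \<zeta> (?n + k)" by (rule tle_trans[OF _ lword_tle_mono]) simp
      then show "\<exists>j. u \<preceq> lword \<zeta> (?n + j)" by blast
    qed (unfold below_def, blast)
    finally show "below u \<xi> \<longleftrightarrow> below u \<zeta>" .
  qed (use \<xi> \<open>gheap I \<zeta>\<close> in \<open>auto simp: bdry_gheap\<close>)
  then show "\<forall>k<?n. \<xi> k = \<xi>' k" by (simp add: \<zeta>_def)
  have "c # y \<preceq> lword \<eta> L" using below_lword_length bdry_gheap \<eta> L by blast
  then have "count_list (c # y) a \<le> count_list (lword \<eta> L) a" by (rule tle_count)
  moreover have "a \<in> set (c # y)" using y(2) by auto
  ultimately have "a \<in> set (lword \<eta> L)" by (metis count_list_0_iff le_zero_eq)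
  then obtain k where "k < L" "a \<in> \<eta> k" by (auto simp: set_lword)
  then have "?n + k < ?n + L" "a \<in> \<xi> (?n + k)" unfolding \<open>\<xi> = \<zeta>\<close> by (auto simp: \<zeta>_def)
  then show "\<exists>k<?n + L. a \<in> \<xi> k" by blast
qed

end

section \<open>Bernoulli measures and cylinders of layers\<close>

locale bernoulli_heaps = independence I for I :: "'a::finite \<Rightarrow> 'a \<Rightarrow> bool" +
  fixes P :: "(nat \<Rightarrow> 'a set) measure"
  assumes connected: "(\<lambda>x y. \<not> I x y)\<^sup>*\<^sup>* a b"
    and bern: "bernoulli I P"
begin

sublocale prob_space P using bern by (simp add: bernoulli_def)

definition Up :: "'a list \<Rightarrow> (nat \<Rightarrow> 'a set) set" where
  "Up u = {\<xi>\<in>bdry I. below u \<xi>}"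

lemma Up_eq: "Up u = up I (heap_of u)"
  by (auto simp: Up_def up_def gle_heap_of_iff bdry_gheap)

lemma space_P [simp]: "space P = bdry I"
  using bern by (simp add: bernoulli_def)

lemma sets_P: "sets P = sigma_sets (bdry I) (range Up)"
proof -
  have "up I ` fheaps I = range Up"
  proof
    show "up I ` fheaps I \<subseteq> range Up"
    proof
      fix A assume "A \<in> up I ` fheaps I"
      then obtain z where "z \<in> fheaps I" "A = up I z" by blast
      then have "A = Up (hword z)" by (simp add: Up_eq)
      then show "A \<in> range Up" by simp
    qed
  qed (auto simp: Up_eq)
  then show ?thesis using bern by (simp add: bernoulli_def)
qed

lemma Up_sets [measurable, simp]: "Up u \<in> sets P"
  unfolding sets_P by (rule sigma_sets.Basic) simp

lemma prob_Up_append: "prob (Up (u @ v)) = prob (Up u) * prob (Up v)"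
  using bern by (simp add: bernoulli_def Up_eq flip: hmul_heap_of)

lemma prob_Up_pos: "0 < prob (Up u)"
  using bern by (simp add: bernoulli_def Up_eq)

lemma Up_mono: "u \<preceq> v \<Longrightarrow> Up v \<subseteq> Up u"
  by (auto simp: Up_def intro: tle_below_trans)

definition cyl :: "nat \<Rightarrow> 'a set list \<Rightarrow> (nat \<Rightarrow> 'a set) set" where
  "cyl n xs = {\<xi>\<in>bdry I. map \<xi> [0..<n] = xs}"

lemma lword_eq_concat: "map \<xi> [0..<n] = xs \<Longrightarrow> lword \<xi> n = concat (map cw xs)"
  by (auto simp: lword_def comp_def)

lemma teq_imp_layers_eq:
  assumes "gheap I \<xi>" "gheap I \<xi>'" "lword \<xi> n \<doteq> lword \<xi>' n" "k < n"
  shows "\<xi> k = \<xi>' k"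
proof -
  have "trunc \<xi> n = trunc \<xi>' n"
    using assms by (intro fheaps_teq_imp_eq) (auto simp: trunc_fheaps hword_trunc)
  then show ?thesis using assms(4) by (metis trunc_def)
qed

text \<open>Only up-sets are measurable by definition. A cylinder is an up-set minus finitely many
  others: those of the different initial segments of \<open>n\<close> layers lying above
  \<open>xs\<close>.\<close>

lemma cyl_sets [measurable]: "cyl n xs \<in> sets P"
proof (cases "cyl n xs = {}")
  case False
  then obtain \<xi>' where \<xi>': "\<xi>' \<in> bdry I" "map \<xi>' [0..<n] = xs" by (auto simp: cyl_def)
  \<comment> \<open>Nonemptiness of \<open>cyl n ys\<close> provides a boundary point with these
    layers, so that \<open>lword_below_iff\<close> applies to it.\<close>
  define Y where "Y = {ys. length ys = n \<and> ys \<noteq> xs \<and> cyl n ys \<noteq> {} \<and> concat (map cw xs) \<preceq> concat (map cw ys)}"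
  have "finite {ys :: 'a set list. length ys = n}" using finite_lists_length_eq[of "UNIV :: 'a set set" n] by simp
  then have fin: "finite Y" unfolding Y_def by (rule rev_finite_subset) auto
  have "cyl n xs = Up (concat (map cw xs)) - (\<Union>ys\<in>Y. Up (concat (map cw ys)))"
  proof (intro set_eqI iffI)
    fix \<xi> assume \<xi>: "\<xi> \<in> cyl n xs"
    have False if ys: "ys \<in> Y" "\<xi> \<in> Up (concat (map cw ys))" for ys
    proof -
      obtain \<zeta> where \<zeta>: "\<zeta> \<in> bdry I" "map \<zeta> [0..<n] = ys" using ys(1) by (auto simp: Y_def cyl_def)
      have "lword \<zeta> n \<preceq> lword \<xi> n"
        using \<zeta> ys(2) \<xi> lword_below_iff[of \<zeta> \<xi> n] by (auto simp: Up_def bdry_gheap lword_eq_concat[OF \<zeta>(2)])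
      moreover have "lword \<xi> n \<preceq> lword \<zeta> n"
        using ys(1) \<xi> by (auto simp: Y_def cyl_def lword_eq_concat[OF \<zeta>(2)] lword_eq_concat[of \<xi>])
      ultimately have "lword \<xi> n \<doteq> lword \<zeta> n" by (intro tle_antisym)
      then have "map \<xi> [0..<n] = map \<zeta> [0..<n]"
        using teq_imp_layers_eq[of \<xi> \<zeta> n] \<xi> \<zeta>(1) by (auto simp: cyl_def bdry_gheap)
      then show False using \<xi> \<zeta>(2) ys(1) by (auto simp: cyl_def Y_def)
    qed
    moreover have "\<xi> \<in> Up (concat (map cw xs))"
      using \<xi> below_lword[of \<xi> n] lword_eq_concat[of \<xi> n xs] by (simp add: cyl_def Up_def)
    ultimately show "\<xi> \<in> Up (concat (map cw xs)) - (\<Union>ys\<in>Y. Up (concat (map cw ys)))" by blast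
  next
    fix \<xi> assume \<xi>: "\<xi> \<in> Up (concat (map cw xs)) - (\<Union>ys\<in>Y. Up (concat (map cw ys)))"
    let ?ys = "map \<xi> [0..<n]"
    have b: "\<xi> \<in> bdry I" "below (lword \<xi>' n) \<xi>" using \<xi> lword_eq_concat[OF \<xi>'(2)] by (auto simp: Up_def)
    then have "lword \<xi>' n \<preceq> lword \<xi> n" using lword_below_iff \<xi>'(1) bdry_gheap by blast
    then have le: "concat (map cw xs) \<preceq> concat (map cw ?ys)"
      using lword_eq_concat[OF \<xi>'(2)] lword_eq_concat[of \<xi> n ?ys] by simp
    have "\<xi> \<in> Up (concat (map cw ?ys))"
      using b below_lword[of \<xi> n] lword_eq_concat[of \<xi> n ?ys] by (simp add: Up_def)
    then have "?ys \<notin> Y" using \<xi> by blast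
    moreover have "\<xi> \<in> cyl n ?ys" using b by (simp add: cyl_def)
    ultimately have "?ys = xs" using le unfolding Y_def by auto
    then show "\<xi> \<in> cyl n xs" using b by (simp add: cyl_def)
  qed
  also have "\<dots> \<in> sets P" using fin by (intro sets.Diff sets.finite_UN) auto
  finally show ?thesis .
qed simp

definition avoid :: "'a \<Rightarrow> nat \<Rightarrow> (nat \<Rightarrow> 'a set) set" where
  "avoid a n = {\<xi>\<in>bdry I. \<forall>k<n. a \<notin> \<xi> k}"

lemma avoid_eq_UN:
  "avoid a n = (\<Union>xs\<in>{xs. length xs = n \<and> a \<notin> \<Union>(set xs)}. cyl n xs)"
proof (intro set_eqI iffI)
  fix \<xi> assume "\<xi> \<in> avoid a n"
  then show "\<xi> \<in> (\<Union>xs\<in>{xs. length xs = n \<and> a \<notin> \<Union>(set xs)}. cyl n xs)"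
    by (intro UN_I[of "map \<xi> [0..<n]"]) (auto simp: avoid_def cyl_def)
next
  fix \<xi> assume "\<xi> \<in> (\<Union>xs\<in>{xs. length xs = n \<and> a \<notin> \<Union>(set xs)}. cyl n xs)"
  then have "\<xi> \<in> bdry I" "a \<notin> \<Union>(set (map \<xi> [0..<n]))" by (auto simp: cyl_def)
  then show "\<xi> \<in> avoid a n" by (auto simp: avoid_def)
qed

lemma avoid_finite: "finite {xs :: 'a set list. length xs = n \<and> a \<notin> \<Union>(set xs)}"
  using finite_lists_length_eq[of "UNIV :: 'a set set" n] by (auto elim: rev_finite_subset)

lemma avoid_sets [measurable]: "avoid a n \<in> sets P"
  unfolding avoid_eq_UN using avoid_finite cyl_sets by (intro sets.finite_UN) auto

lemma avoid_mono: "m \<le> n \<Longrightarrow> avoid a n \<subseteq> avoid a m"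
  by (auto simp: avoid_def)

text \<open>Fix the first \<open>n\<close> layers, choose \<open>c\<close> in the last of them, and
  continue with a covering walk from \<open>c\<close>. By \<open>cylinder_contains_walk\<close> this
  event stays in the cylinder and forces \<open>a\<close> within \<open>L\<close> further layers; by
  multiplicativity its probability is at least \<delta> times that of the cylinder.\<close>

lemma avoid_contraction:
  "\<exists>L \<delta>. 1 \<le> L \<and> 0 < \<delta> \<and> \<delta> < 1 \<and> (\<forall>n\<ge>1. prob (avoid a (n + L)) \<le> (1 - \<delta>) * prob (avoid a n))"
proof -
  obtain Y where Y: "\<And>c. walk (c # Y c)" "\<And>c. set (c # Y c) = UNIV"
    using walk_cover[OF connected] by metis
  define L where "L = Max (range (\<lambda>c. length (c # Y c)))"
  \<comment> \<open>The alphabet is finite, so the minimum over the starting letters is positive;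
    the cap 1/2 keeps \<open>1 - \<delta>\<close> positive for the root taken in
    \<open>avoid_summable\<close>.\<close>
  define \<delta> where "\<delta> = min (1/2) (Min (range (\<lambda>c. prob (Up (c # Y c)))))"
  have L: "length (c # Y c) \<le> L" for c unfolding L_def by (rule Max_ge) auto
  have "length (a # Y a) \<le> L" by (rule L)
  then have "1 \<le> L" by simp
  have \<delta>: "\<delta> \<le> prob (Up (c # Y c))" for c unfolding \<delta>_def by (intro min.coboundedI2 Min_le) auto
  have "0 < Min (range (\<lambda>c. prob (Up (c # Y c))))" by (subst Min_gr_iff) (auto intro: prob_Up_pos)
  then have \<delta>0: "0 < \<delta>" "\<delta> < 1" unfolding \<delta>_def by auto
  have "prob (avoid a (n + L)) \<le> (1 - \<delta>) * prob (avoid a n)" if n: "1 \<le> n" for n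
  proof -
    let ?X = "{xs :: 'a set list. length xs = n \<and> a \<notin> \<Union>(set xs)}"
    obtain m where m: "n = Suc m" using n by (cases n) auto
    have disj: "disjoint_family_on (cyl n) ?X" "disjoint_family_on (\<lambda>xs. cyl n xs \<inter> avoid a (n + L)) ?X"
      by (auto simp: disjoint_family_on_def cyl_def)
    have step: "prob (cyl n xs \<inter> avoid a (n + L)) \<le> (1 - \<delta>) * prob (cyl n xs)" for xs
    proof (cases "cyl n xs = {}")
      case False
      then obtain \<xi>' where \<xi>': "\<xi>' \<in> bdry I" "map \<xi>' [0..<n] = xs" by (auto simp: cyl_def)
      then obtain c where c: "c \<in> \<xi>' m" unfolding bdry_def by blast
      let ?x = "lword \<xi>' n"
      have sub: "Up (?x @ c # Y c) \<subseteq> cyl n xs - avoid a (n + L)"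
      proof
        fix \<xi> assume \<xi>: "\<xi> \<in> Up (?x @ c # Y c)"
        then have "\<xi> \<in> bdry I" "below (lword \<xi>' (Suc m) @ c # Y c) \<xi>" by (auto simp: Up_def m)
        from cylinder_contains_walk[OF this(1) \<xi>'(1) c Y this(2) L]
        have "map \<xi> [0..<n] = map \<xi>' [0..<n]" "\<exists>k<n + L. a \<in> \<xi> k" unfolding m by auto
        then show "\<xi> \<in> cyl n xs - avoid a (n + L)"
          using \<open>\<xi> \<in> bdry I\<close> \<xi>'(2) unfolding cyl_def avoid_def by blast
      qed
      \<comment> \<open>Multiplicativity concerns up-sets, not cylinders; this inclusion has the
        direction needed for a lower bound.\<close>
      have "cyl n xs \<subseteq> Up ?x"
      proof
        fix \<xi> assume \<xi>: "\<xi> \<in> cyl n xs"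
        then have "lword \<xi> n = ?x" using \<xi>'(2) by (simp add: cyl_def lword_eq_concat)
        then show "\<xi> \<in> Up ?x" using \<xi> below_lword[of \<xi> n] by (simp add: cyl_def Up_def)
      qed
      then have cle: "prob (cyl n xs) \<le> prob (Up ?x)" by (intro finite_measure_mono) auto
      have "prob (cyl n xs \<inter> avoid a (n + L)) \<le> prob (cyl n xs - Up (?x @ c # Y c))"
        using sub by (intro finite_measure_mono) auto
      also have "\<dots> = prob (cyl n xs) - prob (Up ?x) * prob (Up (c # Y c))"
      proof -
        have "Up (?x @ c # Y c) \<subseteq> cyl n xs" using sub by blast
        then show ?thesis by (subst finite_measure_Diff) (simp_all add: prob_Up_append)
      qed
      also have "\<dots> \<le> prob (cyl n xs) - prob (cyl n xs) * \<delta>"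
        using cle \<delta>[of c] \<delta>0(1) by (intro diff_left_mono mult_mono) simp_all
      finally show ?thesis by (simp add: algebra_simps)
    qed simp
    have "avoid a (n + L) = (\<Union>xs\<in>?X. cyl n xs \<inter> avoid a (n + L))"
    proof -
      have "avoid a (n + L) \<subseteq> (\<Union>xs\<in>?X. cyl n xs)"
        using avoid_mono[of n "n + L" a] avoid_eq_UN[of a n] by simp
      then show ?thesis by blast
    qed
    then have "prob (avoid a (n + L)) = prob (\<Union>xs\<in>?X. cyl n xs \<inter> avoid a (n + L))"
      by (rule arg_cong)
    also have "\<dots> = (\<Sum>xs\<in>?X. prob (cyl n xs \<inter> avoid a (n + L)))"
      by (rule finite_measure_finite_Union[OF avoid_finite _ disj(2)]) auto
    also have "\<dots> \<le> (\<Sum>xs\<in>?X. (1 - \<delta>) * prob (cyl n xs))" by (intro sum_mono step)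
    also have "\<dots> = (1 - \<delta>) * prob (avoid a n)"
      unfolding avoid_eq_UN[of a n] sum_distrib_left[symmetric]
      by (subst finite_measure_finite_Union[OF avoid_finite _ disj(1)]) auto
    finally show ?thesis .
  qed
  then show ?thesis using \<open>1 \<le> L\<close> \<delta>0 by blast
qed

lemma avoid_summable: "summable (\<lambda>n. prob (avoid a n))"
proof -
  obtain L \<delta> where L: "1 \<le> L" and \<delta>: "0 < \<delta>" "\<delta> < 1"
    and step: "\<And>n. 1 \<le> n \<Longrightarrow> prob (avoid a (n + L)) \<le> (1 - \<delta>) * prob (avoid a n)"
    using avoid_contraction by blast
  \<comment> \<open>Spreads the factor \<open>1 - \<delta>\<close> per \<open>L\<close> layers into
    a factor \<open>s\<close> per layer.\<close>
  define s where "s = root L (1 - \<delta>)"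
  have s: "0 < s" "s < 1" "s ^ L = 1 - \<delta>"
    using L \<delta> by (auto simp: s_def real_root_gt_zero real_root_lt_1_iff)
  \<comment> \<open>Dividing by \<open>s ^ L\<close> makes the bound at least 1 for
    \<open>n \<le> L\<close>, which starts the induction.\<close>
  have "prob (avoid a n) \<le> s ^ n / s ^ L" for n
  proof (induction n rule: less_induct)
    case (less n)
    show ?case
    proof (cases "n \<le> L")
      case True
      then have "s ^ L \<le> s ^ n" using s by (intro power_decreasing) auto
      moreover have "0 < s ^ L" using s(1) by simp
      ultimately have "1 \<le> s ^ n / s ^ L" by (simp only: le_divide_eq_1 simp_thms)
      then show ?thesis using prob_le_1[of "avoid a n"] by linarith
    next
      case False
      then obtain k where k: "n = k + L" "1 \<le> k" by (intro that[of "n - L"]) auto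
      have "prob (avoid a n) \<le> s ^ L * prob (avoid a k)" using step[OF k(2)] k s by simp
      also have "\<dots> \<le> s ^ L * (s ^ k / s ^ L)" using less.IH[of k] k L s(1) by (intro mult_left_mono) auto
      finally show ?thesis by (simp add: k power_add mult.commute)
    qed
  qed
  then have "norm (prob (avoid a n)) \<le> s ^ n / s ^ L" for n by simp
  moreover have "summable (\<lambda>n. s ^ n / s ^ L)" using s by (intro summable_divide summable_geometric) simp
  ultimately show ?thesis by (rule summable_comparison_test'[of "\<lambda>n. s ^ n / s ^ L" 0, rotated])
qed

lemma AE_hit: "AE \<xi> in P. \<exists>k. a \<in> \<xi> k"
proof -
  have "(\<lambda>n. prob (avoid a n)) \<longlonglongrightarrow> prob (\<Inter>n. avoid a n)"
    using avoid_mono by (intro finite_Lim_measure_decseq) (auto simp: decseq_def)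
  then have "prob (\<Inter>n. avoid a n) = 0"
    using summable_LIMSEQ_zero[OF avoid_summable[of a]] LIMSEQ_unique by blast
  then have "AE \<xi> in P. \<xi> \<notin> (\<Inter>n. avoid a n)" by (subst (asm) prob_eq_0) auto
  then show ?thesis using AE_space
    by eventually_elim (auto simp: avoid_def)
qed

end

section \<open>Independence of the increments\<close>

context independence
begin

lemma hitword_imp_nonempty: "hitword a 1 v \<Longrightarrow> v \<noteq> []"
  by (auto simp: hitword_def)

lemma hitword_unique:
  assumes "hitword a n v" "hitword a n v'" "below v \<xi>" "below v' \<xi>" shows "v \<doteq> v'"
proof -
  obtain k where k: "v \<preceq> lword \<xi> k" "v' \<preceq> lword \<xi> k" using belowE2 assms(3,4) .
  have "v \<preceq> v'" using hitword_minimal[OF assms(1) k] assms(2) by (simp add: hitword_def)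
  moreover have "v' \<preceq> v" using hitword_minimal[OF assms(2) k(2,1)] assms(1) by (simp add: hitword_def)
  ultimately show ?thesis by (rule tle_antisym)
qed

text \<open>\<open>canon a\<close> holds one word for each possible value of the first hitting time of \<open>a\<close>.\<close>

definition crep :: "'a \<Rightarrow> 'a list \<Rightarrow> 'a list" where
  "crep a v = (SOME w. hitword a 1 w \<and> w \<doteq> v)"

definition canon :: "'a \<Rightarrow> 'a list set" where
  "canon a = {v. hitword a 1 v \<and> crep a v = v}"

lemma crep_teq: "hitword a 1 v \<Longrightarrow> crep a v \<doteq> v"
  and crep_canon: "hitword a 1 v \<Longrightarrow> crep a v \<in> canon a"
proof -
  assume v: "hitword a 1 v"
  then have *: "hitword a 1 (crep a v) \<and> crep a v \<doteq> v"
    unfolding crep_def by (intro someI[of "\<lambda>w. hitword a 1 w \<and> w \<doteq> v" v]) auto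
  then show "crep a v \<doteq> v" by blast
  then have "(\<lambda>w. hitword a 1 w \<and> w \<doteq> crep a v) = (\<lambda>w. hitword a 1 w \<and> w \<doteq> v)"
    by (auto simp: fun_eq_iff intro: teq_trans teq_sym)
  then have "crep a (crep a v) = crep a v" by (simp add: crep_def)
  with * show "crep a v \<in> canon a" by (simp add: canon_def)
qed

lemma canon_hitword: "v \<in> canon a \<Longrightarrow> hitword a 1 v"
  by (simp add: canon_def)

lemma canon_unique:
  assumes "v \<in> canon a" "v' \<in> canon a" "below v \<xi>" "below v' \<xi>" shows "v = v'"
proof -
  have "v \<doteq> v'" using assms hitword_unique canon_hitword by blast
  then have "(\<lambda>w. hitword a 1 w \<and> w \<doteq> v) = (\<lambda>w. hitword a 1 w \<and> w \<doteq> v')"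
    by (auto simp: fun_eq_iff intro: teq_trans teq_sym)
  then have "crep a v = crep a v'" by (simp add: crep_def)
  with assms show ?thesis by (simp add: canon_def)
qed

lemma ex_canon_below: "below u \<xi> \<Longrightarrow> a \<in> set u \<Longrightarrow> \<exists>v\<in>canon a. below v \<xi>"
  using ex_hitword_below[of u \<xi> a] crep_canon teq_below[OF crep_teq] by blast

lemma Nil_notin_canon [simp]: "[] \<notin> canon a"
  using canon_hitword hitword_imp_nonempty by blast

text \<open>\<open>[]\<close> marks the absence of a hit; words in \<open>canon a\<close> are
  nonempty, so the two cases cannot be confused. The values lie in a countable type, unlike those of
  \<open>hit\<close>.\<close>

definition first_hit :: "'a \<Rightarrow> (nat \<Rightarrow> 'a set) \<Rightarrow> 'a list" where
  "first_hit a \<xi> = (if \<exists>v\<in>canon a. below v \<xi> then THE v. v \<in> canon a \<and> below v \<xi> else [])"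

lemma first_hit_eq: "v \<in> canon a \<Longrightarrow> below v \<xi> \<Longrightarrow> first_hit a \<xi> = v"
  unfolding first_hit_def by (subst if_P) (blast, rule the_equality, blast, blast dest: canon_unique)

lemma first_hit_cases:
  "(first_hit a \<xi> \<in> canon a \<and> below (first_hit a \<xi>) \<xi>) \<or> (first_hit a \<xi> = [] \<and> \<not> (\<exists>v\<in>canon a. below v \<xi>))"
proof (cases "\<exists>v\<in>canon a. below v \<xi>")
  case True
  then obtain v where "v \<in> canon a" "below v \<xi>" by blast
  then show ?thesis using first_hit_eq[of v a \<xi>] by simp
qed (simp add: first_hit_def)

lemma first_hit_iff: "v \<in> canon a \<Longrightarrow> first_hit a \<xi> = v \<longleftrightarrow> below v \<xi>"
  using first_hit_cases[of a \<xi>] first_hit_eq[of v a \<xi>] Nil_notin_canon[of a] by auto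

definition rest :: "'a \<Rightarrow> (nat \<Rightarrow> 'a set) \<Rightarrow> (nat \<Rightarrow> 'a set)" where
  "rest a \<xi> = (if first_hit a \<xi> = [] then \<xi> else bminus I \<xi> (heap_of (first_hit a \<xi>)))"

lemma rest_bdry: "\<xi> \<in> bdry I \<Longrightarrow> rest a \<xi> \<in> bdry I"
  using first_hit_cases[of a \<xi>] bminus_props(1)[of \<xi> "first_hit a \<xi>"] by (auto simp: rest_def)

lemma below_rest_iff:
  assumes "\<xi> \<in> bdry I" "v \<in> canon a" "first_hit a \<xi> = v"
  shows "below u (rest a \<xi>) \<longleftrightarrow> below (v @ u) \<xi>"
proof -
  have "v \<noteq> []" "below v \<xi>" using assms first_hit_iff by auto
  then show ?thesis using assms bminus_props(2) by (simp add: rest_def)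
qed

definition incr :: "'a \<Rightarrow> (nat \<Rightarrow> 'a set) \<Rightarrow> 'a list stream" where
  "incr a \<xi> = smap (first_hit a) (siterate (rest a) \<xi>)"

lemma shd_incr [simp]: "shd (incr a \<xi>) = first_hit a \<xi>"
  and stl_incr [simp]: "stl (incr a \<xi>) = incr a (rest a \<xi>)"
  by (simp_all add: incr_def)

text \<open>Since representatives are canonical, prescribing the first increments amounts to
  prescribing a prefix. Through this, multiplicativity on up-sets becomes independence of the
  increments.\<close>

lemma stake_incr_iff:
  "\<xi> \<in> bdry I \<Longrightarrow> vs \<in> lists (canon a) \<Longrightarrow> stake (length vs) (incr a \<xi>) = vs \<longleftrightarrow> below (concat vs) \<xi>"
proof (induction vs arbitrary: \<xi>)
  case Nil
  have "below [] \<xi>" by (auto simp: below_def)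
  then show ?case by simp
next
  case (Cons v vs)
  have v: "v \<in> canon a" "vs \<in> lists (canon a)" using Cons.prems by auto
  have "stake (length (v # vs)) (incr a \<xi>) = v # vs \<longleftrightarrow>
      first_hit a \<xi> = v \<and> below (concat vs) (rest a \<xi>)"
    using Cons.IH[OF rest_bdry[OF Cons.prems(1)] v(2)] by auto
  also have "\<dots> \<longleftrightarrow> first_hit a \<xi> = v \<and> below (v @ concat vs) \<xi>"
    using below_rest_iff[OF Cons.prems(1) v(1)] by blast
  also have "\<dots> \<longleftrightarrow> below (v @ concat vs) \<xi>"
    using first_hit_iff[OF v(1)] tle_below_trans[OF tle_append] by blast
  finally show ?case by simp
qed

lemma length_lword_le: "length (lword \<xi> n) \<le> n * CARD('a)"
proof (induction n)
  case (Suc n)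
  have "length (cw (\<xi> n)) = card (\<xi> n)" using distinct_card[OF distinct_cw, of "\<xi> n"] by simp
  also have "\<dots> \<le> CARD('a)" by (rule card_mono) auto
  finally show ?case using Suc by simp
qed simp

end

lemma in_sstart_UNIV: "s \<in> sstart UNIV xs \<longleftrightarrow> stake (length xs) s = xs"
  by (induction xs arbitrary: s) (simp_all add: streams_UNIV)

context bernoulli_heaps
begin

lemma AE_canon_below: "AE \<xi> in P. \<exists>v\<in>canon a. below v \<xi>"
  using AE_hit[of a]
proof eventually_elim
  case (elim \<xi>)
  then obtain k where "a \<in> \<xi> k" by blast
  then have "a \<in> set (lword \<xi> (Suc k))" unfolding set_lword by (rule UN_I[rotated]) simp
  then show ?case by (rule ex_canon_below[OF below_lword])
qed

lemma first_hit_measurable [measurable]: "first_hit a \<in> P \<rightarrow>\<^sub>M count_space UNIV"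
proof (rule measurable_count_space_eq2_countable[THEN iffD2], safe)
  fix v
  consider "v \<in> canon a" | "v = []" | "v \<notin> canon a" "v \<noteq> []" by blast
  then show "first_hit a -` {v} \<inter> space P \<in> sets P"
  proof cases
    case 1
    have "first_hit a -` {v} \<inter> space P = Up v" using first_hit_iff[OF 1] by (auto simp: Up_def)
    then show ?thesis by simp
  next
    case 2
    have "first_hit a -` {[]} \<inter> space P = space P - (\<Union>v\<in>canon a. Up v)"
    proof -
      have "first_hit a \<xi> = [] \<longleftrightarrow> \<not> (\<exists>v\<in>canon a. below v \<xi>)" for \<xi>
        using first_hit_cases[of a \<xi>] Nil_notin_canon[of a] by auto
      then show ?thesis by (auto simp: Up_def)
    qed
    also have "\<dots> \<in> sets P" by (intro sets.Diff sets.countable_UN' sets.top) auto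
    finally show ?thesis using 2 by simp
  next
    case 3
    then have "first_hit a -` {v} \<inter> space P = {}" using first_hit_cases[of a] by auto
    then show ?thesis by simp
  qed
qed auto

text \<open>Where a hit occurs, the preimage of \<open>Up u\<close> is the countable union of the
  sets \<open>Up (v @ u)\<close>; the other part comes from the default branch of
  \<open>rest\<close>.\<close>

lemma rest_measurable [measurable]: "rest a \<in> P \<rightarrow>\<^sub>M P"
proof (rule measurable_sigma_sets[OF sets_P])
  show "range Up \<subseteq> Pow (bdry I)" by (auto simp: Up_def)
  show "rest a \<in> space P \<rightarrow> bdry I" using rest_bdry by auto
  fix A assume "A \<in> range Up"
  then obtain u where A: "A = Up u" by blast
  have "rest a -` A \<inter> space P = (\<Union>v\<in>canon a. Up (v @ u)) \<union> (first_hit a -` {[]} \<inter> space P \<inter> Up u)" (is "?L = ?R")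
  proof (intro set_eqI iffI)
    fix \<xi> assume \<xi>: "\<xi> \<in> ?L"
    then have b: "\<xi> \<in> bdry I" "below u (rest a \<xi>)" by (auto simp: A Up_def)
    show "\<xi> \<in> ?R"
    proof (cases "first_hit a \<xi> = []")
      case True
      then show ?thesis using b by (simp add: rest_def Up_def)
    next
      case False
      then have "first_hit a \<xi> \<in> canon a" using first_hit_cases by blast
      then show ?thesis using b below_rest_iff[OF b(1)] by (auto simp: Up_def)
    qed
  next
    fix \<xi> assume \<xi>: "\<xi> \<in> ?R"
    then have b: "\<xi> \<in> bdry I" by (auto simp: Up_def)
    show "\<xi> \<in> ?L"
    proof (cases "first_hit a \<xi> = []")
      case True
      have "\<xi> \<notin> Up (v @ u)" if "v \<in> canon a" for v
      proof
        assume "\<xi> \<in> Up (v @ u)"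
        then have "below v \<xi>" using tle_below_trans[OF tle_append] by (auto simp: Up_def)
        then show False using first_hit_eq[OF that] True that by auto
      qed
      then show ?thesis using \<xi> b True by (auto simp: A rest_def Up_def)
    next
      case False
      then obtain v where v: "v \<in> canon a" "below (v @ u) \<xi>" using \<xi> by (auto simp: Up_def)
      then have "first_hit a \<xi> = v" using first_hit_iff tle_below_trans[OF tle_append] by blast
      then show ?thesis using below_rest_iff[OF b v(1)] v(2) b rest_bdry by (auto simp: A Up_def)
    qed
  qed
  also have "\<dots> \<in> sets P"
    using measurable_sets[OF first_hit_measurable, of "{[]}" a]
    by (intro sets.Un sets.Int[of "first_hit a -` {[]} \<inter> space P"] sets.countable_UN') auto
  finally show "rest a -` A \<inter> space P \<in> sets P" .
qed

lemma incr_measurable [measurable]: "incr a \<in> P \<rightarrow>\<^sub>M stream_space (count_space UNIV)"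
proof (rule measurable_stream_space2)
  fix n
  have "(rest a ^^ n) \<in> P \<rightarrow>\<^sub>M P"
    by (induction n) (auto simp: id_def intro: measurable_comp)
  then have "first_hit a \<circ> (rest a ^^ n) \<in> P \<rightarrow>\<^sub>M count_space UNIV"
    by (rule measurable_comp) measurable
  then show "(\<lambda>\<xi>. incr a \<xi> !! n) \<in> P \<rightarrow>\<^sub>M count_space UNIV"
    by (simp add: incr_def snth_siterate comp_def)
qed

section \<open>The law of the increments\<close>

definition step_law :: "'a \<Rightarrow> 'a list measure" where
  "step_law a = distr P (count_space UNIV) (first_hit a)"

sublocale step: discrete_prob_space "step_law a" for a
proof -
  interpret S: prob_space "step_law a" unfolding step_law_def by (rule prob_space_distr) measurable
  show "discrete_prob_space (step_law a)" by standard (simp add: step_law_def)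
qed

lemma emeasure_step_law: assumes "v \<in> canon a" shows "emeasure (step_law a) {v} = emeasure P (Up v)"
proof -
  have "first_hit a -` {v} \<inter> space P = Up v" using first_hit_iff[OF assms] by (auto simp: Up_def)
  then show ?thesis unfolding step_law_def by (subst emeasure_distr) auto
qed

lemma AE_step_law_canon: "AE v in step_law a. v \<in> canon a"
  unfolding step_law_def
  by (subst AE_distr_iff) (use AE_canon_below[of a] first_hit_cases in \<open>auto elim!: eventually_mono\<close>)

lemma emeasure_Up_append: "emeasure P (Up (u @ v)) = emeasure P (Up u) * emeasure P (Up v)"
  by (simp add: emeasure_eq_measure prob_Up_append ennreal_mult)

lemma emeasure_UN_canon:
  "emeasure P (\<Union>v\<in>canon a. Up (u @ v)) = (\<integral>\<^sup>+v. emeasure P (Up (u @ v)) \<partial>count_space (canon a))"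
proof (rule emeasure_UN_countable)
  have "v = v'" if v: "v \<in> canon a" "v' \<in> canon a" "\<xi> \<in> Up (u @ v)" "\<xi> \<in> Up (u @ v')" for v v' \<xi>
  proof -
    have \<xi>: "\<xi> \<in> bdry I" and b: "below (u @ v) \<xi>" "below (u @ v') \<xi>" using v by (auto simp: Up_def)
    have "below u \<xi>" using b(1) tle_below_trans[OF tle_append] by blast
    then show ?thesis using canon_unique[OF v(1,2)] b bminus_props(2)[OF \<xi>] by blast
  qed
  then show "disjoint_family_on (\<lambda>v. Up (u @ v)) (canon a)"
    by (auto simp: disjoint_family_on_def)
qed auto

text \<open>The sets \<open>Up (u @ v)\<close> with \<open>v\<close> in \<open>canon a\<close> are
  disjoint. By multiplicativity their total mass is that of \<open>Up u\<close> times the total mass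
  of the sets \<open>Up v\<close>, which is 1 since \<open>a\<close> is almost surely hit.\<close>

lemma AE_Up_extend: "AE \<xi> in P. below u \<xi> \<longrightarrow> (\<exists>v\<in>canon a. below (u @ v) \<xi>)"
proof -
  have sets: "(\<Union>v\<in>canon a. Up (u @ v)) \<in> sets P" for u by (intro sets.countable_UN') auto
  have "emeasure P (\<Union>v\<in>canon a. Up (u @ v)) = (\<integral>\<^sup>+v. emeasure P (Up u) * emeasure P (Up v) \<partial>count_space (canon a))"
    unfolding emeasure_UN_canon emeasure_Up_append ..
  also have "\<dots> = emeasure P (Up u) * (\<integral>\<^sup>+v. emeasure P (Up v) \<partial>count_space (canon a))"
    by (rule nn_integral_cmult) simp
  also have "(\<integral>\<^sup>+v. emeasure P (Up v) \<partial>count_space (canon a)) = emeasure P (\<Union>v\<in>canon a. Up v)"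
    using emeasure_UN_canon[of "[]" a] by simp
  also have "\<dots> = 1"
  proof (rule emeasure_eq_1_AE)
    show "AE \<xi> in P. \<xi> \<in> (\<Union>v\<in>canon a. Up v)"
      using AE_canon_below[of a] AE_space by eventually_elim (auto simp: Up_def)
  qed (use sets[of "[]"] in simp)
  finally have "emeasure P (Up u - (\<Union>v\<in>canon a. Up (u @ v))) = 0"
    using sets Up_mono[OF tle_append] by (subst emeasure_Diff) (auto simp: emeasure_eq_measure)
  then have "AE \<xi> in P. \<xi> \<notin> Up u - (\<Union>v\<in>canon a. Up (u @ v))"
    using sets by (intro AE_not_in null_setsI) auto
  then show ?thesis using AE_space by eventually_elim (auto simp: Up_def)
qed

text \<open>There are only countably many finite sequences of increments, so almost surely each one
  that occurs can be extended by \<open>AE_Up_extend\<close>. No invariance of \<open>P\<close>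
  under \<open>rest\<close> is invoked.\<close>

lemma AE_incr_canon: "AE \<xi> in P. incr a \<xi> \<in> streams (canon a)"
proof -
  have "AE \<xi> in P. \<forall>vs\<in>lists (canon a). below (concat vs) \<xi> \<longrightarrow> (\<exists>v\<in>canon a. below (concat vs @ v) \<xi>)"
    using AE_Up_extend by (subst AE_ball_countable) auto
  then show ?thesis using AE_space
  proof eventually_elim
    case (elim \<xi>)
    then have \<xi>: "\<xi> \<in> bdry I" by simp
    have *: "stake n (incr a \<xi>) \<in> lists (canon a)" for n
    proof (induction n)
      case (Suc n)
      let ?vs = "stake n (incr a \<xi>)"
      have "below (concat ?vs) \<xi>" using stake_incr_iff[OF \<xi> Suc] by simp
      then obtain v where v: "v \<in> canon a" "below (concat (?vs @ [v])) \<xi>" using elim(1) Suc by auto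
      have "?vs @ [v] \<in> lists (canon a)" using Suc v(1) by auto
      from stake_incr_iff[OF \<xi> this] v(2) have "stake (Suc n) (incr a \<xi>) = ?vs @ [v]" by simp
      then show ?case using \<open>?vs @ [v] \<in> lists (canon a)\<close> by simp
    qed simp
    have "incr a \<xi> !! n \<in> canon a" for n
    proof -
      have "stake (Suc n) (incr a \<xi>) ! n \<in> set (stake (Suc n) (incr a \<xi>))" by (intro nth_mem) simp
      then show ?thesis using *[of "Suc n"] stake_nth[of n "Suc n" "incr a \<xi>"] by auto
    qed
    then show ?case by (simp add: streams_iff_snth)
  qed
qed

text \<open>Compare cylinders: for words in \<open>canon a\<close> both sides are products of up-set
  probabilities, and a cylinder involving any other word is null on both sides.\<close>

lemma distr_incr: "distr P (stream_space (count_space UNIV)) (incr a) = stream_space (step_law a)"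
proof (rule stream_space_eq_sstart[of UNIV])
  show "prob_space (distr P (stream_space (count_space UNIV)) (incr a))"
    by (rule prob_space_distr) measurable
  show "prob_space (stream_space (step_law a))" by (rule step.prob_space_stream_space)
  show "sets (stream_space (step_law a)) = sets (stream_space (count_space UNIV))"
    by (rule sets_stream_space_cong) (simp add: step_law_def)
  fix xs :: "'a list list"
  have eq: "emeasure (distr P (stream_space (count_space UNIV)) (incr a)) (sstart UNIV xs)
      = emeasure P {\<xi>\<in>bdry I. stake (length xs) (incr a \<xi>) = xs}"
  proof -
    have "incr a -` sstart UNIV xs \<inter> space P = {\<xi>\<in>bdry I. stake (length xs) (incr a \<xi>) = xs}"
      by (auto simp: in_sstart_UNIV)
    then show ?thesis by (subst emeasure_distr) simp_all
  qed
  show "emeasure (distr P (stream_space (count_space UNIV)) (incr a)) (sstart UNIV xs)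
      = emeasure (stream_space (step_law a)) (sstart UNIV xs)"
  proof (cases "xs \<in> lists (canon a)")
    case True
    have "{\<xi>\<in>bdry I. stake (length xs) (incr a \<xi>) = xs} = Up (concat xs)"
      using stake_incr_iff[OF _ True] by (auto simp: Up_def)
    moreover have "emeasure P (Up (concat xs)) = (\<Prod>x\<leftarrow>xs. emeasure (step_law a) {x})"
      using True
    proof (induction xs)
      case Nil
      have "Up [] = space P" by (auto simp: Up_def below_def)
      then show ?case using emeasure_space_1 by simp
    qed (simp add: emeasure_Up_append emeasure_step_law)
    ultimately show ?thesis unfolding eq step.emeasure_sstart by simp
  next
    case False
    then obtain x where x: "x \<in> set xs" "x \<notin> canon a" by auto
    have "emeasure (step_law a) {x} = 0"
    proof -
      have "AE v in step_law a. v \<notin> {x}" using AE_step_law_canon[of a] by eventually_elim (use x in auto)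
      then show ?thesis by (subst (asm) AE_iff_measurable[of "{x}"]) (auto simp: step_law_def)
    qed
    then have "(\<Prod>x\<leftarrow>xs. emeasure (step_law a) {x}) = 0" using x(1) by (induction xs) auto
    moreover have "AE \<xi> in P. \<not> stake (length xs) (incr a \<xi>) = xs"
      using AE_incr_canon[of a]
    proof eventually_elim
      case (elim \<xi>)
      have "stake n s \<in> lists (canon a)" if "s \<in> streams (canon a)" for n s
        using that by (induction n arbitrary: s) (auto simp: streams_shd streams_stl)
      from this[OF elim, of "length xs"] show ?case using False by auto
    qed
    then have "emeasure P {\<xi>\<in>bdry I. stake (length xs) (incr a \<xi>) = xs} = 0"
      using emeasure_eq_0_AE[of "\<lambda>\<xi>. stake (length xs) (incr a \<xi>) = xs" P] by simp
    ultimately show ?thesis unfolding eq step.emeasure_sstart by simp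
  qed
qed (auto simp: streams_UNIV)

lemma AE_incr: "AE s in stream_space (step_law a). Q s \<Longrightarrow> AE \<xi> in P. Q (incr a \<xi>)"
  unfolding distr_incr[symmetric] by (rule AE_distrD) measurable

text \<open>Let \<open>k\<close> be the first layer containing \<open>a\<close>. The hit lies within
  the first \<open>Suc k\<close> layers, each with at most \<open>CARD('a)\<close> pieces, and
  \<open>Suc k\<close> is the number of \<open>n\<close> with \<xi> in \<open>avoid a n\<close>.
  Counted this way, the expectation becomes the sum of the avoidance probabilities.\<close>

lemma length_first_hit_le:
  assumes "\<xi> \<in> bdry I"
  shows "ennreal (real (length (first_hit a \<xi>))) \<le> ennreal (real CARD('a)) * (\<Sum>n. indicator (avoid a n) \<xi>)"
proof (cases "first_hit a \<xi> = []")
  case False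
  then have v: "first_hit a \<xi> \<in> canon a" "below (first_hit a \<xi>) \<xi>" using first_hit_cases by blast+
  have h: "hitword a 1 (first_hit a \<xi>)" by (rule canon_hitword[OF v(1)])
  obtain m where m: "first_hit a \<xi> \<preceq> lword \<xi> m" using v(2) by (auto simp: below_def)
  have "\<exists>k. a \<in> \<xi> k"
  proof -
    have "1 \<le> count_list (lword \<xi> m) a" using tle_count[OF m, of a] h by (simp add: hitword_def)
    then have "a \<in> set (lword \<xi> m)" using count_list_0_iff[of "lword \<xi> m" a] by auto
    then show ?thesis by (auto simp: set_lword)
  qed
  then obtain k where k: "a \<in> \<xi> k" "\<And>j. j < k \<Longrightarrow> a \<notin> \<xi> j" using exists_least_iff[of "\<lambda>k. a \<in> \<xi> k"] by blast
  have le: "first_hit a \<xi> \<preceq> lword \<xi> (Suc k)"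
  proof (rule hitword_minimal[OF h])
    show "first_hit a \<xi> \<preceq> lword \<xi> (max m (Suc k))" by (rule tle_trans[OF m lword_tle_mono]) simp
    show "lword \<xi> (Suc k) \<preceq> lword \<xi> (max m (Suc k))" by (rule lword_tle_mono) simp
    show "1 \<le> count_list (lword \<xi> (Suc k)) a" using k(1) by simp
  qed
  have "length (first_hit a \<xi>) \<le> Suc k * CARD('a)" using tle_length[OF le] length_lword_le[of \<xi> "Suc k"] by linarith
  then have "ennreal (real (length (first_hit a \<xi>))) \<le> ennreal (real (Suc k * CARD('a)))"
    by (intro ennreal_leI) (simp only: of_nat_le_iff)
  also have "\<dots> = ennreal (real CARD('a)) * ennreal (real (Suc k))"
    by (simp only: of_nat_mult ennreal_mult[symmetric] mult.commute of_nat_0_le_iff)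
  also have "ennreal (real (Suc k)) = (\<Sum>n<Suc k. indicator (avoid a n) \<xi>)"
  proof -
    have "(\<Sum>n<Suc k. indicator (avoid a n) \<xi>) = (\<Sum>n<Suc k. (1 :: ennreal))"
      using assms k(2) by (intro sum.cong) (auto simp: avoid_def)
    then show ?thesis by (simp add: ennreal_of_nat_eq_real_of_nat)
  qed
  also have "ennreal (real CARD('a)) * \<dots> \<le> ennreal (real CARD('a)) * (\<Sum>n. indicator (avoid a n) \<xi>)"
    by (intro mult_left_mono sum_le_suminf) auto
  finally show ?thesis .
qed simp

lemma integrable_step_length: "integrable (step_law a) (\<lambda>v. real (length v))"
proof (rule integrableI_bounded)
  have "(\<integral>\<^sup>+v. ennreal (norm (real (length v))) \<partial>step_law a) = (\<integral>\<^sup>+\<xi>. ennreal (real (length (first_hit a \<xi>))) \<partial>P)"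
    unfolding step_law_def by (subst nn_integral_distr) auto
  also have "\<dots> \<le> (\<integral>\<^sup>+\<xi>. ennreal (real CARD('a)) * (\<Sum>n. indicator (avoid a n) \<xi>) \<partial>P)"
    by (rule nn_integral_mono) (rule length_first_hit_le, simp)
  also have "\<dots> = ennreal (real CARD('a)) * (\<Sum>n. emeasure P (avoid a n))"
    by (simp add: nn_integral_cmult nn_integral_suminf)
  also have "(\<Sum>n. emeasure P (avoid a n)) = ennreal (\<Sum>n. prob (avoid a n))"
    using avoid_summable by (simp add: emeasure_eq_measure suminf_ennreal2)
  also have "ennreal (real CARD('a)) * \<dots> < \<infinity>"
    by (simp add: ennreal_mult_less_top)
  finally show "(\<integral>\<^sup>+v. ennreal (norm (real (length v))) \<partial>step_law a) < \<infinity>" .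
qed (simp add: step_law_def)

end

section \<open>Limits and their comparison\<close>

context discrete_prob_space
begin

lemma distr_shd: "distr (stream_space M) M shd = M"
proof (rule measure_eqI)
  fix A assume "A \<in> sets (distr (stream_space M) M shd)"
  then have A: "A \<in> sets M" by simp
  then have A': "shd -` A \<inter> space (stream_space M) \<in> sets (stream_space M)"
    by (rule measurable_sets[OF measurable_shd])
  interpret S: prob_space "stream_space M" by (rule prob_space_stream_space)
  have "emeasure (distr (stream_space M) M shd) A = emeasure (stream_space M) (shd -` A \<inter> space (stream_space M))"
    using A by (simp add: emeasure_distr)
  also have "\<dots> = (\<integral>\<^sup>+t. emeasure (stream_space M) {x\<in>space (stream_space M). t ## x \<in> shd -` A \<inter> space (stream_space M)} \<partial>M)"
    by (rule emeasure_stream_space[OF A'])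
  also have "\<dots> = (\<integral>\<^sup>+t. indicator A t \<partial>M)"
  proof (rule nn_integral_cong)
    fix t
    have "{x\<in>space (stream_space M). t ## x \<in> shd -` A \<inter> space (stream_space M)} = (if t \<in> A then space (stream_space M) else {})"
      by (auto simp: space_stream_space_eq)
    then show "emeasure (stream_space M) {x\<in>space (stream_space M). t ## x \<in> shd -` A \<inter> space (stream_space M)} = indicator A t"
      using S.emeasure_space_1 by simp
  qed
  also have "\<dots> = emeasure M A" using A by simp
  finally show "emeasure (distr (stream_space M) M shd) A = emeasure M A" .
qed simp

lemma shd_funpow_stl: "shd ((stl ^^ i) s) = s !! i"
  by (simp flip: sdrop_eq_funpow)

lemma stream_average:
  fixes F :: "'a \<Rightarrow> real"
  assumes "integrable M F"
  shows "AE s in stream_space M. (\<lambda>n. (\<Sum>i<n. F (s !! i)) / real n) \<longlonglongrightarrow> (\<integral>x. F x \<partial>M)"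
proof -
  interpret E: ergodic_system "stream_space M" stl using ergodic_sdrop[of 1] by simp
  have F: "F \<in> borel_measurable M" using assms by auto
  have "integrable (stream_space M) (\<lambda>s. F (shd s))"
    using integrable_distr[OF measurable_shd, of M F] assms by (simp add: distr_shd)
  moreover have "(\<integral>s. F (shd s) \<partial>stream_space M) = (\<integral>x. F x \<partial>M)"
    using integral_distr[OF measurable_shd F] by (simp add: distr_shd)
  ultimately show ?thesis using E.birkhoff[of "\<lambda>s. F (shd s)"] by (simp add: shd_funpow_stl)
qed

lemma integrable_snth:
  fixes F :: "'a \<Rightarrow> real"
  assumes "integrable M F" shows "integrable (stream_space M) (\<lambda>s. F (s !! i))"
proof -
  interpret E: ergodic_system "stream_space M" stl using ergodic_sdrop[of 1] by simp
  have "integrable (stream_space M) (\<lambda>s. F (shd s))"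
    using integrable_distr[OF measurable_shd, of M F] assms by (simp add: distr_shd)
  from E.integrable_T_pow[OF this, of i] show ?thesis by (simp add: shd_funpow_stl)
qed

end

text \<open>Let \<open>N\<close> count visits and \<open>J n\<close> be the last visit before
  \<open>n\<close>. Since \<open>N n = N (J n) + 1\<close>, both \<open>N (J n) / n\<close> and
  \<open>N (J n) / J n\<close> tend to \<open>p > 0\<close>, so \<open>J n / n\<close> tends to 1;
  linear growth transfers this to \<open>s\<close>.\<close>

lemma last_visit_ratio:
  fixes H :: "nat \<Rightarrow> bool" and s :: "nat \<Rightarrow> real"
  assumes p: "(\<lambda>n. (\<Sum>i<n. of_bool (H i)) / real n) \<longlonglongrightarrow> p" "0 < p"
    and s: "(\<lambda>n. s n / real n) \<longlonglongrightarrow> l" "0 < l"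
  shows "\<exists>J. eventually (\<lambda>n. J n < n \<and> H (J n)) sequentially \<and> (\<lambda>n. s (J n) / s n) \<longlonglongrightarrow> 1"
proof -
  define N :: "nat \<Rightarrow> real" where "N n = (\<Sum>i<n. of_bool (H i))" for n
  define J where "J n = Max {j. j < n \<and> H j}" for n
  have Nlim: "(\<lambda>n. N n / real n) \<longlonglongrightarrow> p" using p by (simp add: N_def)
  have Ninf: "filterlim N at_top sequentially"
  proof -
    have "filterlim (\<lambda>n. N n / real n * real n) at_top sequentially"
      by (rule filterlim_tendsto_pos_mult_at_top[OF Nlim p(2) filterlim_real_sequentially])
    moreover have "eventually (\<lambda>n. N n / real n * real n \<le> N n) sequentially"
      using eventually_gt_at_top[of 0] by eventually_elim simp
    ultimately show ?thesis by (rule filterlim_at_top_mono)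
  qed
  \<comment> \<open>Positivity of \<open>N n\<close> guarantees a visit before \<open>n\<close>, so
    that the maximum defining \<open>J n\<close> is over a nonempty set.\<close>
  have J: "J n < n \<and> H (J n) \<and> N n = N (J n) + 1" if "0 < N n" for n
  proof -
    let ?S = "{j. j < n \<and> H j}"
    have "?S \<noteq> {}"
    proof
      assume "?S = {}"
      then have "N n = (\<Sum>i<n. 0)" unfolding N_def by (intro sum.cong) auto
      then show False using that by simp
    qed
    moreover have fin: "finite ?S" by simp
    ultimately have "J n \<in> ?S" unfolding J_def by (intro Max_in)
    moreover have "\<not> H i" if "J n < i" "i < n" for i
    proof
      assume "H i"
      with that have "i \<le> Max ?S" by (intro Max_ge[OF fin]) simp
      with that show False by (simp add: J_def)
    qed
    then have "N n = N (Suc (J n))"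
      unfolding N_def using \<open>J n \<in> ?S\<close> by (intro sum.mono_neutral_right) auto
    ultimately show ?thesis by (simp add: N_def)
  qed
  have evJ: "eventually (\<lambda>n. J n < n \<and> H (J n) \<and> N n = N (J n) + 1) sequentially"
    using Ninf[unfolded filterlim_at_top_dense, rule_format, of 0] by eventually_elim (rule J)
  have NJinf: "filterlim (\<lambda>n. N (J n)) at_top sequentially"
  proof -
    have "filterlim (\<lambda>n. -1 + N n) at_top sequentially"
      by (rule filterlim_tendsto_add_at_top[OF tendsto_const Ninf])
    moreover have "eventually (\<lambda>n. -1 + N n \<le> N (J n)) sequentially" using evJ by eventually_elim simp
    ultimately show ?thesis by (rule filterlim_at_top_mono)
  qed
  have Nle: "N n \<le> real n" for n
    unfolding N_def using sum_bounded_above[of "{..<n}" "\<lambda>i. of_bool (H i)" "1::real"] by simp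
  have "filterlim (\<lambda>n. real (J n)) at_top sequentially"
    by (rule filterlim_at_top_mono[OF NJinf]) (simp add: Nle)
  then have Jinf: "filterlim J at_top sequentially"
    by (simp add: filterlim_sequentially_iff_filterlim_real)
  have "(\<lambda>n. N n / real n - 1 / real n) \<longlonglongrightarrow> p - 0"
    by (intro tendsto_diff Nlim lim_1_over_n)
  moreover have "eventually (\<lambda>n. N n / real n - 1 / real n = N (J n) / real n) sequentially"
    using evJ by eventually_elim (simp add: diff_divide_distrib[symmetric])
  ultimately have "(\<lambda>n. N (J n) / real n) \<longlonglongrightarrow> p - 0" by (rule Lim_transform_eventually)
  then have NJ: "(\<lambda>n. N (J n) / real n) \<longlonglongrightarrow> p" by simp
  have "(\<lambda>n. (N (J n) / real n) / (N (J n) / real (J n))) \<longlonglongrightarrow> p / p"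
    using p(2) by (intro tendsto_divide NJ filterlim_compose[OF Nlim Jinf]) auto
  moreover have "eventually (\<lambda>n. (N (J n) / real n) / (N (J n) / real (J n)) = real (J n) / real n) sequentially"
    using NJinf[unfolded filterlim_at_top_dense, rule_format, of 0] by eventually_elim simp
  ultimately have "(\<lambda>n. real (J n) / real n) \<longlonglongrightarrow> p / p" by (rule Lim_transform_eventually)
  then have Jn: "(\<lambda>n. real (J n) / real n) \<longlonglongrightarrow> 1" using p(2) by simp
  have "(\<lambda>n. (s (J n) / real (J n)) * (real (J n) / real n) / (s n / real n)) \<longlonglongrightarrow> l * 1 / l"
    using s(2) by (intro tendsto_divide tendsto_mult filterlim_compose[OF s(1) Jinf] Jn s(1)) auto
  then have "(\<lambda>n. (s (J n) / real (J n)) * (real (J n) / real n) / (s n / real n)) \<longlonglongrightarrow> 1" using s(2) by simp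
  moreover have "eventually (\<lambda>n. (s (J n) / real (J n)) * (real (J n) / real n) / (s n / real n) = s (J n) / s n) sequentially"
    using Jinf[unfolded filterlim_at_top, rule_format, of 1] eventually_gt_at_top[of 0]
    by eventually_elim simp
  ultimately have "(\<lambda>n. s (J n) / s n) \<longlonglongrightarrow> 1" by (rule Lim_transform_eventually)
  moreover have "eventually (\<lambda>n. J n < n \<and> H (J n)) sequentially" using evJ by eventually_elim simp
  ultimately show ?thesis by blast
qed

section \<open>Dependence walks between two pieces\<close>

context independence
begin

text \<open>Whenever the path passes through \<open>a\<close> again, what came before is discarded
  and the walk starts afresh.\<close>

lemma walk_avoiding:
  assumes "(\<lambda>x y. \<not> I x y)\<^sup>*\<^sup>* a b"
  shows "b \<noteq> a \<Longrightarrow> \<exists>w. walk (a # w @ [b]) \<and> a \<notin> set w"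
  using assms
proof (induction rule: rtranclp_induct)
  case (step y z)
  show ?case
  proof (cases "y = a")
    case True
    then show ?thesis using step.hyps by (intro exI[of _ "[]"]) auto
  next
    case False
    then obtain w where w: "walk (a # w @ [y])" "a \<notin> set w" using step.IH by blast
    have "walk ((a # w @ [y]) @ [z])" using w(1) step.hyps(2) by (subst successively_append_iff) auto
    then show ?thesis using w(2) False by (intro exI[of _ "w @ [y]"]) auto
  qed
qed simp

lemma pyramid_walk: assumes "walk y" shows "pyramid y"
  unfolding pyramid_def
proof (intro allI impI)
  fix p c q assume y: "y = p @ c # q \<and> q \<noteq> []"
  then have "walk (c # q)" using assms by (simp add: successively_append_iff)
  then have "\<not> I c (hd q)" using y by (cases q) auto
  then show "\<exists>d\<in>set q. \<not> I c d" using y hd_in_set by blast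
qed

text \<open>The tip of a nonempty \<open>u\<close> is \<open>a\<close>, on which the first letter of
  \<open>y\<close> depends; for the other letters the condition holds inside \<open>u\<close> or
  \<open>y\<close>.\<close>

lemma pyramid_append_walk:
  assumes u: "pyramid u" "u \<noteq> [] \<longrightarrow> last u = a" and y: "walk (a # y)" "y \<noteq> []"
  shows "pyramid (u @ y)"
  unfolding pyramid_def
proof (intro allI impI)
  fix p c q assume pcq: "u @ y = p @ c # q \<and> q \<noteq> []"
  have "pyramid y" using y(1) by (intro pyramid_walk) (cases y, auto)
  obtain us where "(u = p @ us \<and> us @ y = c # q) \<or> y = us @ c # q"
    using pcq unfolding append_eq_append_conv2 by blast
  then have "(\<exists>r. u = p @ c # r \<and> q = r @ y) \<or> (\<exists>r. y = r @ c # q)"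
    by (cases us) auto
  then show "\<exists>d\<in>set q. \<not> I c d"
  proof
    assume "\<exists>r. u = p @ c # r \<and> q = r @ y"
    then obtain r where r: "u = p @ c # r" "q = r @ y" by blast
    show ?thesis
    proof (cases "r = []")
      case True
      then have "c = a" "q = y" using r u(2) by auto
      then show ?thesis using y by (cases y) auto
    next
      case False
      then have "\<exists>d\<in>set r. \<not> I c d" using r u(1) unfolding pyramid_def by blast
      then show ?thesis using r(2) by auto
    qed
  next
    assume "\<exists>r. y = r @ c # q"
    then show ?thesis using \<open>pyramid y\<close> pcq unfolding pyramid_def by blast
  qed
qed

definition incr_word :: "'a \<Rightarrow> nat \<Rightarrow> (nat \<Rightarrow> 'a set) \<Rightarrow> 'a list" where
  "incr_word a n \<xi> = concat (stake n (incr a \<xi>))"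

lemma incr_word_Suc: "incr_word a (Suc n) \<xi> = incr_word a n \<xi> @ incr a \<xi> !! n"
  by (simp add: incr_word_def stake_Suc del: stake.simps(2))

lemma length_incr_word: "length (incr_word a n \<xi>) = (\<Sum>i<n. length (incr a \<xi> !! i))"
proof (induction n)
  case (Suc n)
  then show ?case by (simp add: incr_word_Suc)
qed (simp add: incr_word_def)

lemma incr_word_mono: "m \<le> n \<Longrightarrow> prefix (incr_word a m \<xi>) (incr_word a n \<xi>)"
proof (induction n rule: dec_induct)
  case (step n)
  then show ?case unfolding incr_word_Suc by (rule_tac prefix_prefix)
qed simp

lemma incr_word_props:
  assumes \<xi>: "\<xi> \<in> bdry I" "incr a \<xi> \<in> streams (canon a)"
  shows below_incr_word: "below (incr_word a n \<xi>) \<xi>"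
    and hitword_incr_word: "hitword a n (incr_word a n \<xi>)"
    and Viter_incr_word: "Viter I a n \<xi> = heap_of (incr_word a n \<xi>)"
proof -
  have L: "stake n (incr a \<xi>) \<in> lists (canon a)"
  proof -
    have "stake n s \<in> lists (canon a)" if "s \<in> streams (canon a)" for s
      using that by (induction n arbitrary: s) (auto simp: streams_shd streams_stl)
    then show ?thesis using \<xi>(2) .
  qed
  then show b: "below (incr_word a n \<xi>) \<xi>"
    using stake_incr_iff[OF \<xi>(1) L] by (simp add: incr_word_def)
  have h: "\<And>v. v \<in> set (stake n (incr a \<xi>)) \<Longrightarrow> hitword a 1 v" using L canon_hitword by blast
  show "hitword a n (incr_word a n \<xi>)"
    using hitword_concat[of "stake n (incr a \<xi>)" a, OF h] by (simp add: incr_word_def)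
  show "Viter I a n \<xi> = heap_of (incr_word a n \<xi>)"
    using Viter_eq[of \<xi> "stake n (incr a \<xi>)" a, OF \<xi>(1) h] b by (simp add: incr_word_def)
qed

text \<open>A step that walks from \<open>a\<close> to \<open>b\<close> and back puts the whole past below the current occurrence of \<open>b\<close>.\<close>

lemma incr_word_sandwich:
  assumes ab: "b \<noteq> a" "(\<lambda>x y. \<not> I x y)\<^sup>*\<^sup>* a b"
  shows "\<exists>x\<in>canon a. \<forall>\<xi> j n. \<xi> \<in> bdry I \<longrightarrow> incr a \<xi> \<in> streams (canon a) \<longrightarrow> incr b \<xi> \<in> streams (canon b) \<longrightarrow>
    j < n \<longrightarrow> incr a \<xi> !! j = x \<longrightarrow>
    incr_word a j \<xi> \<preceq> incr_word b (count_list (incr_word a n \<xi>) b) \<xi> \<and>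
    incr_word b (count_list (incr_word a n \<xi>) b) \<xi> \<preceq> incr_word a n \<xi>"
proof -
  obtain w where w: "walk (a # w @ [b])" "a \<notin> set w" using walk_avoiding[OF ab(2,1)] by blast
  \<comment> \<open>The initial \<open>a\<close> of the walk is omitted, being the tip of the
    preceding increment. So \<open>a\<close> occurs only at the end, and \<open>x0\<close> is a
    possible increment.\<close>
  define x0 where "x0 = w @ b # rev w @ [a]"
  have "walk (rev (a # w @ [b]))" using w(1) I_sym by (subst successively_rev) (auto intro: successively_mono)
  then have bwd: "walk (b # rev w @ [a])" by simp
  have fwd: "walk (w @ [b])" using w(1) by (cases w) auto
  have "walk x0" unfolding x0_def using bwd fwd by (auto simp: successively_append_iff)
  then have x0: "hitword a 1 x0" using w(2) ab(1) pyramid_walk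
    by (simp add: hitword_def x0_def count_list_0_iff)
  have "incr_word a j \<xi> \<preceq> incr_word b (count_list (incr_word a n \<xi>) b) \<xi> \<and>
    incr_word b (count_list (incr_word a n \<xi>) b) \<xi> \<preceq> incr_word a n \<xi>"
    if \<xi>: "\<xi> \<in> bdry I" "incr a \<xi> \<in> streams (canon a)" "incr b \<xi> \<in> streams (canon b)"
      and j: "j < n" "incr a \<xi> !! j = crep a x0" for \<xi> j n
  proof -
    let ?A = "\<lambda>n. incr_word a n \<xi>"
    define m where "m = count_list (?A n) b"
    have A: "below (?A n) \<xi>" "hitword a n (?A n)" for n
      using below_incr_word[OF \<xi>(1,2)] hitword_incr_word[OF \<xi>(1,2)] by auto
    have B: "below (incr_word b m \<xi>) \<xi>" "hitword b m (incr_word b m \<xi>)"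
      using below_incr_word[OF \<xi>(1,3)] hitword_incr_word[OF \<xi>(1,3)] by auto
    obtain k where k: "?A n \<preceq> lword \<xi> k" "incr_word b m \<xi> \<preceq> lword \<xi> k" using belowE2[OF A(1) B(1)] .
    have "incr_word b m \<xi> \<preceq> ?A n" using hitword_minimal[OF B(2) k(2,1)] by (simp add: m_def)
    moreover have "?A j \<preceq> incr_word b m \<xi>"
    proof -
      \<comment> \<open>The step is cut at its visit to \<open>b\<close>: this is a pyramid with tip
        \<open>b\<close>, so it lies below every heap under the same bound that holds at least as
        many \<open>b\<close>. For \<open>j = 0\<close> the past is empty and \<open>w @ [b]\<close>
        is itself a walk.\<close>
      let ?u = "?A j @ w @ [b]"
      have "?u @ rev w @ [a] \<doteq> ?A (Suc j)"
        using crep_teq[OF x0] by (simp add: incr_word_Suc j(2) x0_def teq_sym)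
      then have "?u \<preceq> ?A (Suc j)" using tle_append tle_teq_trans by blast
      also have "?A (Suc j) \<preceq> ?A n"
        using incr_word_mono[of "Suc j" n a \<xi>] j(1) by (auto elim!: prefixE)
      finally have u: "?u \<preceq> ?A n" .
      have "pyramid ?u"
      proof (rule pyramid_append_walk)
        show "pyramid (?A j)" "?A j \<noteq> [] \<longrightarrow> last (?A j) = a" using A(2)[of j] by (auto simp: hitword_def)
        show "walk (a # w @ [b])" by (rule w(1))
      qed simp
      then have hu: "hitword b (count_list ?u b) ?u" by (simp add: hitword_def)
      have "?u \<preceq> incr_word b m \<xi>"
      proof (rule hitword_minimal[OF hu])
        show "?u \<preceq> lword \<xi> k" using u k(1) by (rule tle_trans)
        show "incr_word b m \<xi> \<preceq> lword \<xi> k" by (rule k(2))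
        show "count_list ?u b \<le> count_list (incr_word b m \<xi>) b"
          using tle_count[OF u, of b] B(2) by (simp add: hitword_def m_def)
      qed
      then show ?thesis by (rule tle_appendD)
    qed
    ultimately show ?thesis by (simp add: m_def)
  qed
  then show ?thesis using crep_canon[OF x0] by blast
qed

end

section \<open>Almost sure limits and their independence of the piece\<close>

context bernoulli_heaps
begin

context
  fixes \<phi> :: "(nat \<Rightarrow> 'a set) \<Rightarrow> real"
  assumes nonneg: "\<And>x. x \<in> fheaps I \<Longrightarrow> 0 \<le> \<phi> x"
    and subadditive: "\<And>x y. x \<in> fheaps I \<Longrightarrow> y \<in> fheaps I \<Longrightarrow> \<phi> (hmul I x y) \<le> \<phi> x + \<phi> y"
begin

lemma phi_append: "\<phi> (heap_of (u @ v)) \<le> \<phi> (heap_of u) + \<phi> (heap_of v)"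
  using subadditive[of "heap_of u" "heap_of v"] by (simp add: hmul_heap_of)

text \<open>\<open>C\<close> is the largest value on a single piece. The value at the empty heap
  stays as a constant, since sub-additivity does not force it to vanish.\<close>

lemma phi_linear: "\<exists>C\<ge>0. \<forall>w. \<phi> (heap_of w) \<le> \<phi> (heap_of []) + C * real (length w)"
proof -
  define C where "C = Max (range (\<lambda>b. \<phi> (heap_of [b])))"
  have C: "\<phi> (heap_of [b]) \<le> C" for b unfolding C_def by (rule Max_ge) auto
  have "0 \<le> C" by (rule order_trans[OF nonneg[OF heap_of_fheaps] C])
  moreover have "\<phi> (heap_of w) \<le> \<phi> (heap_of []) + C * real (length w)" for w
  proof (induction w)
    case (Cons b w)
    have "\<phi> (heap_of (b # w)) \<le> \<phi> (heap_of [b]) + \<phi> (heap_of w)" using phi_append[of "[b]" w] by simp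
    with Cons C[of b] show ?case by (simp add: algebra_simps)
  qed simp
  ultimately show ?thesis by blast
qed

text \<open>The limit is the mean length of an increment, at least 1 because words in
  \<open>canon a\<close> are nonempty; positivity permits division by it later.\<close>

lemma AE_length_average:
  "\<exists>l>0. AE \<xi> in P. (\<lambda>n. real (length (incr_word a n \<xi>)) / real n) \<longlonglongrightarrow> l"
proof (intro exI conjI)
  let ?l = "\<integral>v. real (length v) \<partial>step_law a"
  have "AE v in step_law a. 1 \<le> real (length v)"
    using AE_step_law_canon[of a]
  proof eventually_elim
    case (elim v)
    then show ?case by (cases v) auto
  qed
  then have "1 \<le> ?l" using integrable_step_length by (rule step.integral_ge_const[rotated])
  then show "0 < ?l" by simp
  show "AE \<xi> in P. (\<lambda>n. real (length (incr_word a n \<xi>)) / real n) \<longlonglongrightarrow> ?l"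
    using AE_incr[OF step.stream_average[OF integrable_step_length[of a]]] by (simp add: length_incr_word)
qed

lemma AE_visit_average:
  assumes "x \<in> canon a"
  shows "AE \<xi> in P. (\<lambda>n. (\<Sum>i<n. of_bool (incr a \<xi> !! i = x)) / real n) \<longlonglongrightarrow> prob (Up x)"
proof -
  have "integrable (step_law a) (\<lambda>v. of_bool (v = x) :: real)"
    by (rule step.integrable_const_bound[of _ 1]) (auto simp: step_law_def)
  moreover have "(\<integral>v. of_bool (v = x) \<partial>step_law a) = prob (Up x)"
  proof -
    have "(\<integral>v. of_bool (v = x) \<partial>step_law a) = (\<integral>v. indicator {x} v \<partial>step_law a)"
      by (rule Bochner_Integration.integral_cong) (auto simp: indicator_def)
    also have "\<dots> = measure (step_law a) {x}" by (simp add: step_law_def)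
    finally show ?thesis using emeasure_step_law[OF assms] by (simp add: measure_def)
  qed
  ultimately show ?thesis
    using AE_incr[OF step.stream_average[of a "\<lambda>v. of_bool (v = x)"]] by simp
qed

text \<open>Kingman's theorem is applied to the independent stream of increments, where \<phi> of
  the first \<open>n\<close> words concatenated is a sub-additive cocycle, and the result is pulled
  back by \<open>AE_incr\<close>. Integrability comes from \<open>phi_linear\<close> and the mean
  length of an increment.\<close>

lemma AE_phi_average:
  "\<exists>c. AE \<xi> in P. (\<lambda>n. \<phi> (heap_of (incr_word a n \<xi>)) / real n) \<longlonglongrightarrow> c"
proof -
  define g where "g n s = \<phi> (heap_of (concat (stake n s)))" for n s
  obtain C where C: "0 \<le> C" "\<And>w. \<phi> (heap_of w) \<le> \<phi> (heap_of []) + C * real (length w)"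
    using phi_linear by blast
  interpret S: prob_space "stream_space (step_law a)" by (rule step.prob_space_stream_space)
  interpret E: ergodic_system "stream_space (step_law a)" stl using step.ergodic_sdrop[of 1 a] by simp
  have sets: "sets (stream_space (step_law a)) = sets (stream_space (count_space UNIV))"
    by (rule sets_stream_space_cong) (simp add: step_law_def)
  have meas: "g n \<in> borel_measurable (stream_space (step_law a))" for n
  proof -
    have "(\<lambda>w. \<phi> (heap_of (concat w))) \<circ> stake n \<in> borel_measurable (stream_space (count_space UNIV))"
      by (rule measurable_comp[OF measurable_stake]) simp
    then show ?thesis unfolding g_def comp_def by (subst measurable_cong_sets[OF sets refl])
  qed
  have len: "length (concat (stake n s)) = (\<Sum>i<n. length (s !! i))" for n and s :: "'a list stream"
  proof (induction n)
    case (Suc n)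
    then show ?case by (simp add: stake_Suc del: stake.simps(2))
  qed simp
  have bound: "integrable (stream_space (step_law a)) (\<lambda>s. \<phi> (heap_of []) + C * (\<Sum>i<n. real (length (s !! i))))" for n
    by (intro Bochner_Integration.integrable_add integrable_mult_right Bochner_Integration.integrable_sum
        step.integrable_snth integrable_step_length) simp
  have "\<exists>c. AE s in stream_space (step_law a). (\<lambda>n. g n s / real n) \<longlonglongrightarrow> c"
  proof (rule kingman)
    show "ergodic_system (stream_space (step_law a)) (stl ^^ k)" if "1 \<le> k" for k
      by (rule step.ergodic_sdrop[OF that])
    show "g (m + n) s \<le> g m s + g n ((stl ^^ m) s)" for m n s
      unfolding g_def using phi_append[of "concat (stake m s)" "concat (stake n (sdrop m s))"]
      by (simp add: stake_add[symmetric] sdrop_eq_funpow)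
    show "0 \<le> g n s" for n s by (simp add: g_def nonneg)
    show "integrable (stream_space (step_law a)) (g n)" for n
    proof (rule Bochner_Integration.integrable_bound[OF bound[of n] meas], rule AE_I2)
      fix s
      have "0 \<le> g n s" by (simp add: g_def nonneg)
      moreover have "g n s \<le> \<phi> (heap_of []) + C * (\<Sum>i<n. real (length (s !! i)))"
        unfolding g_def using C(2)[of "concat (stake n s)"] by (simp add: len)
      ultimately show "norm (g n s) \<le> norm (\<phi> (heap_of []) + C * (\<Sum>i<n. real (length (s !! i))))" by simp
    qed
  qed
  then obtain c where "AE s in stream_space (step_law a). (\<lambda>n. g n s / real n) \<longlonglongrightarrow> c" by blast
  from AE_incr[OF this] show ?thesis unfolding g_def incr_word_def by blast
qed

lemma AE_phi_ratio:
  "\<exists>c. AE \<xi> in P. (\<lambda>n. \<phi> (heap_of (incr_word a n \<xi>)) / real (length (incr_word a n \<xi>))) \<longlonglongrightarrow> c"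
proof -
  obtain c where c: "AE \<xi> in P. (\<lambda>n. \<phi> (heap_of (incr_word a n \<xi>)) / real n) \<longlonglongrightarrow> c"
    using AE_phi_average by blast
  obtain l where l: "0 < l" "AE \<xi> in P. (\<lambda>n. real (length (incr_word a n \<xi>)) / real n) \<longlonglongrightarrow> l"
    using AE_length_average by blast
  have "AE \<xi> in P. (\<lambda>n. \<phi> (heap_of (incr_word a n \<xi>)) / real (length (incr_word a n \<xi>))) \<longlonglongrightarrow> c / l"
    using c l(2)
  proof eventually_elim
    case (elim \<xi>)
    have "(\<lambda>n. (\<phi> (heap_of (incr_word a n \<xi>)) / real n) / (real (length (incr_word a n \<xi>)) / real n)) \<longlonglongrightarrow> c / l"
      using elim l(1) by (intro tendsto_divide) auto
    moreover have "eventually (\<lambda>n. (\<phi> (heap_of (incr_word a n \<xi>)) / real n) / (real (length (incr_word a n \<xi>)) / real n)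
        = \<phi> (heap_of (incr_word a n \<xi>)) / real (length (incr_word a n \<xi>))) sequentially"
      using eventually_gt_at_top[of 0] by eventually_elim simp
    ultimately show ?case by (rule Lim_transform_eventually)
  qed
  then show ?thesis by blast
qed

text \<open>With \<open>J n\<close> the last visit to the step \<open>x\<close>, the heap
  \<open>B (m n)\<close> lies between \<open>A (J n)\<close> and \<open>A n\<close>, whose lengths
  have ratio tending to 1. Passing from \<open>B (m n)\<close> to \<open>A n\<close> adds to \<phi>
  at most a constant and a multiple of the difference in length, both negligible against
  \<open>s n\<close>.\<close>

lemma phi_ratio_le:
  assumes "a \<noteq> b"
    and ca: "AE \<xi> in P. (\<lambda>n. \<phi> (heap_of (incr_word a n \<xi>)) / real (length (incr_word a n \<xi>))) \<longlonglongrightarrow> ca"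
    and cb: "AE \<xi> in P. (\<lambda>n. \<phi> (heap_of (incr_word b n \<xi>)) / real (length (incr_word b n \<xi>))) \<longlonglongrightarrow> cb"
  shows "ca \<le> cb"
proof -
  obtain x where x: "x \<in> canon a" and sandwich:
    "\<And>\<xi> j n. \<xi> \<in> bdry I \<Longrightarrow> incr a \<xi> \<in> streams (canon a) \<Longrightarrow> incr b \<xi> \<in> streams (canon b) \<Longrightarrow>
      j < n \<Longrightarrow> incr a \<xi> !! j = x \<Longrightarrow>
      incr_word a j \<xi> \<preceq> incr_word b (count_list (incr_word a n \<xi>) b) \<xi> \<and>
      incr_word b (count_list (incr_word a n \<xi>) b) \<xi> \<preceq> incr_word a n \<xi>"
    using incr_word_sandwich[OF _ connected[of a b]] assms(1) by metis
  obtain l where l: "0 < l" "AE \<xi> in P. (\<lambda>n. real (length (incr_word a n \<xi>)) / real n) \<longlonglongrightarrow> l"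
    using AE_length_average by blast
  obtain C where C: "0 \<le> C" "\<And>w. \<phi> (heap_of w) \<le> \<phi> (heap_of []) + C * real (length w)"
    using phi_linear by blast
  \<comment> \<open>An inequality between two constants, shown almost surely so that all limits are
    available at a common \<xi>.\<close>
  have "AE \<xi> in P. ca \<le> cb"
    using ca cb l(2) AE_visit_average[OF x] AE_incr_canon[of a] AE_incr_canon[of b] AE_space
  proof eventually_elim
    case (elim \<xi>)
    define A where "A n = incr_word a n \<xi>" for n
    define B where "B n = incr_word b n \<xi>" for n
    define s where "s n = real (length (A n))" for n
    define t where "t n = real (length (B n))" for n
    define m where "m n = count_list (A n) b" for n
    have slim: "(\<lambda>n. s n / real n) \<longlonglongrightarrow> l" using elim(3) by (simp add: s_def A_def)
    obtain J where J: "eventually (\<lambda>n. J n < n \<and> incr a \<xi> !! J n = x) sequentially"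
      and Jlim: "(\<lambda>n. s (J n) / s n) \<longlonglongrightarrow> 1"
      using last_visit_ratio[OF elim(4) prob_Up_pos slim l(1)] by blast
    have sinf: "filterlim s at_top sequentially"
    proof -
      have "filterlim (\<lambda>n. s n / real n * real n) at_top sequentially"
        by (rule filterlim_tendsto_pos_mult_at_top[OF slim l(1) filterlim_real_sequentially])
      moreover have "eventually (\<lambda>n. s n / real n * real n \<le> s n) sequentially"
        using eventually_gt_at_top[of 0] by eventually_elim simp
      ultimately show ?thesis by (rule filterlim_at_top_mono)
    qed
    have sJinf: "filterlim (\<lambda>n. s (J n)) at_top sequentially"
    proof -
      have "filterlim (\<lambda>n. s (J n) / s n * s n) at_top sequentially"
        by (rule filterlim_tendsto_pos_mult_at_top[OF Jlim _ sinf]) simp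
      moreover have "eventually (\<lambda>n. s (J n) / s n * s n \<le> s (J n)) sequentially"
        using sinf[unfolded filterlim_at_top_dense, rule_format, of 0] by eventually_elim simp
      ultimately show ?thesis by (rule filterlim_at_top_mono)
    qed
    have key: "eventually (\<lambda>n. s (J n) \<le> t (m n) \<and> t (m n) \<le> s n \<and>
        \<phi> (heap_of (A n)) \<le> \<phi> (heap_of (B (m n))) + \<phi> (heap_of []) + C * (s n - s (J n))) sequentially"
      using J
    proof eventually_elim
      case (elim n)
      have le: "A (J n) \<preceq> B (m n)" "B (m n) \<preceq> A n"
        using sandwich[of \<xi> "J n" n] elim \<open>incr a \<xi> \<in> streams (canon a)\<close> \<open>incr b \<xi> \<in> streams (canon b)\<close> \<open>\<xi> \<in> space P\<close>
        by (auto simp: A_def B_def m_def)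
      have st: "s (J n) \<le> t (m n)" "t (m n) \<le> s n"
        using le[THEN tle_length] by (auto simp: s_def t_def)
      obtain r where r: "A n \<doteq> B (m n) @ r" using le(2) by (rule tleE)
      have "\<phi> (heap_of (A n)) = \<phi> (heap_of (B (m n) @ r))" using r by (simp flip: heap_of_eq_iff)
      also have "\<dots> \<le> \<phi> (heap_of (B (m n))) + (\<phi> (heap_of []) + C * real (length r))"
        using phi_append[of "B (m n)" r] C(2)[of r] by linarith
      also have "real (length r) = s n - t (m n)" using teq_length[OF r] by (simp add: s_def t_def)
      also have "C * (s n - t (m n)) \<le> C * (s n - s (J n))" using st C(1) by (intro mult_left_mono) auto
      finally show ?case using st by simp
    qed
    \<comment> \<open>\<open>B (m n)\<close> is at least as long as \<open>A (J n)\<close>, whose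
      length is unbounded, so its index cannot stay below any \<open>Z\<close>.\<close>
    have minf: "filterlim m at_top sequentially"
      unfolding filterlim_at_top
    proof
      fix Z
      show "eventually (\<lambda>n. Z \<le> m n) sequentially"
        using key sJinf[unfolded filterlim_at_top_dense, rule_format, of "t Z"]
      proof eventually_elim
        case (elim n)
        show ?case
        proof (rule ccontr)
          assume "\<not> Z \<le> m n"
          then have "prefix (B (m n)) (B Z)" unfolding B_def by (intro incr_word_mono) simp
          then have "t (m n) \<le> t Z" by (auto simp: t_def dest: prefix_length_le)
          then show False using elim by linarith
        qed
      qed
    qed
    have tlim: "(\<lambda>n. t (m n) / s n) \<longlonglongrightarrow> 1"
    proof (rule real_tendsto_sandwich[OF _ _ Jlim tendsto_const])
      show "eventually (\<lambda>n. s (J n) / s n \<le> t (m n) / s n) sequentially"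
        using key by eventually_elim (intro divide_right_mono, auto simp: s_def)
      show "eventually (\<lambda>n. t (m n) / s n \<le> 1) sequentially"
        using key sinf[unfolded filterlim_at_top_dense, rule_format, of 0] by eventually_elim simp
    qed
    have clim: "(\<lambda>n. \<phi> (heap_of (B (m n))) / t (m n)) \<longlonglongrightarrow> cb"
      using filterlim_compose[OF elim(2) minf] by (simp add: B_def t_def)
    have "(\<lambda>n. \<phi> (heap_of (B (m n))) / t (m n) * (t (m n) / s n) + \<phi> (heap_of []) / s n + C * (1 - s (J n) / s n))
        \<longlonglongrightarrow> cb * 1 + 0 + C * (1 - 1)"
      by (intro tendsto_add tendsto_mult tendsto_diff tendsto_const clim tlim Jlim
          tendsto_divide_0[OF tendsto_const] filterlim_at_top_imp_at_infinity sinf)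
    then have rhs: "(\<lambda>n. \<phi> (heap_of (B (m n))) / t (m n) * (t (m n) / s n) + \<phi> (heap_of []) / s n + C * (1 - s (J n) / s n))
        \<longlonglongrightarrow> cb" by simp
    have lhs: "(\<lambda>n. \<phi> (heap_of (A n)) / s n) \<longlonglongrightarrow> ca" using elim(1) by (simp add: A_def s_def)
    show ?case
    proof (rule tendsto_le[OF _ rhs lhs])
      show "eventually (\<lambda>n. \<phi> (heap_of (A n)) / s n \<le>
          \<phi> (heap_of (B (m n))) / t (m n) * (t (m n) / s n) + \<phi> (heap_of []) / s n + C * (1 - s (J n) / s n)) sequentially"
        using key sinf[unfolded filterlim_at_top_dense, rule_format, of 0]
          sJinf[unfolded filterlim_at_top_dense, rule_format, of 0]
      proof eventually_elim
        case (elim n)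
        then have pos: "0 < t (m n)" "0 < s n" by linarith+
        have "\<phi> (heap_of (A n)) / s n \<le> (\<phi> (heap_of (B (m n))) + \<phi> (heap_of []) + C * (s n - s (J n))) / s n"
          using elim pos by (intro divide_right_mono) auto
        also have "\<dots> = \<phi> (heap_of (B (m n))) / t (m n) * (t (m n) / s n) + \<phi> (heap_of []) / s n + C * (1 - s (J n) / s n)"
          using pos by (simp add: field_simps)
        finally show ?case .
      qed
    qed simp
  qed
  then show ?thesis by simp
qed

lemma phi_ratio_limit:
  "\<exists>c. \<forall>a. AE \<xi> in P. (\<lambda>n. \<phi> (Viter I a n \<xi>) / real (hlen (Viter I a n \<xi>))) \<longlonglongrightarrow> c"
proof -
  obtain c where c: "\<And>a. AE \<xi> in P. (\<lambda>n. \<phi> (heap_of (incr_word a n \<xi>)) / real (length (incr_word a n \<xi>))) \<longlonglongrightarrow> c a"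
    using choice[of "\<lambda>a c. AE \<xi> in P. (\<lambda>n. \<phi> (heap_of (incr_word a n \<xi>)) / real (length (incr_word a n \<xi>))) \<longlonglongrightarrow> c"]
      AE_phi_ratio by blast
  have eq: "c a = c b" for a b
    using phi_ratio_le[OF _ c c, of a b] phi_ratio_le[OF _ c c, of b a] by (cases "a = b") auto
  have "AE \<xi> in P. (\<lambda>n. \<phi> (Viter I a n \<xi>) / real (hlen (Viter I a n \<xi>))) \<longlonglongrightarrow> c a" for a
    using c[of a] AE_incr_canon[of a] AE_space
  proof eventually_elim
    case (elim \<xi>)
    then show ?case by (simp add: Viter_incr_word)
  qed
  \<comment> \<open>Any fixed letter serves as reference; \<open>undefined\<close> is just one of
    them.\<close>
  then have "AE \<xi> in P. (\<lambda>n. \<phi> (Viter I a n \<xi>) / real (hlen (Viter I a n \<xi>))) \<longlonglongrightarrow> c undefined" for a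
    unfolding eq[of a undefined, symmetric] .
  then show ?thesis by blast
qed

end
end

theorem theorem3:
  fixes I :: "'a::finite \<Rightarrow> 'a \<Rightarrow> bool"
    and P :: "(nat \<Rightarrow> 'a set) measure"
    and \<phi> :: "(nat \<Rightarrow> 'a set) \<Rightarrow> real"
  assumes "indep_ok I"
    and "bernoulli I P"
    and "\<forall>x\<in>fheaps I. \<phi> x \<ge> 0"
    and "\<forall>x\<in>fheaps I. \<forall>y\<in>fheaps I. \<phi> (hmul I x y) \<le> \<phi> x + \<phi> y"
  shows "\<exists>c::real. \<forall>a::'a. AE \<xi> in P.
           (\<lambda>n. \<phi> (Viter I a n \<xi>) / real (hlen (Viter I a n \<xi>))) \<longlonglongrightarrow> c"
proof -
  interpret bernoulli_heaps I P
    using assms(1,2) by unfold_locales (auto simp: indep_ok_def)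
  show ?thesis using assms(3,4) by (intro phi_ratio_limit) auto
qed

end
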